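(* Let $n\ge 7$ and let $(u_\lambda)$ be a family of least energy radial sign-changing solutions of $$-\Delta u=\lambda u+|u|^{2^*-2}u \ \text{ in } B_1,\qquad u=0\ \text{ on }\partial B_1,$$ with $u_\lambda(0)>0$. Consider the rescaled functions $$\tilde u_\lambda^+(y):=\frac{1}{M_{\lambda,+}}u_\lambda^+\Big(\frac{y}{M_{\lambda,+}^\beta}\Big)\ \text{ in } B_{\sigma_\lambda},\qquad \tilde u_\lambda^-(y):=\frac{1}{M_{\lambda,-}}u_\lambda^-\Big(\frac{y}{M_{\lambda,-}^\beta}\Big)\ \text{ in } A_{\rho_\lambda},$$ where $B_{\sigma_\lambda}:=M_{\lambda,+}^\beta B_{r_\lambda}$ and $A_{\rho_\lambda}:=M_{\lambda,-}^\beta A_{r_\lambda}$. Let $\mu=\sqrt{n(n-2)}$. Then: (i) $\tilde u_\lambda^+\to\delta_{0,\mu}$ in $C^2_{loc}(\mathbb{R}^n)$ as $\lambda\to0$; (ii) $\tilde u_\lambda^-\to\delta_{0,\mu}$ in $C^2_{loc}(\mathbb{R}^n\setminus\{0\})$ as $\lambda\to0$.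
   Context: $B_1$ is the open unit ball of $\mathbb{R}^n$, $2^*=\frac{2n}{n-2}$, $\beta:=\frac{2}{n-2}$, and $\lambda_1$ is the first Dirichlet eigenvalue of $-\Delta$ in $B_1$. A least energy radial sign-changing solution is a radial sign-changing solution minimizing $I_\lambda(u)=\frac12\int_{B_1}(|\nabla u|^2-\lambda u^2)\,dx-\frac1{2^*}\int_{B_1}|u|^{2^*}dx$ among all radial sign-changing solutions of the problem with parameter $\lambda$. The family consists of one such solution $u_\lambda$ for each $\lambda\in(0,\lambda_1)$; $\lambda\to 0$ means $\lambda\to0^+$. Solutions are classical; write $u_\lambda=u_\lambda(r)$, $r=|x|$. Each $u_\lambda$ has exactly two nodal regions: there is a node $r_\lambda\in(0,1)$ with $u_\lambda>0$ in $B_{r_\lambda}=\{|x|<r_\lambda\}$ and $u_\lambda<0$ in $A_{r_\lambda}:=\{x\in\mathbb{R}^n:\ r_\lambda<|x|<1\}$. Moreover $u_\lambda^+=\max(u_\lambda,0)$, $u_\lambda^-=\max(-u_\lambda,0)$, $M_{\lambda,\pm}:=\|u_\lambda^\pm\|_\infty$, $\sigma_\lambda:=M_{\lambda,+}^\beta r_\lambda$, $\rho_\lambda:=M_{\lambda,-}^\beta r_\lambda$, so $B_{\sigma_\lambda}=\{|y|<\sigma_\lambda\}$ and $A_{\rho_\lambda}=\{\rho_\lambda<|y|<M_{\lambda,-}^\beta\}$. For $\mu>0$, $x_0\in\mathbb{R}^n$: $\delta_{x_0,\mu}(x):=\dfrac{[n(n-2)\mu^2]^{(n-2)/4}}{[\mu^2+|x-x_0|^2]^{(n-2)/2}}$.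 Convergence in $C^2_{loc}(\Omega)$ for an open set $\Omega$ means: every compact $K\subset\Omega$ is contained in the domain of the rescaled function for all sufficiently small $\lambda$, and convergence holds in $C^2(K)$. *)

theory Defs
  imports "HOL-Analysis.Analysis"
begin

section \<open>Derivatives of order at most two\<close>

definition pd :: "'a::euclidean_space \<Rightarrow> ('a \<Rightarrow> real) \<Rightarrow> 'a \<Rightarrow> real" where
  "pd b f x = frechet_derivative f (at x) b"

definition grad :: "('a::euclidean_space \<Rightarrow> real) \<Rightarrow> 'a \<Rightarrow> 'a" where
  "grad f x = (\<Sum>b\<in>Basis. pd b f x *\<^sub>R b)"

definition laplacian :: "('a::euclidean_space \<Rightarrow> real) \<Rightarrow> 'a \<Rightarrow> real" where
  "laplacian f x = (\<Sum>b\<in>Basis. pd b (pd b f) x)"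

(* Meant for open S: differentiability is required "at x", not within S. *)
definition C2_on :: "'a::euclidean_space set \<Rightarrow> ('a \<Rightarrow> real) \<Rightarrow> bool" where
  "C2_on S f \<longleftrightarrow>
     (\<forall>x\<in>S. f differentiable (at x)) \<and>
     (\<forall>b\<in>Basis. \<forall>x\<in>S. pd b f differentiable (at x)) \<and>
     (\<forall>b\<in>Basis. \<forall>c\<in>Basis. continuous_on S (pd c (pd b f)))"

(* Convergence in C^2_loc(S) of functions f l with (open) domains D l, along the filter F.
   The values of f l outside D l are irrelevant. *)
definition C2_loc_tendsto ::
  "('l \<Rightarrow> 'a::euclidean_space set) \<Rightarrow> ('l \<Rightarrow> 'a \<Rightarrow> real) \<Rightarrow> ('a \<Rightarrow> real) \<Rightarrow> 'a set \<Rightarrow> 'l filter \<Rightarrow> bool"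
  where
  "C2_loc_tendsto D f g S F \<longleftrightarrow>
     C2_on S g \<and>
     (\<forall>K. compact K \<and> K \<subseteq> S \<longrightarrow>
        (\<forall>\<^sub>F l in F. \<exists>U. open U \<and> K \<subseteq> U \<and> U \<subseteq> D l \<and> C2_on U (f l)) \<and>
        uniform_limit K f g F \<and>
        (\<forall>b\<in>Basis. uniform_limit K (\<lambda>l. pd b (f l)) (pd b g) F) \<and>
        (\<forall>b\<in>Basis. \<forall>c\<in>Basis.
           uniform_limit K (\<lambda>l. pd c (pd b (f l))) (pd c (pd b g)) F))"

section \<open>The Brezis--Nirenberg problem in the unit ball\<close>

definition crit_exp :: "'a::euclidean_space itself \<Rightarrow> real" where
  "crit_exp _ = 2 * real DIM('a) / (real DIM('a) - 2)"

definition beta_exp :: "'a::euclidean_space itself \<Rightarrow> real" where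
  "beta_exp _ = 2 / (real DIM('a) - 2)"

definition dirichlet_eigenvalue :: "'a::euclidean_space itself \<Rightarrow> real \<Rightarrow> bool" where
  "dirichlet_eigenvalue _ \<Lambda> \<longleftrightarrow>
     (\<exists>\<phi>::'a \<Rightarrow> real. C2_on (ball 0 1) \<phi> \<and> continuous_on (cball 0 1) \<phi> \<and>
        (\<exists>x\<in>ball 0 1. \<phi> x \<noteq> 0) \<and>
        (\<forall>x\<in>ball 0 1. - laplacian \<phi> x = \<Lambda> * \<phi> x) \<and>
        (\<forall>x\<in>sphere 0 1. \<phi> x = 0))"

definition first_dirichlet_eigenvalue :: "'a::euclidean_space itself \<Rightarrow> real" where
  "first_dirichlet_eigenvalue T = Inf {\<Lambda>. dirichlet_eigenvalue T \<Lambda>}"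

definition BN_solution :: "real \<Rightarrow> ('a::euclidean_space \<Rightarrow> real) \<Rightarrow> bool" where
  "BN_solution lam u \<longleftrightarrow>
     C2_on (ball 0 1) u \<and> continuous_on (cball 0 1) u \<and>
     (\<forall>x\<in>ball 0 1. - laplacian u x =
        lam * u x + \<bar>u x\<bar> powr (crit_exp TYPE('a) - 2) * u x) \<and>
     (\<forall>x\<in>sphere 0 1. u x = 0)"

definition radial :: "('a::euclidean_space \<Rightarrow> real) \<Rightarrow> bool" where
  "radial u \<longleftrightarrow> (\<forall>x\<in>cball 0 1. \<forall>y\<in>cball 0 1. norm x = norm y \<longrightarrow> u x = u y)"

definition sign_changing :: "('a::euclidean_space \<Rightarrow> real) \<Rightarrow> bool" where
  "sign_changing u \<longleftrightarrow> (\<exists>x\<in>ball 0 1. u x > 0) \<and> (\<exists>x\<in>ball 0 1. u x < 0)"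

definition BN_energy :: "real \<Rightarrow> ('a::euclidean_space \<Rightarrow> real) \<Rightarrow> real" where
  "BN_energy lam u =
     1 / 2 * (LINT x:ball 0 1|lborel. (norm (grad u x))\<^sup>2 - lam * (u x)\<^sup>2)
     - 1 / crit_exp TYPE('a) * (LINT x:ball 0 1|lborel. \<bar>u x\<bar> powr crit_exp TYPE('a))"

definition radial_sign_changing_solution :: "real \<Rightarrow> ('a::euclidean_space \<Rightarrow> real) \<Rightarrow> bool" where
  "radial_sign_changing_solution lam u \<longleftrightarrow> BN_solution lam u \<and> radial u \<and> sign_changing u"

definition least_energy_radial_sign_changing_solution ::
  "real \<Rightarrow> ('a::euclidean_space \<Rightarrow> real) \<Rightarrow> bool" where
  "least_energy_radial_sign_changing_solution lam u \<longleftrightarrow>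
     radial_sign_changing_solution lam u \<and>
     (\<forall>v::'a \<Rightarrow> real. radial_sign_changing_solution lam v \<longrightarrow> BN_energy lam u \<le> BN_energy lam v)"

section \<open>Rescaling\<close>

definition pos_fun :: "('a \<Rightarrow> real) \<Rightarrow> 'a \<Rightarrow> real" where
  "pos_fun u x = max (u x) 0"

definition neg_fun :: "('a \<Rightarrow> real) \<Rightarrow> 'a \<Rightarrow> real" where
  "neg_fun u x = max (- u x) 0"

definition sup_norm :: "('a::euclidean_space \<Rightarrow> real) \<Rightarrow> real" where
  "sup_norm v = (SUP x\<in>ball 0 1. \<bar>v x\<bar>)"

(* The smallest radius at which u vanishes. If u is radial, positive in {|x| < r} and
   negative in {r < |x| < 1} with 0 < r < 1, then this is r. *)
definition node :: "('a::euclidean_space \<Rightarrow> real) \<Rightarrow> real" where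
  "node u = Inf {r. 0 < r \<and> r \<le> 1 \<and> (\<exists>x. norm x = r \<and> u x = 0)}"

definition rescale :: "('a::euclidean_space \<Rightarrow> real) \<Rightarrow> 'a \<Rightarrow> real" where
  "rescale v y = 1 / sup_norm v * v (y /\<^sub>R (sup_norm v powr beta_exp TYPE('a)))"

definition ball_rescaled :: "('a::euclidean_space \<Rightarrow> real) \<Rightarrow> 'a set" where
  "ball_rescaled u =
     {y. norm y < sup_norm (pos_fun u) powr beta_exp TYPE('a) * node u}"

definition annulus_rescaled :: "('a::euclidean_space \<Rightarrow> real) \<Rightarrow> 'a set" where
  "annulus_rescaled u =
     {y. sup_norm (neg_fun u) powr beta_exp TYPE('a) * node u < norm y \<and>
         norm y < sup_norm (neg_fun u) powr beta_exp TYPE('a)}"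

definition bubble :: "'a::euclidean_space \<Rightarrow> real \<Rightarrow> 'a \<Rightarrow> real" where
  "bubble x0 \<mu> x =
     (real DIM('a) * (real DIM('a) - 2) * \<mu>\<^sup>2) powr ((real DIM('a) - 2) / 4) /
     (\<mu>\<^sup>2 + (norm (x - x0))\<^sup>2) powr ((real DIM('a) - 2) / 2)"

end

theory Submission
  imports Defs
begin

text \<open>
  Only the radial equation is needed, not the energy: write \<open>u = \<phi>(|x|)\<close> and rescale a nodal piece to amplitude 1.
  The rescaled profile then solves the same equation with \<open>\<epsilon> = \<lambda> M\<^sup>-\<^sup>2\<^sup>\<beta>\<close> in front of the linear term, and
  \<open>\<epsilon> \<le> \<lambda>\<close> because a maximum principle on the unit ball gives \<open>\<lambda> + M\<^sup>2\<^sup>\<beta> \<ge> n\<close>. A Gronwall estimate for the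
  distance to the bubble shows that a profile with value 1 and slope 0 at a radius \<open>s\<close> is close to the bubble
  whenever \<open>\<epsilon>\<close> and \<open>s\<close> are small; in particular its next zero moves off to infinity. For the positive part
  \<open>s = 0\<close>. For the negative part \<open>s\<close> is the rescaled position of the minimum, and smallness of \<open>s\<close> comes from
  the Pohozaev functional \<open>P\<close>, with \<open>P' = \<epsilon> r\<^sup>n\<^sup>-\<^sup>1 v\<^sup>2\<close>: since \<open>P \<ge> 0\<close>, the slope \<open>- r v' / v\<close> increases up to
  the node, so \<open>v\<close> decays like \<open>r\<^sup>3\<^sup>-\<^sup>n\<close> there and \<open>P = O(\<epsilon>)\<close> at the node, while at the minimum \<open>P\<close>
  controls \<open>s\<^sup>n\<close>.
\<close>

section \<open>The radial equation\<close>

text \<open>The obstacle is the negative part: its profile starts at the minimum, and nothing local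
  there says that the rescaled radius is small. That information has to be carried from the origin
  through the node. The Pohozaev functional can do this because at the critical exponent every term
  of its derivative except the one with \<open>eps\<close> cancels. The exponent
  \<open>n - 3\<close> is a compromise. The slope of the bubble tends to \<open>n - 2\<close> but
  stays below it, so a smaller value has to be certified at a finite radius; with
  \<open>n - 3\<close> the tail of \<open>r^(n-1) v^2\<close> behaves like \<open>r^(5-n)\<close>,
  which is integrable exactly for \<open>n > 6\<close>. A second issue is the range of
  \<open>lam\<close>. The solutions are given only below \<open>first_dirichlet_eigenvalue\<close>,
  an infimum of a set of reals, so the limit at \<open>0\<close> has content only once this infimum
  is known to be positive. This requires a lower bound for all eigenvalues, from the same maximum
  principle, and the existence of at least one, for which a Bessel series is built by hand.\<close>

lemma DERIV_abs_powr_mult: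
  fixes a x :: real
  assumes "a > 0"
  shows "((\<lambda>x. \<bar>x\<bar> powr a * x) has_real_derivative (a + 1) * \<bar>x\<bar> powr a) (at x)"
proof (cases "x = 0")
  case True
  have "((\<lambda>h. \<bar>h\<bar> powr a) \<longlongrightarrow> 0) (at (0::real))"
    using assms by (auto intro!: tendsto_eq_intros)
  then have "((\<lambda>h. (\<bar>h\<bar> powr a * h) / h) \<longlongrightarrow> 0) (at (0::real))"
    by (rule Lim_transform_eventually) (auto simp: eventually_at_filter)
  with True assms show ?thesis
    by (simp add: DERIV_def)
next
  case False
  have "((\<lambda>x. (x * sgn x) powr a * x) has_real_derivative (a + 1) * \<bar>x\<bar> powr a) (at x)"
  proof (cases "x > 0")
    case True
    have "((\<lambda>x. x powr a * x) has_real_derivative (a + 1) * \<bar>x\<bar> powr a) (at x)"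
      using True by (auto intro!: derivative_eq_intros simp: powr_diff field_simps)
    moreover have "\<forall>\<^sub>F y in nhds x. y powr a * y = (y * sgn y) powr a * y"
      using True by (auto intro!: eventually_mono[OF eventually_nhds_in_open[of "{0<..}"]])
    ultimately show ?thesis
      by (rule DERIV_cong_ev[OF refl _ refl, THEN iffD1, rotated])
  next
    case n: False
    with False have "x < 0" by simp
    then have "((\<lambda>x. (- x) powr a * x) has_real_derivative (a + 1) * \<bar>x\<bar> powr a) (at x)"
      by (auto intro!: derivative_eq_intros simp: powr_diff field_simps)
    moreover have "\<forall>\<^sub>F y in nhds x. (- y) powr a * y = (y * sgn y) powr a * y"
      using \<open>x < 0\<close> by (auto intro!: eventually_mono[OF eventually_nhds_in_open[of "{..<0}"]])
    ultimately show ?thesis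
      by (rule DERIV_cong_ev[OF refl _ refl, THEN iffD1, rotated])
  qed
  then show ?thesis
    by (simp add: abs_sgn)
qed

lemma DERIV_abs_powr_add2:
  fixes a x :: real
  assumes "a > 0"
  shows "((\<lambda>x. \<bar>x\<bar> powr (a + 2)) has_real_derivative (a + 2) * (\<bar>x\<bar> powr a * x)) (at x)"
proof -
  have eq: "\<bar>x\<bar> powr (a + 2) = (\<bar>x\<bar> powr a * x) * x" for x :: real
    by (cases "x = 0") (auto simp: powr_add powr_numeral power2_eq_square)
  show ?thesis
    unfolding eq by (rule DERIV_cong, rule DERIV_mult[OF DERIV_abs_powr_mult[OF assms] DERIV_ident])
      (simp add: algebra_simps)
qed

lemma abs_powr_mult_lipschitz:
  fixes a x y :: real
  assumes "a > 0" "\<bar>x\<bar> \<le> 1" "\<bar>y\<bar> \<le> 1"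
  shows "\<bar>\<bar>x\<bar> powr a * x - \<bar>y\<bar> powr a * y\<bar> \<le> (a + 1) * \<bar>x - y\<bar>"
proof -
  have "norm (\<bar>x\<bar> powr a * x - \<bar>y\<bar> powr a * y) \<le> (a + 1) * norm (x - y)"
  proof (rule field_differentiable_bound[of "{-1..1}"])
    fix z :: real assume "z \<in> {-1..1}"
    then show "norm ((a + 1) * \<bar>z\<bar> powr a) \<le> a + 1"
      using assms powr_le1[of a "\<bar>z\<bar>"] by (auto simp: abs_mult intro!: mult_left_le)
    show "((\<lambda>x. \<bar>x\<bar> powr a * x) has_field_derivative (a + 1) * \<bar>z\<bar> powr a) (at z within {-1..1})"
      using DERIV_abs_powr_mult[OF assms(1)] has_field_derivative_at_within by blast
  qed (use assms in auto)
  then show ?thesis by simp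
qed

text \<open>Derivatives are required only on the open interval: the equation is singular at
  \<open>0\<close>, where \<open>v1 0 = 0\<close> records regularity at the centre, and at
  \<open>L\<close> a classical solution is known only to be continuous.\<close>

locale radial_ode =
  fixes n :: nat and b eps L :: real and v v1 v2 :: "real \<Rightarrow> real"
  assumes n: "n \<ge> 7" and b: "b = 2 / (real n - 2)" and eps: "eps \<ge> 0" and L: "L > 0"
    and cont: "continuous_on {0..L} v" and cont1: "continuous_on {0..<L} v1" and v1_0: "v1 0 = 0"
    and der: "\<And>r. 0 < r \<Longrightarrow> r < L \<Longrightarrow> (v has_real_derivative v1 r) (at r)"
    and der1: "\<And>r. 0 < r \<Longrightarrow> r < L \<Longrightarrow> (v1 has_real_derivative v2 r) (at r)"
    and ode: "\<And>r. 0 < r \<Longrightarrow> r < L \<Longrightarrow>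
      v2 r = - (real n - 1) / r * v1 r - (eps * v r + \<bar>v r\<bar> powr (2 * b) * v r)"
begin

text \<open>The fact \<open>nb\<close> is criticality: both sides equal
  \<open>2 n / (n - 2)\<close>.\<close>

lemma b_pos: "b > 0" and b_le: "2 * b \<le> 1" and nb: "2 * b + 2 = real n * b"
  using n by (auto simp: b field_simps)

text \<open>Lets the simplifier compute with \<open>n - 1\<close> up to \<open>n - 4\<close> as
  exponents, free of truncated subtraction.\<close>

lemma n_eq: "\<exists>k. n = Suc (Suc (Suc (Suc k)))"
  using n by (intro exI[of _ "n - 4"]) simp

text \<open>The potential of the nonlinearity, so that \<open>v1^2 / 2 + F v\<close> is the
  mechanical energy of the equation.\<close>

definition F :: "real \<Rightarrow> real" where
  "F x = eps * x\<^sup>2 / 2 + \<bar>x\<bar> powr (2 * b + 2) / (2 * b + 2)"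

lemma DERIV_F: "(F has_real_derivative eps * x + \<bar>x\<bar> powr (2 * b) * x) (at x)"
proof -
  have "((\<lambda>x. eps * x\<^sup>2 / 2) has_real_derivative eps * x) (at x)"
    by (auto intro!: derivative_eq_intros)
  from DERIV_add[OF this DERIV_cdivide[OF DERIV_abs_powr_add2[of "2 * b" x], of "2 * b + 2"]]
  show ?thesis using b_pos unfolding F_def[abs_def] by simp
qed

lemma continuous_on_F [continuous_intros]:
  "continuous_on A g \<Longrightarrow> continuous_on A (\<lambda>x. F (g x))"
  by (rule continuous_on_compose2[of UNIV F])
    (auto intro!: DERIV_continuous_on[OF has_field_derivative_at_within[OF DERIV_F]])

lemma F_le_imp: assumes "F x \<le> F y" shows "\<bar>x\<bar> \<le> \<bar>y\<bar>"
proof (rule ccontr)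
  assume "\<not> \<bar>x\<bar> \<le> \<bar>y\<bar>"
  then have l: "\<bar>y\<bar> < \<bar>x\<bar>" by simp
  then have "\<bar>y\<bar> powr (2 * b + 2) < \<bar>x\<bar> powr (2 * b + 2)"
    using b_pos by (intro powr_less_mono2) auto
  moreover have "eps * y\<^sup>2 \<le> eps * x\<^sup>2"
    using l eps by (intro mult_left_mono) (auto simp: abs_le_square_iff[symmetric])
  ultimately show False
    using assms b_pos divide_strict_right_mono[of "\<bar>y\<bar> powr (2 * b + 2)" "\<bar>x\<bar> powr (2 * b + 2)" "2 * b + 2"]
    unfolding F_def by linarith
qed

lemma cont_sub: "0 \<le> x \<Longrightarrow> y \<le> L \<Longrightarrow> continuous_on {x..y} v"
  and cont1_sub: "0 \<le> x \<Longrightarrow> y < L \<Longrightarrow> continuous_on {x..y} v1"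
  by (auto intro: continuous_on_subset[OF cont] continuous_on_subset[OF cont1])

text \<open>The first-order term is friction: the mechanical energy changes at the rate
  \<open>- (n - 1) / r * v1^2\<close>.\<close>

lemma F_le: assumes "0 \<le> t" "t \<le> r" "r < L" shows "(v1 r)\<^sup>2 / 2 + F (v r) \<le> (v1 t)\<^sup>2 / 2 + F (v t)"
proof (rule DERIV_nonpos_imp_decreasing_open[OF assms(2), where f = "\<lambda>r. (v1 r)\<^sup>2 / 2 + F (v r)"])
  fix x assume x: "t < x" "x < r"
  then have x0: "0 < x" "x < L" using assms by auto
  have "((\<lambda>r. (v1 r)\<^sup>2 / 2 + F (v r)) has_real_derivative
      v1 x * v2 x + (eps * v x + \<bar>v x\<bar> powr (2 * b) * v x) * v1 x) (at x)"
    by (auto intro!: derivative_eq_intros der[OF x0] der1[OF x0] DERIV_chain2[OF DERIV_F])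
  also have "v1 x * v2 x + (eps * v x + \<bar>v x\<bar> powr (2 * b) * v x) * v1 x = - (real n - 1) / x * (v1 x)\<^sup>2"
    unfolding ode[OF x0] by (simp add: algebra_simps power2_eq_square)
  finally have "((\<lambda>r. (v1 r)\<^sup>2 / 2 + F (v r)) has_real_derivative - (real n - 1) / x * (v1 x)\<^sup>2) (at x)" .
  moreover have "- (real n - 1) / x * (v1 x)\<^sup>2 \<le> 0"
    using n x0 by (intro mult_nonpos_nonneg divide_nonpos_pos) auto
  ultimately show "\<exists>y. ((\<lambda>r. (v1 r)\<^sup>2 / 2 + F (v r)) has_real_derivative y) (at x) \<and> y \<le> 0"
    by blast
next
  show "continuous_on {t..r} (\<lambda>r. (v1 r)\<^sup>2 / 2 + F (v r))"
    using assms by (intro continuous_intros cont_sub cont1_sub) auto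
qed

text \<open>At a critical point all energy is potential and \<open>F\<close> is strictly increasing
  in the modulus, so later values cannot be larger. Applied at the centre and at the
  minimum.\<close>

lemma abs_le_critical:
  assumes "0 \<le> t" "t \<le> r" "r < L" "v1 t = 0" shows "\<bar>v r\<bar> \<le> \<bar>v t\<bar>"
proof -
  have "F (v r) \<le> F (v t)" using F_le[OF assms(1-3)] unfolding assms(4)
    by (rule order_trans[rotated, THEN order_trans]) simp_all
  then show ?thesis by (rule F_le_imp)
qed

section \<open>The Pohozaev functional and the decay up to the first zero\<close>

definition P :: "real \<Rightarrow> real" where
  "P r = r ^ n * ((v1 r)\<^sup>2 / 2 + F (v r)) + (real n - 2) / 2 * r ^ (n - 1) * v r * v1 r"

text \<open>The power terms cancel because \<open>n / (n b) = (n - 2) / 2\<close>. The linear terms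
  leave \<open>n / 2 - (n - 2) / 2 = 1\<close> times \<open>eps * v^2\<close>.\<close>

lemma DERIV_P: assumes "0 < r" "r < L"
  shows "(P has_real_derivative eps * r ^ (n - 1) * (v r)\<^sup>2) (at r)"
proof -
  obtain k where k: "n = Suc (Suc (Suc (Suc k)))" using n_eq by blast
  define g where "g = \<bar>v r\<bar> powr (2 * b)"
  have gF: "real n * F (v r) = eps * (v r)\<^sup>2 * real n / 2 + (real n - 2) / 2 * g * (v r)\<^sup>2"
  proof -
    have "\<bar>v r\<bar> powr (2 * b + 2) = g * (v r)\<^sup>2"
      by (cases "v r = 0") (auto simp: g_def powr_add powr_numeral)
    then have "real n * F (v r) = eps * (v r)\<^sup>2 * real n / 2 + g * (v r)\<^sup>2 * (real n / (real n * b))"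
      unfolding F_def nb by (simp add: algebra_simps)
    also have "real n / (real n * b) = (real n - 2) / 2"
      using n by (simp add: b)
    finally show ?thesis by (simp add: algebra_simps)
  qed
  have "(P has_real_derivative real n * r ^ (n - 1) * ((v1 r)\<^sup>2 / 2 + F (v r))
      + r ^ n * (v1 r * v2 r + (eps * v r + g * v r) * v1 r)
      + (real n - 2) / 2 * (real (n - 1) * r ^ (n - 2) * v r * v1 r + r ^ (n - 1) * (v1 r)\<^sup>2 + r ^ (n - 1) * v r * v2 r)) (at r)"
    unfolding P_def[abs_def] g_def
    by (auto intro!: derivative_eq_intros der[OF assms] der1[OF assms] DERIV_chain2[OF DERIV_F])
       (simp add: k algebra_simps power2_eq_square)
  moreover have "real n * r ^ (n - 1) * ((v1 r)\<^sup>2 / 2 + F (v r))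
      + r ^ n * (v1 r * v2 r + (eps * v r + g * v r) * v1 r)
      + (real n - 2) / 2 * (real (n - 1) * r ^ (n - 2) * v r * v1 r + r ^ (n - 1) * (v1 r)\<^sup>2 + r ^ (n - 1) * v r * v2 r)
     = eps * r ^ (n - 1) * (v r)\<^sup>2" (is "?l = _")
  proof -
    have v2: "r * v2 r = - (real n - 1) * v1 r - r * (eps * v r + g * v r)"
      using ode[OF assms] assms by (simp add: g_def field_simps)
    have "?l = r ^ Suc (Suc k) * (r * (real n * F (v r)) + r * real n * (v1 r)\<^sup>2 / 2 
      + r * v1 r * (r * v2 r) + r * r * (eps * v r + g * v r) * v1 r
      + (real n - 2) / 2 * ((real n - 1) * v r * v1 r + r * (v1 r)\<^sup>2 + v r * (r * v2 r)))"
      by (simp add: k algebra_simps power2_eq_square)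
    also have "\<dots> = r ^ Suc (Suc k) * (r * eps * (v r)\<^sup>2)"
      unfolding v2 gF by (simp add: algebra_simps power2_eq_square add_divide_distrib diff_divide_distrib)
    finally show ?thesis by (simp add: k algebra_simps)
  qed
  ultimately show ?thesis by simp
qed

lemma continuous_on_P: "0 \<le> x \<Longrightarrow> y < L \<Longrightarrow> continuous_on {x..y} P"
  unfolding P_def[abs_def] by (intro continuous_intros cont_sub cont1_sub) auto

lemma P_mono:
  assumes "0 \<le> x" "x \<le> y" "y < L" shows "P x \<le> P y"
proof (rule DERIV_nonneg_imp_increasing_open[OF assms(2)])
  fix z assume "x < z" "z < y"
  then show "\<exists>d. (P has_real_derivative d) (at z) \<and> 0 \<le> d"
    using DERIV_P[of z] assms eps by (intro exI[of _ "eps * z ^ (n - 1) * (v z)\<^sup>2"]) auto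
qed (use continuous_on_P assms in auto)

lemma P_nonneg: "0 \<le> r \<Longrightarrow> r < L \<Longrightarrow> 0 \<le> P r"
  using P_mono[of 0 r] n by (simp add: P_def power_0_left)

text \<open>In divergence form the equation says that \<open>r^(n-1) v1\<close> is strictly
  decreasing while \<open>v\<close> is positive. The case \<open>r = r1\<close> matters: it makes a
  first zero transversal.\<close>

lemma v1_neg:
  assumes "0 < r" "r \<le> r1" "r1 < L" and pos: "\<And>t. 0 < t \<Longrightarrow> t < r1 \<Longrightarrow> 0 < v t"
  shows "v1 r < 0"
proof -
  have "r ^ (n - 1) * v1 r < 0 ^ (n - 1) * v1 0"
  proof (rule DERIV_neg_imp_decreasing_open[OF assms(1), where f = "\<lambda>r. r ^ (n - 1) * v1 r"])
    fix x assume x: "0 < x" "x < r"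
    then have x0: "0 < x" "x < L" using assms(1-3) by auto
    have vx: "0 < v x" using x assms(1-3) by (intro pos) auto
    obtain k where k: "n = Suc (Suc (Suc (Suc k)))" using n_eq by blast
    have "((\<lambda>r. r ^ (n - 1) * v1 r) has_real_derivative (real n - 1) * x ^ (n - 2) * v1 x + x ^ (n - 1) * v2 x) (at x)"
      by (rule DERIV_cong[OF DERIV_mult[OF DERIV_pow der1[OF x0]]]) (simp add: k algebra_simps)
    also have "(real n - 1) * x ^ (n - 2) * v1 x + x ^ (n - 1) * v2 x = - (x ^ (n - 1) * (eps * v x + \<bar>v x\<bar> powr (2 * b) * v x))"
      unfolding ode[OF x0] using x0 by (simp add: k field_simps)
    finally have "((\<lambda>r. r ^ (n - 1) * v1 r) has_real_derivative
        - (x ^ (n - 1) * (eps * v x + \<bar>v x\<bar> powr (2 * b) * v x))) (at x)" .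
    moreover have "- (x ^ (n - 1) * (eps * v x + \<bar>v x\<bar> powr (2 * b) * v x)) < 0"
      using x0 vx eps by (auto intro!: mult_pos_pos add_nonneg_pos)
    ultimately show "\<exists>y. ((\<lambda>r. r ^ (n - 1) * v1 r) has_real_derivative y) (at x) \<and> y < 0"
      by blast
  qed (use assms(1-3) cont1_sub[of 0 r] in \<open>auto intro!: continuous_intros\<close>)
  then have "r ^ (n - 1) * v1 r < 0" using n by (simp add: power_0_left)
  then show ?thesis using assms(1) by (smt (verit) zero_le_power zero_le_mult_iff)
qed

text \<open>Positivity of the Pohozaev functional is what forces the logarithmic slope to increase.\<close>

lemma slope_mono:
  assumes "0 < x" "x \<le> y" "y < L" and pos: "\<And>t. x \<le> t \<Longrightarrow> t \<le> y \<Longrightarrow> 0 < v t"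
  shows "- x * v1 x / v x \<le> - y * v1 y / v y"
proof (rule DERIV_nonneg_imp_increasing_open[OF assms(2), where f = "\<lambda>r. - r * v1 r / v r"])
  fix r assume r: "x < r" "r < y"
  then have r0: "0 < r" "r < L" using assms(1-3) by auto
  have vr: "0 < v r" using r assms(1-3) by (intro pos) auto
  define g where "g = \<bar>v r\<bar> powr (2 * b)"
  have g: "g \<ge> 0" by (simp add: g_def)
  obtain k where k: "n = Suc (Suc (Suc (Suc k)))" using n_eq by blast
  have d: "((\<lambda>r. - r * v1 r / v r) has_real_derivative
      ((- v1 r - r * v2 r) * v r + r * v1 r * v1 r) / (v r * v r)) (at r)"
    using vr by (auto intro!: derivative_eq_intros der[OF r0] der1[OF r0] simp: field_simps)
  have v2: "r * v2 r = - (real n - 1) * v1 r - r * (eps * v r + g * v r)"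
    using ode[OF r0] r0 by (simp add: g_def field_simps)
  have "\<bar>v r\<bar> powr (2 * b + 2) = g * (v r)\<^sup>2"
    using vr by (auto simp: g_def powr_add powr_numeral)
  \<comment> \<open>Weakening \<open>1 / (2 * b + 2)\<close> to \<open>1 / 2\<close> makes the bound
    obtained from \<open>P r \<ge> 0\<close> exactly half of the numerator of the derivative in
    \<open>d\<close>.\<close>
  moreover have "g * (v r)\<^sup>2 / (2 * b + 2) \<le> g * (v r)\<^sup>2 / 2"
    using b_pos g by (intro divide_left_mono) auto
  ultimately have F: "F (v r) \<le> eps * (v r)\<^sup>2 / 2 + g * (v r)\<^sup>2 / 2"
    by (simp add: F_def)
  have "r ^ n = r ^ Suc (Suc k) * (r * r)" "r ^ (n - 1) = r ^ Suc (Suc k) * r"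
    by (simp_all add: k)
  then have "P r = r ^ Suc (Suc k) * (r * (r * ((v1 r)\<^sup>2 / 2 + F (v r)) + (real n - 2) / 2 * v r * v1 r))"
    unfolding P_def by (simp only:) (simp only: algebra_simps)
  then have "0 \<le> r * ((v1 r)\<^sup>2 / 2 + F (v r)) + (real n - 2) / 2 * v r * v1 r"
    using P_nonneg[of r] r0 by (metis zero_le_mult_iff zero_less_power not_le less_imp_le)
  also have "\<dots> \<le> r * ((v1 r)\<^sup>2 / 2 + (eps * (v r)\<^sup>2 / 2 + g * (v r)\<^sup>2 / 2)) + (real n - 2) / 2 * v r * v1 r"
    using F r0 by auto
  also have "\<dots> = ((- v1 r - r * v2 r) * v r + r * v1 r * v1 r) / 2"
    unfolding v2 by (simp add: algebra_simps power2_eq_square add_divide_distrib diff_divide_distrib)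
  finally have "0 \<le> ((- v1 r - r * v2 r) * v r + r * v1 r * v1 r) / (v r * v r)"
    using vr by (intro divide_nonneg_pos) auto
  with d show "\<exists>d. ((\<lambda>r. - r * v1 r / v r) has_real_derivative d) (at r) \<and> 0 \<le> d"
    by blast
next
  show "continuous_on {x..y} (\<lambda>r. - r * v1 r / v r)"
    using assms(1-3) pos by (intro continuous_intros cont_sub cont1_sub ballI) (auto dest!: pos)
qed

text \<open>By \<open>slope_mono\<close> the slope bound at \<open>R\<close> persists, and slope at
  least \<open>n - 3\<close> means precisely that \<open>r^(n-3) v\<close> has nonpositive
  derivative.\<close>

lemma decay:
  assumes "0 < R" "R \<le> r" "r < L" and pos: "\<And>t. R \<le> t \<Longrightarrow> t \<le> r \<Longrightarrow> 0 < v t"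
    and slope: "real n - 3 \<le> - R * v1 R / v R"
  shows "r ^ (n - 3) * v r \<le> R ^ (n - 3) * v R"
proof (rule DERIV_nonpos_imp_decreasing_open[OF assms(2), where f = "\<lambda>r. r ^ (n - 3) * v r"])
  fix x assume x: "R < x" "x < r"
  then have x0: "0 < x" "x < L" using assms(1-3) by auto
  have vx: "0 < v x" using x assms(1-3) by (intro pos) auto
  obtain k where k: "n = Suc (Suc (Suc (Suc k)))" using n_eq by blast
  have "real n - 3 \<le> - x * v1 x / v x"
    using slope_mono[of R x] assms x by (smt (verit))
  then have "(real n - 3) * v x + x * v1 x \<le> 0" using vx by (simp add: field_simps)
  moreover have "((\<lambda>r. r ^ (n - 3) * v r) has_real_derivative x ^ (n - 4) * ((real n - 3) * v x + x * v1 x)) (at x)"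
    by (rule DERIV_cong[OF DERIV_mult[OF DERIV_pow der[OF x0]]]) (simp add: k algebra_simps)
  moreover have "x ^ (n - 4) * ((real n - 3) * v x + x * v1 x) \<le> 0" if "(real n - 3) * v x + x * v1 x \<le> 0"
    using x0 that by (auto intro!: mult_nonneg_nonpos)
  ultimately show "\<exists>d. ((\<lambda>r. r ^ (n - 3) * v r) has_real_derivative d) (at x) \<and> d \<le> 0"
    by blast
qed (use assms(1-3) cont_sub[of R r] in \<open>auto intro!: continuous_intros\<close>)

text \<open>The integral of \<open>P'\<close>, split at \<open>R\<close>. Inside,
  \<open>v^2 \<le> 1\<close> gives \<open>R^n / n\<close>. Outside,
  \<open>v \<le> (R / r)^(n-3)\<close> gives the tail integral \<open>R^n / (n - 6)\<close>, finite
  because \<open>n \<ge> 7\<close>.\<close>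

lemma P_first_zero_le:
  assumes R: "0 < R" "R \<le> r1" "r1 < L" and pos: "\<And>t. 0 \<le> t \<Longrightarrow> t < r1 \<Longrightarrow> 0 < v t"
    and v0: "v 0 = 1" and slope: "real n - 3 \<le> - R * v1 R / v R"
  shows "P r1 \<le> eps * (R ^ n / real n + R ^ n / (real n - 6))"
proof -
  have le1: "\<bar>v r\<bar> \<le> 1" if "0 \<le> r" "r < L" for r
    using abs_le_critical[of 0 r] that v1_0 v0 by simp
  \<comment> \<open>With this \<open>k\<close>, the exponents \<open>n - 3\<close> and
    \<open>n - 6\<close> become \<open>k + 4\<close> and \<open>k + 1\<close>.\<close>
  obtain k where k: "n = k + 7" using n le_Suc_ex by (metis add.commute)
  have "P R - eps * R ^ n / real n \<le> P 0 - eps * 0 ^ n / real n"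
  proof (rule DERIV_nonpos_imp_decreasing_open[of 0 R "\<lambda>r. P r - eps * r ^ n / real n"])
    fix x assume "0 < x" "x < R"
    then have x: "0 < x" "x < L" using R by auto
    have "((\<lambda>r. P r - eps * r ^ n / real n) has_real_derivative
        eps * x ^ (n - 1) * (v x)\<^sup>2 - eps * x ^ (n - 1)) (at x)"
      by (rule DERIV_cong[OF DERIV_diff[OF DERIV_P[OF x] DERIV_cdivide[OF DERIV_cmult[OF DERIV_pow]]]])
        (use n in \<open>simp add: field_simps\<close>)
    moreover have "(v x)\<^sup>2 \<le> 1" using le1[of x] x by (simp add: abs_square_le_1)
    then have "eps * x ^ (n - 1) * (v x)\<^sup>2 \<le> eps * x ^ (n - 1) * 1"
      using x eps by (intro mult_left_mono) auto
    ultimately show "\<exists>y. ((\<lambda>r. P r - eps * r ^ n / real n) has_real_derivative y) (at x) \<and> y \<le> 0"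
      by (intro exI[of _ "eps * x ^ (n - 1) * (v x)\<^sup>2 - eps * x ^ (n - 1)"]) simp
  qed (use R n continuous_on_P[of 0 R] in \<open>auto intro!: continuous_intros\<close>)
  then have PR: "P R \<le> eps * R ^ n / real n"
    using n by (simp add: P_def power_0_left)
  \<comment> \<open>\<open>C / r^(k+1)\<close> is the integral from \<open>r\<close> to infinity of
    the bound \<open>eps * R^(2(n-3)) * r^(5-n)\<close> for \<open>P'\<close>; adding it to
    \<open>P\<close> gives a nonincreasing function.\<close>
  define C where "C = eps * R ^ (2 * (k + 4)) / (real k + 1)"
  have "P r1 + C / r1 ^ (k + 1) \<le> P R + C / R ^ (k + 1)"
  proof (rule DERIV_nonpos_imp_decreasing_open[OF R(2), of "\<lambda>r. P r + C / r ^ (k + 1)"])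
    fix x assume xR: "R < x" "x < r1"
    then have x: "0 < x" "x < L" using R by auto
    have "x ^ (n - 3) * v x \<le> R ^ (n - 3) * v R"
      using R xR slope pos by (intro decay) auto
    also have "\<dots> \<le> R ^ (n - 3) * 1"
      using R le1[of R] by (intro mult_left_mono) auto
    finally have "(x ^ (n - 3) * v x)\<^sup>2 \<le> (R ^ (n - 3))\<^sup>2"
      using x pos[of x] xR by (intro power_mono) auto
    then have "(v x)\<^sup>2 * x ^ (2 * (k + 4)) \<le> R ^ (2 * (k + 4))"
      by (simp add: k power_mult_distrib power_mult[symmetric] mult.commute add.commute)
    then have "(v x)\<^sup>2 * x ^ (k + 6) \<le> R ^ (2 * (k + 4)) / x ^ (k + 2)"
      using x by (simp add: field_simps power_add[symmetric] power_mult[symmetric] numeral_eq_Suc)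
    then have "eps * ((v x)\<^sup>2 * x ^ (k + 6)) \<le> eps * (R ^ (2 * (k + 4)) / x ^ (k + 2))"
      using eps by (intro mult_left_mono)
    moreover have "((\<lambda>r. P r + C / r ^ (k + 1)) has_real_derivative
        eps * ((v x)\<^sup>2 * x ^ (k + 6)) - eps * (R ^ (2 * (k + 4)) / x ^ (k + 2))) (at x)"
    proof (rule DERIV_cong[OF DERIV_add[OF DERIV_P[OF x] DERIV_divide[OF DERIV_const DERIV_pow]]])
      show "x ^ (k + 1) \<noteq> 0" using x by simp
      have C: "C * (real (k + 1) * y) = eps * R ^ (2 * (k + 4)) * y" for y
        by (simp add: C_def field_simps)
      define X where "X = R ^ (2 * (k + 4))"
      show "eps * x ^ (n - 1) * (v x)\<^sup>2 + (0 * x ^ (k + 1) - C * (real (k + 1) * x ^ (k + 1 - Suc 0))) / (x ^ (k + 1) * x ^ (k + 1))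
        = eps * ((v x)\<^sup>2 * x ^ (k + 6)) - eps * (R ^ (2 * (k + 4)) / x ^ (k + 2))"
        unfolding C X_def[symmetric] using x by (simp add: k field_simps power_add)
    qed
    ultimately show "\<exists>d. ((\<lambda>r. P r + C / r ^ (k + 1)) has_real_derivative d) (at x) \<and> d \<le> 0"
      by (intro exI[of _ "eps * ((v x)\<^sup>2 * x ^ (k + 6)) - eps * (R ^ (2 * (k + 4)) / x ^ (k + 2))"]) simp
  qed (use R continuous_on_P[of R r1] in \<open>auto intro!: continuous_intros\<close>)
  moreover have "C / R ^ (k + 1) = eps * R ^ n / (real n - 6)"
  proof -
    have "R ^ (2 * (k + 4)) = R ^ n * R ^ (k + 1)"
      unfolding power_add[symmetric] k by (rule arg_cong[of _ _ "\<lambda>i. R ^ i"]) simp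
    then show ?thesis using R unfolding C_def by (simp add: k)
  qed
  moreover have "0 \<le> C / r1 ^ (k + 1)"
    using R eps by (simp add: C_def)
  ultimately show ?thesis using PR by (simp add: algebra_simps)
qed

text \<open>At the critical point \<open>s\<close> the functional reduces to
  \<open>s^n F (v s)\<close>. Its growth since \<open>r1\<close> is at most
  \<open>eps (v s)^2 s^n / n\<close>, which the linear part \<open>eps (v s)^2 s^n / 2\<close>
  absorbs, leaving the power part.\<close>

lemma second_bump_le:
  assumes "0 < r1" "r1 \<le> s" "s < L" "v1 s = 0"
    and le: "\<And>t. r1 \<le> t \<Longrightarrow> t \<le> s \<Longrightarrow> \<bar>v t\<bar> \<le> \<bar>v s\<bar>"
  shows "s ^ n * \<bar>v s\<bar> powr (real n * b) / (real n * b) \<le> P r1"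
proof -
  define m where "m = (v s)\<^sup>2"
  have "P s - eps * m * s ^ n / real n \<le> P r1 - eps * m * r1 ^ n / real n"
  proof (rule DERIV_nonpos_imp_decreasing_open[OF assms(2), of "\<lambda>r. P r - eps * m * r ^ n / real n"])
    fix x assume xs: "r1 < x" "x < s"
    then have x: "0 < x" "x < L" using assms(1-3) by auto
    have "((\<lambda>r. P r - eps * m * r ^ n / real n) has_real_derivative
        eps * x ^ (n - 1) * (v x)\<^sup>2 - eps * x ^ (n - 1) * m) (at x)"
      by (rule DERIV_cong[OF DERIV_diff[OF DERIV_P[OF x] DERIV_cdivide[OF DERIV_cmult[OF DERIV_pow]]]])
        (use n in \<open>simp add: field_simps\<close>)
    moreover have "(v x)\<^sup>2 \<le> m" using le[of x] xs by (simp add: m_def abs_le_square_iff)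
    then have "eps * x ^ (n - 1) * (v x)\<^sup>2 \<le> eps * x ^ (n - 1) * m"
      using x eps by (intro mult_left_mono) auto
    ultimately show "\<exists>y. ((\<lambda>r. P r - eps * m * r ^ n / real n) has_real_derivative y) (at x) \<and> y \<le> 0"
      by (intro exI[of _ "eps * x ^ (n - 1) * (v x)\<^sup>2 - eps * x ^ (n - 1) * m"]) simp
  qed (use assms(1-3) n continuous_on_P[of r1 s] in \<open>auto intro!: continuous_intros\<close>)
  moreover have "0 \<le> eps * m * r1 ^ n / real n"
    using assms(1) eps by (simp add: m_def)
  moreover have "P s = eps * m * s ^ n / 2 + s ^ n * \<bar>v s\<bar> powr (real n * b) / (real n * b)"
    using assms(4) unfolding P_def F_def nb m_def by (simp add: algebra_simps)
  moreover have "eps * m * s ^ n / real n \<le> eps * m * s ^ n / 2"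
    using n eps assms(1,2) by (intro divide_left_mono) (auto simp: m_def)
  ultimately show ?thesis by linarith
qed

end

section \<open>The bubble of height 1 as a radial profile\<close>

definition bubble_base :: "nat \<Rightarrow> real \<Rightarrow> real" where
  "bubble_base n r = 1 + r\<^sup>2 / (real n * (real n - 2))"

definition bubble_profile :: "nat \<Rightarrow> real \<Rightarrow> real" where
  "bubble_profile n r = bubble_base n r powr (- (real n - 2) / 2)"

definition bubble_profile1 :: "nat \<Rightarrow> real \<Rightarrow> real" where
  "bubble_profile1 n r = - r / real n * bubble_base n r powr (- real n / 2)"

text \<open>The factor \<open>bubble_base n r - 1\<close> stands for
  \<open>r^2 / (n (n - 2))\<close>, so that checking the equation becomes algebra in powers of the
  base.\<close>

definition bubble_profile2 :: "nat \<Rightarrow> real \<Rightarrow> real" where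
  "bubble_profile2 n r =
     - 1 / real n * bubble_base n r powr (- real n / 2) + (bubble_base n r - 1) * bubble_base n r powr (- real n / 2 - 1)"

lemma bubble_base_ge_1: "n \<ge> 7 \<Longrightarrow> bubble_base n r \<ge> 1"
  by (auto simp: bubble_base_def)

lemma DERIV_bubble_base: "n \<ge> 7 \<Longrightarrow> (bubble_base n has_real_derivative 2 * r / (real n * (real n - 2))) (at r)"
  unfolding bubble_base_def[abs_def] by (auto intro!: derivative_eq_intros)

lemma DERIV_bubble_base_powr:
  assumes "n \<ge> 7"
  shows "((\<lambda>r. bubble_base n r powr c) has_real_derivative
    c * bubble_base n r powr (c - 1) * (2 * r / (real n * (real n - 2)))) (at r)"
  using DERIV_fun_powr[OF DERIV_bubble_base[OF assms], of r c] bubble_base_ge_1[OF assms, of r] by simp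

lemma DERIV_bubble_profile:
  assumes "n \<ge> 7"
  shows "(bubble_profile n has_real_derivative bubble_profile1 n r) (at r)"
proof -
  have "- (real n - 2) / 2 - 1 = - real n / 2" by (simp add: field_simps)
  then show ?thesis
    unfolding bubble_profile_def[abs_def] bubble_profile1_def
    by (intro DERIV_cong[OF DERIV_bubble_base_powr[OF assms]]) (use assms in \<open>simp add: field_simps\<close>)
qed

lemma DERIV_bubble_profile1:
  assumes "n \<ge> 7"
  shows "(bubble_profile1 n has_real_derivative bubble_profile2 n r) (at r)"
proof -
  have "((\<lambda>r. - r / real n) has_real_derivative - 1 / real n) (at r)"
    using assms by (auto intro!: derivative_eq_intros)
  from DERIV_mult[OF this DERIV_bubble_base_powr[OF assms]] show ?thesis
    unfolding bubble_profile1_def[abs_def] bubble_profile2_def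
    by (rule DERIV_cong) (use assms in \<open>simp add: bubble_base_def field_simps power2_eq_square\<close>)
qed

lemma bubble_profile_pos: "n \<ge> 7 \<Longrightarrow> 0 < bubble_profile n r"
  using bubble_base_ge_1[of n r] by (simp add: bubble_profile_def)

lemma bubble_profile_le_1: assumes "n \<ge> 7" shows "bubble_profile n r \<le> 1"
  using powr_mono[of "- (real n - 2) / 2" 0 "bubble_base n r"] assms bubble_base_ge_1[OF assms, of r]
  by (simp add: bubble_profile_def)

lemma bubble_profile_antimono:
  assumes "n \<ge> 7" "0 \<le> r" "r \<le> R" shows "bubble_profile n R \<le> bubble_profile n r"
proof -
  have "bubble_base n r \<le> bubble_base n R" using assms by (simp add: bubble_base_def divide_right_mono power_mono)
  then show ?thesis
    using assms bubble_base_ge_1[OF assms(1), of r] unfolding bubble_profile_def by (intro powr_mono2') auto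
qed

lemma continuous_on_bubble_profile: "n \<ge> 7 \<Longrightarrow> continuous_on S (bubble_profile n)"
  by (auto intro!: DERIV_continuous_on[OF has_field_derivative_at_within[OF DERIV_bubble_profile]])

lemma continuous_on_bubble_profile1: "n \<ge> 7 \<Longrightarrow> continuous_on S (bubble_profile1 n)"
  by (auto intro!: DERIV_continuous_on[OF has_field_derivative_at_within[OF DERIV_bubble_profile1]])

lemma bubble_profile_0: "bubble_profile n 0 = 1" "bubble_profile1 n 0 = 0"
  by (simp_all add: bubble_profile_def bubble_profile1_def bubble_base_def)

text \<open>The nonlinearity raises the base to \<open>- (n + 2) / 2 = - n / 2 - 1\<close>, and all
  other terms can be written with the same power.\<close>

lemma radial_ode_bubble_profile:
  assumes n: "n \<ge> 7" and b: "b = 2 / (real n - 2)" and L: "L > 0"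
  shows "radial_ode n b 0 L (bubble_profile n) (bubble_profile1 n) (bubble_profile2 n)"
proof
  fix r :: real assume r: "0 < r"
  have A: "bubble_base n r \<ge> 1" using bubble_base_ge_1[OF n] .
  have "\<bar>bubble_profile n r\<bar> powr (2 * b) * bubble_profile n r = bubble_base n r powr (- 2 + - (real n - 2) / 2)"
  proof -
    have "\<bar>bubble_profile n r\<bar> powr (2 * b) = bubble_base n r powr (- (real n - 2) / 2 * (2 * b))"
      by (simp add: bubble_profile_def powr_powr)
    also have "- (real n - 2) / 2 * (2 * b) = - 2" using n by (simp add: b field_simps)
    finally show ?thesis by (simp only: bubble_profile_def powr_add)
  qed
  also have "- 2 + - (real n - 2) / 2 = - real n / 2 - 1" by (simp add: field_simps)
  finally have *: "\<bar>bubble_profile n r\<bar> powr (2 * b) * bubble_profile n r = bubble_base n r powr (- real n / 2 - 1)" .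
  have **: "bubble_base n r powr (- real n / 2) = bubble_base n r * bubble_base n r powr (- real n / 2 - 1)"
    using A powr_mult_base[of "bubble_base n r" "- real n / 2 - 1"] by simp
  show "bubble_profile2 n r = - (real n - 1) / r * bubble_profile1 n r
      - (0 * bubble_profile n r + \<bar>bubble_profile n r\<bar> powr (2 * b) * bubble_profile n r)"
    unfolding * bubble_profile1_def bubble_profile2_def ** using r n
    by (simp add: field_simps)
qed (use assms in \<open>auto intro: continuous_on_bubble_profile continuous_on_bubble_profile1
    DERIV_bubble_profile DERIV_bubble_profile1 simp: bubble_profile_0\<close>)

section \<open>Comparison with the bubble\<close>

context radial_ode
begin

abbreviation "U \<equiv> bubble_profile n"
abbreviation "U1 \<equiv> bubble_profile1 n"
abbreviation "U2 \<equiv> bubble_profile2 n"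

lemma U_ode: assumes "0 < r"
  shows "U2 r = - (real n - 1) / r * U1 r - \<bar>U r\<bar> powr (2 * b) * U r"
  using radial_ode.ode[OF radial_ode_bubble_profile[OF n b, of "r + 1"], of r] assms by simp

lemma nonlinearity_diff_le:
  assumes "\<bar>v r\<bar> \<le> 1"
  shows "\<bar>eps * v r + \<bar>v r\<bar> powr (2 * b) * v r - \<bar>U r\<bar> powr (2 * b) * U r\<bar> \<le> eps + 2 * \<bar>v r - U r\<bar>"
proof -
  have "\<bar>\<bar>v r\<bar> powr (2 * b) * v r - \<bar>U r\<bar> powr (2 * b) * U r\<bar> \<le> (2 * b + 1) * \<bar>v r - U r\<bar>"
    using b_pos assms bubble_profile_le_1[OF n, of r] bubble_profile_pos[OF n, of r]
    by (intro abs_powr_mult_lipschitz) auto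
  also have "\<dots> \<le> 2 * \<bar>v r - U r\<bar>"
    using b_le by (intro mult_right_mono) auto
  finally have 1: "\<bar>\<bar>v r\<bar> powr (2 * b) * v r - \<bar>U r\<bar> powr (2 * b) * U r\<bar> \<le> 2 * \<bar>v r - U r\<bar>" .
  have "\<bar>eps * v r\<bar> \<le> eps" using assms eps by (simp add: abs_mult mult_left_le)
  with 1 show ?thesis by linarith
qed

text \<open>The singular damping has the good sign and is dropped, so the rate does not depend on
  how close \<open>s\<close> is to \<open>0\<close>. Including \<open>eps^2\<close> in the distance
  makes the inequality homogeneous; collecting the cross terms with
  \<open>2 x y \<le> x^2 + y^2\<close> yields the rate \<open>4\<close>.\<close>

lemma diff_energy_le:
  assumes s: "0 \<le> s" "s \<le> r" "r < L" and vs: "v s = 1" "v1 s = 0"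
  shows "(v r - U r)\<^sup>2 + (v1 r - U1 r)\<^sup>2 \<le> exp (4 * (r - s)) * ((1 - U s)\<^sup>2 + (U1 s)\<^sup>2 + eps\<^sup>2)"
proof -
  define g where "g r = (v r - U r)\<^sup>2 + (v1 r - U1 r)\<^sup>2 + eps\<^sup>2" for r
  have "exp (- 4 * r) * g r \<le> exp (- 4 * s) * g s"
  proof (rule DERIV_nonpos_imp_decreasing_open[OF s(2), of "\<lambda>r. exp (- 4 * r) * g r"])
    fix x assume "s < x" "x < r"
    then have x: "0 < x" "x < L" "s \<le> x" using s by auto
    define d d1 where "d = v x - U x" and "d1 = v1 x - U1 x"
    define N where "N = eps * v x + \<bar>v x\<bar> powr (2 * b) * v x - \<bar>U x\<bar> powr (2 * b) * U x"
    have N: "\<bar>N\<bar> \<le> eps + 2 * \<bar>d\<bar>"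
      unfolding N_def d_def using abs_le_critical[of s x] x s vs by (intro nonlinearity_diff_le) auto
    have dd: "v2 x - U2 x = - (real n - 1) / x * d1 - N"
      unfolding ode[OF x(1,2)] U_ode[OF x(1)] N_def d1_def
      by (simp add: right_diff_distrib left_diff_distrib)
    have "((\<lambda>r. exp (- 4 * r) * g r) has_real_derivative
        exp (- 4 * x) * (2 * d * d1 + 2 * d1 * (v2 x - U2 x) - 4 * g x)) (at x)"
      unfolding g_def
      by (auto intro!: derivative_eq_intros der[OF x(1,2)] der1[OF x(1,2)] DERIV_bubble_profile DERIV_bubble_profile1 n
          simp: d_def d1_def algebra_simps)
    moreover have "2 * d * d1 + 2 * d1 * (v2 x - U2 x) - 4 * g x \<le> 0"
    proof -
      have "2 * d1 * (v2 x - U2 x) = - 2 * ((real n - 1) / x * d1\<^sup>2) - 2 * d1 * N"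
        unfolding dd by (simp add: algebra_simps power2_eq_square)
      also have "\<dots> \<le> - 2 * d1 * N"
        using n x by (auto intro!: mult_nonneg_nonneg divide_nonneg_pos)
      also have "\<dots> \<le> 2 * \<bar>d1\<bar> * \<bar>N\<bar>"
        using abs_ge_minus_self[of "d1 * N"] by (simp add: abs_mult mult.commute)
      also have "\<dots> \<le> 2 * \<bar>d1\<bar> * (eps + 2 * \<bar>d\<bar>)"
        using N by (intro mult_left_mono) auto
      finally have "2 * d1 * (v2 x - U2 x) \<le> 2 * \<bar>d1\<bar> * eps + 4 * \<bar>d\<bar> * \<bar>d1\<bar>"
        by (simp add: algebra_simps)
      moreover have "2 * d * d1 \<le> 2 * \<bar>d\<bar> * \<bar>d1\<bar>"
        using abs_ge_self[of "d * d1"] by (simp add: abs_mult mult.commute)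
      moreover have "2 * \<bar>d1\<bar> * eps \<le> d1\<^sup>2 + eps\<^sup>2"
        using sum_squares_bound[of "\<bar>d1\<bar>" eps] by simp
      moreover have "2 * \<bar>d\<bar> * \<bar>d1\<bar> \<le> d\<^sup>2 + d1\<^sup>2"
        using sum_squares_bound[of "\<bar>d\<bar>" "\<bar>d1\<bar>"] by simp
      moreover have "g x = d\<^sup>2 + d1\<^sup>2 + eps\<^sup>2" by (simp add: g_def d_def d1_def)
      ultimately show ?thesis using zero_le_power2[of d] zero_le_power2[of eps] by linarith
    qed
    then have "exp (- 4 * x) * (2 * d * d1 + 2 * d1 * (v2 x - U2 x) - 4 * g x) \<le> 0"
      by (intro mult_nonneg_nonpos) auto
    ultimately show "\<exists>y. ((\<lambda>r. exp (- 4 * r) * g r) has_real_derivative y) (at x) \<and> y \<le> 0"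
      by blast
  next
    show "continuous_on {s..r} (\<lambda>r. exp (- 4 * r) * g r)"
      unfolding g_def using s n
      by (intro continuous_intros cont_sub cont1_sub continuous_on_bubble_profile continuous_on_bubble_profile1) auto
  qed
  then have "exp (4 * r) * (exp (- 4 * r) * g r) \<le> exp (4 * r) * (exp (- 4 * s) * g s)"
    by (intro mult_left_mono) auto
  then have "g r \<le> exp (4 * (r - s)) * g s"
    by (simp add: mult.assoc[symmetric] exp_add[symmetric] right_diff_distrib)
  moreover have "g s = (1 - U s)\<^sup>2 + (U1 s)\<^sup>2 + eps\<^sup>2" using vs by (simp add: g_def)
  moreover have "(v r - U r)\<^sup>2 + (v1 r - U1 r)\<^sup>2 \<le> g r" by (simp add: g_def)
  ultimately show ?thesis by simp
qed

text \<open>Needed near the origin, where \<open>v1 r / r\<close> enters the Hessian.\<close>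

lemma diff_deriv_le:
  assumes r: "0 < r" "r < L" and N: "\<And>t. 0 < t \<Longrightarrow> t < r \<Longrightarrow>
    \<bar>eps * v t + \<bar>v t\<bar> powr (2 * b) * v t - \<bar>U t\<bar> powr (2 * b) * U t\<bar> \<le> e"
  shows "\<bar>v1 r - U1 r\<bar> \<le> e * r"
proof -
  define N where "N t = eps * v t + \<bar>v t\<bar> powr (2 * b) * v t - \<bar>U t\<bar> powr (2 * b) * U t" for t
  have d: "((\<lambda>t. t ^ (n - 1) * (v1 t - U1 t)) has_real_derivative - (t ^ (n - 1) * N t)) (at t)"
    if "0 < t" "t < r" for t
  proof -
    have t: "0 < t" "t < L" using that r by auto
    obtain k where k: "n = Suc (Suc (Suc (Suc k)))" using n_eq by blast
    have dd: "v2 t - U2 t = - (real n - 1) / t * (v1 t - U1 t) - N t"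
      unfolding ode[OF t] U_ode[OF t(1)] N_def
      by (simp add: right_diff_distrib left_diff_distrib)
    show ?thesis
    proof (rule DERIV_cong[OF DERIV_mult[OF DERIV_pow DERIV_diff[OF der1[OF t] DERIV_bubble_profile1[OF n]]]])
      have "t ^ (n - 1) = t * t ^ (n - 2)" using k by simp
      then have "(v2 t - U2 t) * t ^ (n - 1) = - (real n - 1) * t ^ (n - 2) * (v1 t - U1 t) - t ^ (n - 1) * N t"
        unfolding dd using t by (simp add: field_simps)
      then show "real (n - 1) * t ^ (n - 1 - Suc 0) * (v1 t - U1 t) + (v2 t - U2 t) * t ^ (n - 1) = - (t ^ (n - 1) * N t)"
        using n by (simp add: of_nat_diff diff_diff_left numeral_2_eq_2 left_diff_distrib)
    qed
  qed
  have e: "0 \<le> e" using N[of "r / 2"] r by auto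
  \<comment> \<open>\<open>c\<close> is a sign; the values \<open>1\<close> and \<open>-1\<close>
    together bound the absolute value. The comparison function is the integral of
    \<open>e * t^(n-1)\<close>.\<close>
  have "c * (r ^ (n - 1) * (v1 r - U1 r)) - e * r ^ n / real n \<le> c * (0 ^ (n - 1) * (v1 0 - U1 0)) - e * 0 ^ n / real n"
    if c: "\<bar>c\<bar> = 1" for c :: real
  proof (rule DERIV_nonpos_imp_decreasing_open[of 0 r "\<lambda>t. c * (t ^ (n - 1) * (v1 t - U1 t)) - e * t ^ n / real n"])
    fix t assume t: "0 < t" "t < r"
    have "((\<lambda>t. c * (t ^ (n - 1) * (v1 t - U1 t)) - e * t ^ n / real n) has_real_derivative
        c * (- (t ^ (n - 1) * N t)) - e * t ^ (n - 1)) (at t)"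
      by (rule DERIV_cong[OF DERIV_diff[OF DERIV_cmult[OF d[OF t]] DERIV_cdivide[OF DERIV_cmult[OF DERIV_pow]]]])
        (use n in \<open>simp add: field_simps\<close>)
    moreover have "c * (- (t ^ (n - 1) * N t)) - e * t ^ (n - 1) = t ^ (n - 1) * (- (c * N t) - e)"
      by (simp add: algebra_simps)
    moreover have "\<bar>c * N t\<bar> \<le> e" using N[OF t] c by (simp add: abs_mult N_def)
    then have "t ^ (n - 1) * (- (c * N t) - e) \<le> 0"
      using t by (intro mult_nonneg_nonpos) auto
    ultimately show "\<exists>y. ((\<lambda>t. c * (t ^ (n - 1) * (v1 t - U1 t)) - e * t ^ n / real n) has_real_derivative y) (at t) \<and> y \<le> 0"
      by (intro exI[of _ "t ^ (n - 1) * (- (c * N t) - e)"]) simp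
  qed (use r n in \<open>auto intro!: continuous_intros cont1_sub continuous_on_bubble_profile1\<close>)
  then have *: "c * (r ^ (n - 1) * (v1 r - U1 r)) \<le> e * r ^ n / real n" if "\<bar>c\<bar> = 1" for c :: real
    using that n by (simp add: power_0_left)
  have "r ^ (n - 1) * \<bar>v1 r - U1 r\<bar> = \<bar>r ^ (n - 1) * (v1 r - U1 r)\<bar>"
    using r by (simp add: abs_mult)
  also have "\<dots> \<le> e * r ^ n / real n"
    using *[of 1] *[of "-1"] by auto
  also have "\<dots> \<le> e * r ^ n"
    using mult_right_mono[of 1 "real n" "e * r ^ n"] e r n by (simp add: divide_le_eq mult.commute)
  also have "\<dots> = r ^ (n - 1) * (e * r)"
    using n by (metis (no_types, lifting) mult.commute mult.left_commute power_eq_if not_numeral_le_zero)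
  finally show ?thesis using r by simp
qed

end

text \<open>The threshold is chosen before the equation, so it is uniform over all solutions, all
  lengths \<open>L\<close> and all starting radii \<open>s\<close>.\<close>

lemma bubble_close_C1:
  fixes R e :: real
  assumes n: "n \<ge> 7" and R: "R > 0" and e: "e > 0"
  obtains \<theta> where "\<theta> > 0" "\<And>b eps L v v1 v2 s. radial_ode n b eps L v v1 v2 \<Longrightarrow> eps \<le> \<theta> \<Longrightarrow>
    0 \<le> s \<Longrightarrow> s \<le> \<theta> \<Longrightarrow> s < L \<Longrightarrow> v s = 1 \<Longrightarrow> v1 s = 0 \<Longrightarrow> v L = 0 \<Longrightarrow>
    R < L \<and> (\<forall>r. s \<le> r \<and> r \<le> R \<longrightarrow> 0 < v r \<and> \<bar>v r - bubble_profile n r\<bar> \<le> e \<and> \<bar>v1 r - bubble_profile1 n r\<bar> \<le> e)"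
proof -
  let ?U = "bubble_profile n" and ?U1 = "bubble_profile1 n"
  \<comment> \<open>An error below \<open>?U R\<close> keeps \<open>v\<close> positive up to
    \<open>R\<close>, because the bubble is decreasing.\<close>
  define e' where "e' = min e (?U R / 2)"
  have e': "e' > 0" "e' \<le> e" "e' < ?U R"
    using e bubble_profile_pos[OF n, of R] by (auto simp: e'_def)
  \<comment> \<open>One function controls both small parameters: the estimate from
    \<open>diff_energy_le\<close> is at most \<open>h s + h eps\<close>, and \<open>h\<close> is
    continuous with \<open>h 0 = 0\<close>.\<close>
  define h where "h t = exp (4 * R) * ((1 - ?U t)\<^sup>2 + (?U1 t)\<^sup>2 + t\<^sup>2)" for t
  have "isCont h 0"
    unfolding h_def[abs_def]
    using DERIV_isCont[OF DERIV_bubble_profile[OF n]] DERIV_isCont[OF DERIV_bubble_profile1[OF n]]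
    by (intro continuous_intros) auto
  then have "(h \<longlongrightarrow> 0) (at 0)"
    by (simp add: isCont_def h_def bubble_profile_0)
  then have "\<forall>\<^sub>F t in at 0. h t < e'\<^sup>2 / 2"
    using e'(1) by (intro order_tendstoD) auto
  then obtain d where d: "d > 0" "\<And>t. t \<noteq> 0 \<Longrightarrow> \<bar>t\<bar> < d \<Longrightarrow> h t < e'\<^sup>2 / 2"
    unfolding eventually_at by (auto simp: dist_real_def)
  define \<theta> where "\<theta> = d / 2"
  have th: "\<theta> > 0" "\<And>t. 0 \<le> t \<Longrightarrow> t \<le> \<theta> \<Longrightarrow> h t < e'\<^sup>2 / 2"
  proof -
    show "\<theta> > 0" using d by (simp add: \<theta>_def)
    fix t assume "0 \<le> t" "t \<le> \<theta>"
    then show "h t < e'\<^sup>2 / 2"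
      using d(2)[of t] d(1) e'(1) by (cases "t = 0") (auto simp: \<theta>_def h_def bubble_profile_0)
  qed
  show thesis
  proof (rule that[OF th(1)])
    fix b eps L v v1 v2 s
    assume A: "radial_ode n b eps L v v1 v2" and eps_le: "eps \<le> \<theta>" and s: "0 \<le> s" "s \<le> \<theta>" "s < L"
      and vs: "v s = 1" "v1 s = 0" and vL: "v L = (0::real)"
    interpret radial_ode n b eps L v v1 v2 by fact
    have close: "(v r - ?U r)\<^sup>2 + (v1 r - ?U1 r)\<^sup>2 \<le> e'\<^sup>2" if "s \<le> r" "r < L" "r \<le> R" for r
    proof -
      have "(v r - ?U r)\<^sup>2 + (v1 r - ?U1 r)\<^sup>2 \<le> exp (4 * (r - s)) * ((1 - ?U s)\<^sup>2 + (?U1 s)\<^sup>2 + eps\<^sup>2)"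
        using that s vs by (intro diff_energy_le) auto
      also have "\<dots> \<le> exp (4 * R) * ((1 - ?U s)\<^sup>2 + (?U1 s)\<^sup>2 + eps\<^sup>2)"
        using that s by (intro mult_right_mono) auto
      also have "\<dots> \<le> h s + h eps"
        by (simp add: h_def algebra_simps)
      also have "\<dots> \<le> e'\<^sup>2"
        using th(2)[of s] th(2)[of eps] s eps eps_le by linarith
      finally show ?thesis .
    qed
    have close1: "\<bar>v r - ?U r\<bar> \<le> e'" and close2: "\<bar>v1 r - ?U1 r\<bar> \<le> e'" if "s \<le> r" "r < L" "r \<le> R" for r
    proof -
      have "(v r - ?U r)\<^sup>2 \<le> e'\<^sup>2" "(v1 r - ?U1 r)\<^sup>2 \<le> e'\<^sup>2"
        using close[OF that] zero_le_power2[of "v r - ?U r"] zero_le_power2[of "v1 r - ?U1 r"] by linarith+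
      then show "\<bar>v r - ?U r\<bar> \<le> e'" "\<bar>v1 r - ?U1 r\<bar> \<le> e'"
        using e'(1) by (simp_all add: power2_le_iff_abs_le)
    qed
    have RL: "R < L"
    proof (rule ccontr)
      assume "\<not> R < L"
      then have LR: "L \<le> R" by simp
      \<comment> \<open>Closeness is known only on \<open>{s..<L}\<close>. Passing to the limit at
        \<open>L\<close> contradicts \<open>v L = 0\<close>, since there the bubble is at least
        \<open>?U R > e'\<close>.\<close>
      have "continuous_on {s..L} (\<lambda>r. \<bar>v r - ?U r\<bar>)"
        using s n by (intro continuous_intros cont_sub continuous_on_bubble_profile) auto
      from continuous_on_Icc_at_leftD[OF this s(3)]
      have "((\<lambda>r. \<bar>v r - ?U r\<bar>) \<longlongrightarrow> \<bar>v L - ?U L\<bar>) (at_left L)" .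
      moreover have "\<forall>\<^sub>F r in at_left L. \<bar>v r - ?U r\<bar> \<le> e'"
        using eventually_at_left_real[OF s(3)] by eventually_elim (use LR close1 in auto)
      ultimately have "\<bar>v L - ?U L\<bar> \<le> e'"
        by (intro tendsto_upperbound) auto
      moreover have "?U R \<le> ?U L" using LR L n by (intro bubble_profile_antimono) auto
      ultimately show False using vL e'(3) by auto
    qed
    show "R < L \<and> (\<forall>r. s \<le> r \<and> r \<le> R \<longrightarrow> 0 < v r \<and> \<bar>v r - ?U r\<bar> \<le> e \<and> \<bar>v1 r - ?U1 r\<bar> \<le> e)"
    proof (intro conjI allI impI RL)
      fix r assume r: "s \<le> r \<and> r \<le> R"
      then have "r < L" using RL by simp
      from r this close1[of r] close2[of r] e'(2)
      show "\<bar>v r - ?U r\<bar> \<le> e" "\<bar>v1 r - ?U1 r\<bar> \<le> e" by auto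
      have "?U R \<le> ?U r" using r s n by (intro bubble_profile_antimono) auto
      then show "0 < v r" using r \<open>r < L\<close> close1[of r] e'(3) by auto
    qed
  qed
qed

text \<open>For \<open>s > 0\<close> the first-order bound is only available away from the origin, hence the lower cut-off.\<close>

lemma bubble_close_C2:
  fixes R e \<delta> :: real
  assumes n: "n \<ge> 7" and R: "R > 0" and e: "e > 0" and \<delta>: "0 \<le> \<delta>"
  obtains \<theta> where "\<theta> > 0" "\<And>b eps L v v1 v2 s. radial_ode n b eps L v v1 v2 \<Longrightarrow> eps \<le> \<theta> \<Longrightarrow>
    0 \<le> s \<Longrightarrow> s \<le> \<theta> \<Longrightarrow> s = 0 \<or> 0 < \<delta> \<Longrightarrow> s < L \<Longrightarrow> v s = 1 \<Longrightarrow> v1 s = 0 \<Longrightarrow> v L = 0 \<Longrightarrow>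
    R < L \<and> (\<forall>r. s \<le> r \<and> r \<le> R \<longrightarrow> 0 < v r) \<and> (\<forall>r. 0 < r \<and> \<delta> \<le> r \<and> r \<le> R \<longrightarrow> s \<le> r \<and>
      \<bar>v r - bubble_profile n r\<bar> \<le> e \<and> \<bar>v1 r - bubble_profile1 n r\<bar> \<le> e * r \<and> \<bar>v2 r - bubble_profile2 n r\<bar> \<le> e)"
proof -
  let ?U = "bubble_profile n" and ?U1 = "bubble_profile1 n" and ?U2 = "bubble_profile2 n"
  \<comment> \<open>The second derivative costs \<open>(n - 1) e1\<close> for the first-order term
    and \<open>e1\<close> for the nonlinearity; the denominator leaves room for both.\<close>
  define e1 where "e1 = e / (real n + 2)"
  have e1: "e1 > 0" "(real n + 2) * e1 = e" using e by (auto simp: e1_def)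
  \<comment> \<open>The third is for \<open>eps + 2 * \<bar>v - U\<bar> \<le> 3 * e2\<close>. The
    bound \<open>e1 * \<delta>\<close> turns an absolute error of the slope into one relative to
    \<open>r\<close> when \<open>r \<ge> \<delta>\<close>.\<close>
  define e2 where "e2 = (if \<delta> = 0 then e1 / 3 else min (e1 / 3) (e1 * \<delta>))"
  have e2: "e2 > 0" "3 * e2 \<le> e1" "\<delta> > 0 \<Longrightarrow> e2 \<le> e1 * \<delta>" using e1 \<delta> by (auto simp: e2_def)
  obtain \<theta> where th: "\<theta> > 0" "\<And>b eps L v v1 v2 s. radial_ode n b eps L v v1 v2 \<Longrightarrow> eps \<le> \<theta> \<Longrightarrow>
    0 \<le> s \<Longrightarrow> s \<le> \<theta> \<Longrightarrow> s < L \<Longrightarrow> v s = 1 \<Longrightarrow> v1 s = 0 \<Longrightarrow> v L = 0 \<Longrightarrow>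
    R < L \<and> (\<forall>r. s \<le> r \<and> r \<le> R \<longrightarrow> 0 < v r \<and> \<bar>v r - ?U r\<bar> \<le> e2 \<and> \<bar>v1 r - ?U1 r\<bar> \<le> e2)"
    using bubble_close_C1[OF n R e2(1)] by blast
  \<comment> \<open>For positive \<open>\<delta>\<close> the starting radius must lie below the
    cut-off, so that \<open>s \<le> r\<close> for all radii considered.\<close>
  define \<theta>' where "\<theta>' = (if \<delta> = 0 then min \<theta> e2 else min \<delta> (min \<theta> e2))"
  have th': "\<theta>' > 0" "\<theta>' \<le> \<theta>" "\<theta>' \<le> e2" "\<delta> > 0 \<Longrightarrow> \<theta>' \<le> \<delta>" using \<delta> th(1) e2(1) by (auto simp: \<theta>'_def)
  show thesis
  proof (rule that[OF th'(1)])
    fix b eps L v v1 v2 s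
    assume A: "radial_ode n b eps L v v1 v2" and eps_le: "eps \<le> \<theta>'" and s: "0 \<le> s" "s \<le> \<theta>'" "s = 0 \<or> 0 < \<delta>" "s < L"
      and vs: "v s = 1" "v1 s = 0" and vL: "v L = (0::real)"
    interpret radial_ode n b eps L v v1 v2 by fact
    have cl: "R < L" "\<And>r. s \<le> r \<Longrightarrow> r \<le> R \<Longrightarrow> 0 < v r"
      "\<And>r. s \<le> r \<Longrightarrow> r \<le> R \<Longrightarrow> \<bar>v r - ?U r\<bar> \<le> e2" "\<And>r. s \<le> r \<Longrightarrow> r \<le> R \<Longrightarrow> \<bar>v1 r - ?U1 r\<bar> \<le> e2"
      using th(2)[OF A order_trans[OF eps_le th'(2)] s(1) order_trans[OF s(2) th'(2)] s(4) vs vL] by auto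
    have N: "\<bar>eps * v t + \<bar>v t\<bar> powr (2 * b) * v t - \<bar>?U t\<bar> powr (2 * b) * ?U t\<bar> \<le> e1" if "s \<le> t" "t \<le> R" for t
    proof -
      have "\<bar>v t\<bar> \<le> 1" using abs_le_critical[of s t] s vs that cl(1) by auto
      moreover have "eps + 2 * \<bar>v t - ?U t\<bar> \<le> e1"
      proof -
        have "2 * \<bar>v t - ?U t\<bar> \<le> 2 * e2" using cl(3)[OF that] by simp
        then show ?thesis using eps_le th'(3) e2(2) by linarith
      qed
      ultimately show ?thesis by (meson nonlinearity_diff_le order_trans)
    qed
    have "s \<le> r \<and> \<bar>v r - ?U r\<bar> \<le> e \<and> \<bar>v1 r - ?U1 r\<bar> \<le> e * r \<and> \<bar>v2 r - ?U2 r\<bar> \<le> e"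
      if r: "0 < r" "\<delta> \<le> r" "r \<le> R" for r
    proof -
      have rL: "r < L" using r cl(1) by simp
      have sr: "s \<le> r" using s th'(4) r by auto
      have e1e: "e1 \<le> e" "0 \<le> real n * e1" using e1 n by (auto simp flip: e1(2) simp: algebra_simps)
      have d1: "\<bar>v1 r - ?U1 r\<bar> \<le> e1 * r"
      proof (cases "s = 0")
        case True
        then show ?thesis using r rL N by (intro diff_deriv_le) auto
      next
        case False
        then have "0 < \<delta>" using s by auto
        then have "e2 \<le> e1 * r" using e2(3) r e1(1) by (meson mult_le_cancel_left_pos order_trans)
        then show ?thesis using cl(4)[OF sr r(3)] by linarith
      qed
      have dd: "v2 r - ?U2 r = - (real n - 1) * ((v1 r - ?U1 r) / r)
         - (eps * v r + \<bar>v r\<bar> powr (2 * b) * v r - \<bar>?U r\<bar> powr (2 * b) * ?U r)"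
        unfolding ode[OF r(1) rL] U_ode[OF r(1)] by (simp add: algebra_simps diff_divide_distrib)
      have dn: "\<bar>- (real n - 1) * ((v1 r - ?U1 r) / r)\<bar> \<le> (real n - 1) * e1"
        using d1 r n by (simp add: abs_mult divide_le_eq mult_left_mono)
      have "\<bar>v2 r - ?U2 r\<bar> \<le> (real n - 1) * e1 + e1"
        unfolding dd by (rule order_trans[OF abs_triangle_ineq4 add_mono[OF dn N[OF sr r(3)]]])
      also have "\<dots> \<le> e" using e1 by (simp add: algebra_simps flip: e1(2))
      finally have "\<bar>v2 r - ?U2 r\<bar> \<le> e" .
      moreover have "e1 * r \<le> e * r" using e1e r by (intro mult_right_mono) auto
      moreover have "\<bar>v r - ?U r\<bar> \<le> e" using cl(3)[OF sr r(3)] e2 e1e by linarith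
      ultimately show ?thesis using sr d1 by linarith
    qed
    then show "R < L \<and> (\<forall>r. s \<le> r \<and> r \<le> R \<longrightarrow> 0 < v r) \<and> (\<forall>r. 0 < r \<and> \<delta> \<le> r \<and> r \<le> R \<longrightarrow> s \<le> r \<and>
      \<bar>v r - ?U r\<bar> \<le> e \<and> \<bar>v1 r - ?U1 r\<bar> \<le> e * r \<and> \<bar>v2 r - ?U2 r\<bar> \<le> e)"
      using cl by auto
  qed
qed

section \<open>Scaling to amplitude 1 and the position of the second bump\<close>

lemma radial_ode_scale:
  assumes "radial_ode n b eps L v v1 v2" and c: "c \<noteq> 0" and k: "k = \<bar>c\<bar> powr b"
  shows "radial_ode n b (eps * \<bar>c\<bar> powr (- 2 * b)) (k * L)
    (\<lambda>r. v (r / k) / c) (\<lambda>r. v1 (r / k) / (k * c)) (\<lambda>r. v2 (r / k) / (k\<^sup>2 * c))"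
proof -
  interpret radial_ode n b eps L v v1 v2 by fact
  have k0: "k > 0" using c k by simp
  \<comment> \<open>This identity keeps the coefficient of the power term equal to \<open>1\<close>.
    The sign of \<open>c\<close> is free because the nonlinearity is odd; a negative
    \<open>c\<close> turns a negative bump into a positive profile.\<close>
  have k2: "\<bar>c\<bar> powr (2 * b) = k\<^sup>2" by (simp add: k powr_add[symmetric] power2_eq_square)
  show ?thesis
  proof
    show "continuous_on {0..k * L} (\<lambda>r. v (r / k) / c)"
      using k0 c by (intro continuous_intros continuous_on_compose2[OF cont]) (auto simp: field_simps)
    show "continuous_on {0..<k * L} (\<lambda>r. v1 (r / k) / (k * c))"
      using k0 c by (intro continuous_intros continuous_on_compose2[OF cont1]) (auto simp: field_simps)
    fix r assume "0 < r" "r < k * L"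
    then have r: "0 < r / k" "r / k < L" "0 < r" using k0 by (auto simp: field_simps)
    have dk: "((\<lambda>r. r / k) has_real_derivative 1 / k) (at r)"
      using k0 by (auto intro!: derivative_eq_intros)
    show "((\<lambda>r. v (r / k) / c) has_real_derivative v1 (r / k) / (k * c)) (at r)"
      by (rule DERIV_cong[OF DERIV_cdivide[OF DERIV_chain2[OF der[OF r(1,2)] dk]]]) (use k0 c in \<open>simp add: field_simps\<close>)
    show "((\<lambda>r. v1 (r / k) / (k * c)) has_real_derivative v2 (r / k) / (k\<^sup>2 * c)) (at r)"
      by (rule DERIV_cong[OF DERIV_cdivide[OF DERIV_chain2[OF der1[OF r(1,2)] dk]]])
        (use k0 c in \<open>simp add: field_simps power2_eq_square\<close>)
    have e1: "\<bar>v (r / k) / c\<bar> powr (2 * b) = \<bar>v (r / k)\<bar> powr (2 * b) / k\<^sup>2"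
      by (simp add: abs_divide powr_divide k2)
    have e2: "\<bar>c\<bar> powr (- 2 * b) = 1 / k\<^sup>2"
      using powr_minus_divide[of "\<bar>c\<bar>" "2 * b"] k2 by simp
    show "v2 (r / k) / (k\<^sup>2 * c) = - (real n - 1) / r * (v1 (r / k) / (k * c))
        - (eps * \<bar>c\<bar> powr (- 2 * b) * (v (r / k) / c) + \<bar>v (r / k) / c\<bar> powr (2 * b) * (v (r / k) / c))"
      unfolding ode[OF r(1,2)] e1 e2 using r(3) k0 c by (simp add: field_simps power2_eq_square)
  qed (use n b eps L k0 v1_0 in auto)
qed

text \<open>The quantity \<open>\<bar>v s\<bar> powr b * s\<close> is scale invariant, so it may be
  computed after normalising the height at the centre to \<open>1\<close>. Then
  \<open>P_first_zero_le\<close> bounds \<open>P\<close> at the node and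
  \<open>second_bump_le\<close> transfers the bound to the minimum.\<close>

lemma second_bump_small:
  fixes \<theta> :: real
  assumes n: "n \<ge> 7" and \<theta>: "\<theta> > 0"
  obtains e0 where "e0 > 0" "\<And>b eps L v v1 v2 r1 s. radial_ode n b eps L v v1 v2 \<Longrightarrow>
    eps * v 0 powr (- 2 * b) \<le> e0 \<Longrightarrow> 0 < r1 \<Longrightarrow> r1 \<le> s \<Longrightarrow> s < L \<Longrightarrow>
    (\<And>t. 0 \<le> t \<Longrightarrow> t < r1 \<Longrightarrow> 0 < v t) \<Longrightarrow> v r1 = 0 \<Longrightarrow> v1 s = 0 \<Longrightarrow> v L = 0 \<Longrightarrow>
    (\<And>t. r1 \<le> t \<Longrightarrow> t \<le> s \<Longrightarrow> \<bar>v t\<bar> \<le> \<bar>v s\<bar>) \<Longrightarrow> \<bar>v s\<bar> powr b * s \<le> \<theta>"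
proof -
  let ?U = "bubble_profile n" and ?U1 = "bubble_profile1 n"
  \<comment> \<open>The slope of the bubble at \<open>R\<close> is
    \<open>R^2 / (n * bubble_base n R)\<close>. With \<open>R^2 = n^3\<close> it exceeds
    \<open>n - 3\<close>, since this reduces to \<open>n - 3 < n^2 / (n - 2)\<close>.\<close>
  define R where "R = sqrt (real n * (real n * real n))"
  have R: "R > 0" using n by (simp add: R_def)
  have slope: "(real n - 3) * ?U R < - R * ?U1 R"
  proof -
    have A: "bubble_base n R \<ge> 1" using bubble_base_ge_1[OF n] .
    have "?U R = bubble_base n R powr (1 + - real n / 2)"
      unfolding bubble_profile_def by (rule arg_cong) (simp add: field_simps)
    also have "\<dots> = bubble_base n R * bubble_base n R powr (- real n / 2)"
      using A by (intro powr_mult_base[symmetric]) simp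
    finally have U: "?U R = bubble_base n R * bubble_base n R powr (- real n / 2)" .
    have R2: "R\<^sup>2 / real n = real n * real n" using n by (simp add: R_def)
    define t where "t = real n * real n / (real n - 2)"
    have t: "t * (real n - 2) = real n * real n" using n by (simp add: t_def)
    have "real n \<le> t" unfolding t_def using n by (simp add: le_divide_eq algebra_simps)
    moreover have "R\<^sup>2 / (real n * (real n - 2)) = t"
      unfolding divide_divide_eq_left[symmetric] R2 t_def ..
    then have "(real n - 3) * bubble_base n R = (real n - 3) + (t * (real n - 2) - t)"
      by (simp add: bubble_base_def algebra_simps)
    ultimately have "(real n - 3) * bubble_base n R < R\<^sup>2 / real n"
      unfolding R2 t by linarith
    then have "(real n - 3) * bubble_base n R * bubble_base n R powr (- real n / 2) < R\<^sup>2 / real n * bubble_base n R powr (- real n / 2)"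
      using A by (intro mult_strict_right_mono) auto
    then show ?thesis unfolding U bubble_profile1_def by (simp add: power2_eq_square mult.assoc)
  qed
  \<comment> \<open>The gap in \<open>slope\<close>, divided so that errors \<open>e\<close> in the
    value and in the derivative, weighted by \<open>n - 3\<close> and \<open>R\<close>, still leave
    slope at least \<open>n - 3\<close>.\<close>
  define e where "e = (- R * ?U1 R - (real n - 3) * ?U R) / (R + real n)"
  have e: "e > 0" "(R + real n) * e = - R * ?U1 R - (real n - 3) * ?U R" using slope R n by (auto simp: e_def)
  obtain t0 where t0: "t0 > 0" "\<And>b eps L v v1 v2 s. radial_ode n b eps L v v1 v2 \<Longrightarrow> eps \<le> t0 \<Longrightarrow>
    0 \<le> s \<Longrightarrow> s \<le> t0 \<Longrightarrow> s < L \<Longrightarrow> v s = 1 \<Longrightarrow> v1 s = 0 \<Longrightarrow> v L = 0 \<Longrightarrow>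
    R < L \<and> (\<forall>r. s \<le> r \<and> r \<le> R \<longrightarrow> 0 < v r \<and> \<bar>v r - ?U r\<bar> \<le> e \<and> \<bar>v1 r - ?U1 r\<bar> \<le> e)"
    using bubble_close_C1[OF n R e(1)] by blast
  define C where "C = R ^ n / real n + R ^ n / (real n - 6)"
  have C: "C > 0" using R n by (auto simp: C_def intro!: add_pos_pos)
  define nb where "nb = real n * (2 / (real n - 2))"
  have nb_gt: "nb > 0" using n by (auto simp: nb_def)
  \<comment> \<open>The second entry solves \<open>nb * (e0 * C) = \<theta>^n\<close>; the first
    makes \<open>w\<close> close to the bubble up to \<open>R\<close>.\<close>
  define e0 where "e0 = min t0 (\<theta> ^ n / (nb * C))"
  have e0: "e0 > 0" "e0 \<le> t0" "e0 * (nb * C) \<le> \<theta> ^ n"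
    using t0(1) nb_gt C \<theta> by (auto simp: e0_def min_def field_simps)
  show thesis
  proof (rule that[OF e0(1)])
    fix b eps L v v1 v2 r1 s
    assume ode: "radial_ode n b eps L v v1 v2" and le: "eps * v 0 powr (- 2 * b) \<le> e0"
      and s: "0 < r1" "r1 \<le> s" "s < L" and pos: "\<And>t. 0 \<le> t \<Longrightarrow> t < r1 \<Longrightarrow> 0 < v t"
      and z: "v r1 = 0" "v1 s = 0" "v L = 0" and m: "\<And>t. r1 \<le> t \<Longrightarrow> t \<le> s \<Longrightarrow> \<bar>v t\<bar> \<le> \<bar>v s\<bar>"
    have a: "v 0 > 0" using pos s by simp
    define k where "k = \<bar>v 0\<bar> powr b"
    have k: "k > 0" using a by (simp add: k_def)
    define w where "w r = v (r / k) / v 0" for r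
    define w1 where "w1 r = v1 (r / k) / (k * v 0)" for r
    define w2 where "w2 r = v2 (r / k) / (k\<^sup>2 * v 0)" for r
    interpret o: radial_ode n b eps L v v1 v2 by fact
    have W: "radial_ode n b (eps * \<bar>v 0\<bar> powr (- 2 * b)) (k * L) w w1 w2"
      unfolding w_def[abs_def] w1_def[abs_def] w2_def[abs_def]
      by (rule radial_ode_scale[OF ode _ k_def]) (use a in simp)
    interpret radial_ode n b "eps * \<bar>v 0\<bar> powr (- 2 * b)" "k * L" w w1 w2 by fact
    have w0: "w 0 = 1" using a by (simp add: w_def)
    have "R < k * L \<and> (\<forall>r. 0 \<le> r \<and> r \<le> R \<longrightarrow> 0 < w r \<and> \<bar>w r - ?U r\<bar> \<le> e \<and> \<bar>w1 r - ?U1 r\<bar> \<le> e)"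
      by (rule t0(2)[OF W]) (use a le e0 t0(1) w0 v1_0 L z k in \<open>auto simp: w_def\<close>)
    then have wR: "R < k * L" "\<And>r. 0 \<le> r \<Longrightarrow> r \<le> R \<Longrightarrow> 0 < w r" "\<bar>w R - ?U R\<bar> \<le> e" "\<bar>w1 R - ?U1 R\<bar> \<le> e"
      using R by auto
    \<comment> \<open>Closeness to the bubble keeps \<open>w\<close> positive up to
      \<open>R\<close>, so the node must lie beyond \<open>R\<close>.\<close>
    have "w (k * r1) = 0" using k z by (simp add: w_def)
    then have Rr: "R < k * r1" using wR(2)[of "k * r1"] s k by force
    have wpos: "0 < w t" if "0 \<le> t" "t < k * r1" for t
      using pos[of "t / k"] that k a by (simp add: w_def field_simps)
    have "(real n - 3) * w R \<le> - R * w1 R"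
    proof -
      have "(real n - 3) * w R \<le> (real n - 3) * (?U R + e)"
        using wR(3) n by (intro mult_left_mono) auto
      moreover have "R * w1 R \<le> R * (?U1 R + e)"
        using wR(4) R by (intro mult_left_mono) auto
      moreover have "(real n - 3) * e \<le> real n * e" using e by simp
      ultimately show ?thesis using e(2) by (simp add: algebra_simps)
    qed
    moreover have "0 < w R" using wR(2)[of R] R by simp
    ultimately have slope': "real n - 3 \<le> - R * w1 R / w R"
      by (simp only: pos_le_divide_eq)
    have P1: "P (k * r1) \<le> eps * \<bar>v 0\<bar> powr (- 2 * b) * C"
      unfolding C_def by (rule P_first_zero_le[OF R _ _ wpos w0 slope']) (use Rr s k in auto)
    have "(k * s) ^ n * \<bar>w (k * s)\<bar> powr (real n * b) / (real n * b) \<le> P (k * r1)"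
    proof (rule second_bump_le)
      fix t assume "k * r1 \<le> t" "t \<le> k * s"
      then have "\<bar>v (t / k)\<bar> \<le> \<bar>v s\<bar>" using k by (intro m) (auto simp: field_simps)
      then show "\<bar>w t\<bar> \<le> \<bar>w (k * s)\<bar>" using k a by (simp add: w_def abs_divide divide_right_mono)
    qed (use k s z in \<open>auto simp: w1_def\<close>)
    \<comment> \<open>Scale invariance: the factors \<open>k^n\<close> from the radius and from the
      normalised height cancel.\<close>
    also have "(k * s) ^ n * \<bar>w (k * s)\<bar> powr (real n * b) = (\<bar>v s\<bar> powr b * s) ^ n"
    proof -
      have pw: "x powr (real n * b) = (x powr b) ^ n" for x :: real
        using n powr_realpow[of "x powr b" n] by (cases "x = 0") (auto simp: powr_powr mult.commute)
      have "\<bar>w (k * s)\<bar> powr (real n * b) = (\<bar>v s\<bar> powr b) ^ n / k ^ n"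
        using k a by (simp add: w_def abs_divide powr_divide pw k_def power_divide)
      then show ?thesis using k by (simp add: power_mult_distrib)
    qed
    finally have "(\<bar>v s\<bar> powr b * s) ^ n / nb \<le> P (k * r1)"
      by (simp add: nb_def b)
    with P1 have "(\<bar>v s\<bar> powr b * s) ^ n / nb \<le> eps * \<bar>v 0\<bar> powr (- 2 * b) * C"
      by (rule order_trans[rotated])
    then have "(\<bar>v s\<bar> powr b * s) ^ n \<le> nb * (eps * \<bar>v 0\<bar> powr (- 2 * b) * C)"
      using nb_gt by (simp only: pos_divide_le_eq) (simp only: mult.commute)
    also have "\<dots> \<le> nb * (e0 * C)"
      using le a nb_gt C by (intro mult_left_mono mult_right_mono) auto
    also have "\<dots> \<le> \<theta> ^ n" using e0(3) by (simp add: algebra_simps)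
    finally have le: "(\<bar>v s\<bar> powr b * s) ^ n \<le> \<theta> ^ n" .
    have "0 \<le> \<bar>v s\<bar> powr b * s" "0 \<le> \<theta>" "0 < n" using \<theta> s n by simp_all
    from power_mono_iff[OF this] le show "\<bar>v s\<bar> powr b * s \<le> \<theta>" by blast
  qed
qed

section \<open>Derivatives of radial functions\<close>

lemma pd_eqI: "(f has_derivative f') (at x) \<Longrightarrow> pd b f x = f' b"
  unfolding pd_def by (simp add: frechet_derivative_at[symmetric])

lemma pd_cong:
  assumes "open S" "x \<in> S" "\<And>y. y \<in> S \<Longrightarrow> f y = g y"
  shows "pd b f x = pd b g x"
proof -
  have "(f has_derivative D) (at x) \<longleftrightarrow> (g has_derivative D) (at x)" for D
    using has_derivative_transform_within_open[OF _ assms(1,2)] assms(3) by metis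
  then show ?thesis by (simp add: pd_def frechet_derivative_def)
qed

lemma differentiable_cong_open:
  assumes "open S" "x \<in> S" "\<And>y. y \<in> S \<Longrightarrow> f y = g y"
  shows "f differentiable (at x) \<longleftrightarrow> g differentiable (at x)"
proof -
  have "(f has_derivative D) (at x) \<longleftrightarrow> (g has_derivative D) (at x)" for D
    using has_derivative_transform_within_open[OF _ assms(1,2)] assms(3) by metis
  then show ?thesis by (simp add: differentiable_def)
qed

lemma C2_on_cong:
  assumes "open S" "\<And>y. y \<in> S \<Longrightarrow> f y = g y"
  shows "C2_on S f \<longleftrightarrow> C2_on S g"
proof -
  have 1: "pd b f x = pd b g x" if "x \<in> S" for b x
    by (rule pd_cong[OF assms(1) that assms(2)])
  then have 2: "pd c (pd b f) x = pd c (pd b g) x" if "x \<in> S" for b c x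
    by (rule pd_cong[OF assms(1) that, of "pd b f" "pd b g"]) (simp add: 1)
  have d0: "f differentiable (at x) \<longleftrightarrow> g differentiable (at x)" if "x \<in> S" for x
    by (rule differentiable_cong_open[OF assms(1) that assms(2)])
  have d1: "pd b f differentiable (at x) \<longleftrightarrow> pd b g differentiable (at x)" if "x \<in> S" for x b
    by (rule differentiable_cong_open[OF assms(1) that 1])
  show ?thesis
    unfolding C2_on_def by (intro conj_cong ball_cong continuous_on_cong refl d0 d1 2)
qed

lemma C2_on_subset: "C2_on S f \<Longrightarrow> T \<subseteq> S \<Longrightarrow> C2_on T f"
  unfolding C2_on_def by (meson continuous_on_subset subsetD)

text \<open>The variable \<open>y \<bullet> y\<close> is smooth at the origin, unlike
  \<open>norm y\<close>. This form serves functions given by a smooth formula on the whole space,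
  such as the bubble and the eigenfunction.\<close>

lemma pd_radial_sq:
  fixes f :: "'a::euclidean_space \<Rightarrow> real"
  assumes "open S" "x \<in> S" "\<And>y. y \<in> S \<Longrightarrow> f y = G (y \<bullet> y)"
    and "(G has_real_derivative G1) (at (x \<bullet> x))"
  shows "f differentiable (at x)" "pd b f x = 2 * G1 * (x \<bullet> b)"
proof -
  have "((\<lambda>y. G (y \<bullet> y)) has_derivative (\<lambda>h. G1 * (2 * (x \<bullet> h)))) (at x)"
    by (rule has_derivative_compose[of "\<lambda>y. y \<bullet> y" "\<lambda>h. 2 * (x \<bullet> h)" x UNIV G "\<lambda>h. G1 * h"])
       (use assms(4) in \<open>auto intro!: derivative_eq_intros simp: has_field_derivative_def inner_commute\<close>)
  then have d: "(f has_derivative (\<lambda>h. G1 * (2 * (x \<bullet> h)))) (at x)"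
    by (rule has_derivative_transform_within_open[OF _ assms(1,2)]) (simp add: assms(3))
  then show "f differentiable (at x)" by (rule differentiableI)
  show "pd b f x = 2 * G1 * (x \<bullet> b)" using pd_eqI[OF d] by simp
qed

lemma pd2_radial_sq:
  fixes f :: "'a::euclidean_space \<Rightarrow> real"
  assumes S: "open S" "x \<in> S" "\<And>y. y \<in> S \<Longrightarrow> f y = G (y \<bullet> y)"
    and G1: "\<And>y. y \<in> S \<Longrightarrow> (G has_real_derivative G1 (y \<bullet> y)) (at (y \<bullet> y))"
    and G2: "(G1 has_real_derivative G2) (at (x \<bullet> x))"
  shows "pd b f differentiable (at x)"
    "pd c (pd b f) x = 4 * G2 * (x \<bullet> b) * (x \<bullet> c) + 2 * G1 (x \<bullet> x) * (b \<bullet> c)"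
proof -
  have pd: "pd b f y = 2 * G1 (y \<bullet> y) * (y \<bullet> b)" if "y \<in> S" for y
    using pd_radial_sq(2)[OF S(1) that S(3) G1[OF that]] .
  have "((\<lambda>y. G1 (y \<bullet> y)) has_derivative (\<lambda>h. G2 * (2 * (x \<bullet> h)))) (at x)"
    by (rule has_derivative_compose[of "\<lambda>y. y \<bullet> y" "\<lambda>h. 2 * (x \<bullet> h)" x UNIV G1 "\<lambda>h. G2 * h"])
       (use G2 in \<open>auto intro!: derivative_eq_intros simp: has_field_derivative_def inner_commute\<close>)
  then have "((\<lambda>y. 2 * G1 (y \<bullet> y) * (y \<bullet> b)) has_derivative
      (\<lambda>h. 2 * (G2 * (2 * (x \<bullet> h))) * (x \<bullet> b) + 2 * G1 (x \<bullet> x) * (h \<bullet> b))) (at x)"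
    by (auto intro!: derivative_eq_intros simp: algebra_simps)
  then have d: "(pd b f has_derivative
      (\<lambda>h. 2 * (G2 * (2 * (x \<bullet> h))) * (x \<bullet> b) + 2 * G1 (x \<bullet> x) * (h \<bullet> b))) (at x)"
    by (rule has_derivative_transform_within_open[OF _ S(1,2)]) (simp add: pd)
  then show "pd b f differentiable (at x)" by (rule differentiableI)
  show "pd c (pd b f) x = 4 * G2 * (x \<bullet> b) * (x \<bullet> c) + 2 * G1 (x \<bullet> x) * (b \<bullet> c)"
    using pd_eqI[OF d, of c] by (simp add: inner_commute)
qed

lemma C2_on_radial_sq:
  fixes f :: "'a::euclidean_space \<Rightarrow> real"
  assumes S: "open S" "\<And>y. y \<in> S \<Longrightarrow> f y = G (y \<bullet> y)"
    and G1: "\<And>y. y \<in> S \<Longrightarrow> (G has_real_derivative G1 (y \<bullet> y)) (at (y \<bullet> y))"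
    and G2: "\<And>y. y \<in> S \<Longrightarrow> (G1 has_real_derivative G2 (y \<bullet> y)) (at (y \<bullet> y))"
    and cont: "continuous_on S (\<lambda>y. G2 (y \<bullet> y))"
  shows "C2_on S f"
proof -
  have c1: "continuous_on S (\<lambda>y. G1 (y \<bullet> y))"
  proof -
    have "isCont (\<lambda>y. G1 (y \<bullet> y)) y" if "y \<in> S" for y
      by (rule isCont_o2[where f = "\<lambda>y. y \<bullet> y"]) (use DERIV_isCont[OF G2[OF that]] in \<open>auto intro!: continuous_intros\<close>)
    then show ?thesis by (simp add: continuous_at_imp_continuous_on)
  qed
  have "continuous_on S (pd c (pd b f))" for b c
  proof -
    have "continuous_on S (\<lambda>x. 4 * G2 (x \<bullet> x) * (x \<bullet> b) * (x \<bullet> c) + 2 * G1 (x \<bullet> x) * (b \<bullet> c))"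
      by (intro continuous_intros cont c1)
    then show ?thesis
      using pd2_radial_sq(2)[OF S(1) _ S(2) G1 G2] by (simp cong: continuous_on_cong)
  qed
  then show ?thesis
    unfolding C2_on_def
    by (intro conjI ballI pd_radial_sq(1)[OF S(1) _ S(2) G1] pd2_radial_sq(1)[OF S(1) _ S(2) G1 G2])
qed

text \<open>Profiles in the variable \<open>norm y\<close> require the origin to be removed; it is
  recovered later by continuity.\<close>

locale radial_profile =
  fixes S :: "'a::euclidean_space set" and f :: "'a \<Rightarrow> real" and w w1 w2 :: "real \<Rightarrow> real"
  assumes S: "open S" "0 \<notin> S" and f: "\<And>y. y \<in> S \<Longrightarrow> f y = w (norm y)"
    and w1: "\<And>y. y \<in> S \<Longrightarrow> (w has_real_derivative w1 (norm y)) (at (norm y))"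
    and w2: "\<And>y. y \<in> S \<Longrightarrow> (w1 has_real_derivative w2 (norm y)) (at (norm y))"
begin

lemma norm_pos: "y \<in> S \<Longrightarrow> 0 < norm y"
  using S by auto

lemma f_eq: "y \<in> S \<Longrightarrow> f y = w (sqrt (y \<bullet> y))"
  by (simp add: f norm_eq_sqrt_inner)

lemma DERIV_w_sqrt:
  assumes "y \<in> S"
  shows "((\<lambda>t. w (sqrt t)) has_real_derivative w1 (sqrt (y \<bullet> y)) / (2 * sqrt (y \<bullet> y))) (at (y \<bullet> y))"
proof -
  have y: "0 < y \<bullet> y" using norm_pos[OF assms] by simp
  show ?thesis
    by (rule DERIV_cong[OF DERIV_chain2[OF w1[OF assms, unfolded norm_eq_sqrt_inner] DERIV_real_sqrt[OF y]]])
      (simp add: field_simps)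
qed

lemma DERIV_w1_sqrt:
  assumes "y \<in> S"
  shows "((\<lambda>t. w1 (sqrt t) / (2 * sqrt t)) has_real_derivative
    (w2 (sqrt (y \<bullet> y)) / (sqrt (y \<bullet> y))\<^sup>2 - w1 (sqrt (y \<bullet> y)) / sqrt (y \<bullet> y) ^ 3) / 4) (at (y \<bullet> y))"
proof -
  have y: "0 < y \<bullet> y" using norm_pos[OF assms] by simp
  then have "sqrt (y \<bullet> y) > 0" by simp
  then show ?thesis
    by (intro DERIV_cong[OF DERIV_divide[OF DERIV_chain2[OF w2[OF assms, unfolded norm_eq_sqrt_inner] DERIV_real_sqrt[OF y]]
      DERIV_cmult[OF DERIV_real_sqrt[OF y]]]]) (auto simp: field_simps power2_eq_square power3_eq_cube)
qed

lemma pd: "x \<in> S \<Longrightarrow> pd b f x = w1 (norm x) / norm x * (x \<bullet> b)"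
  using pd_radial_sq(2)[OF S(1) _ f_eq DERIV_w_sqrt, of x b] by (simp add: norm_eq_sqrt_inner)

lemma pd2: "x \<in> S \<Longrightarrow> pd c (pd b f) x =
    (w2 (norm x) / (norm x)\<^sup>2 - w1 (norm x) / norm x ^ 3) * (x \<bullet> b) * (x \<bullet> c) + w1 (norm x) / norm x * (b \<bullet> c)"
proof -
  assume x: "x \<in> S"
  have "4 * (t / 4) = t" "2 * (t / (2 * z)) = t / z" for t z :: real by simp_all
  then show ?thesis
    using pd2_radial_sq(2)[OF S(1) x f_eq DERIV_w_sqrt DERIV_w1_sqrt[OF x]]
    unfolding norm_eq_sqrt_inner by presburger
qed

lemma C2: 
  assumes "continuous_on S (\<lambda>y. w2 (norm y))"
  shows "C2_on S f"
proof (rule C2_on_radial_sq[OF S(1) f_eq DERIV_w_sqrt DERIV_w1_sqrt])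
  have "isCont (\<lambda>y. w1 (norm y)) y" if "y \<in> S" for y
    by (rule isCont_o2[where f = "norm"]) (use DERIV_isCont[OF w2[OF that]] in \<open>auto intro!: continuous_intros\<close>)
  then have "continuous_on S (\<lambda>y. w1 (norm y))" by (simp add: continuous_at_imp_continuous_on)
  with assms show "continuous_on S (\<lambda>y. (w2 (sqrt (y \<bullet> y)) / (sqrt (y \<bullet> y))\<^sup>2 - w1 (sqrt (y \<bullet> y)) / sqrt (y \<bullet> y) ^ 3) / 4)"
    using S(2) unfolding norm_eq_sqrt_inner[symmetric] by (intro continuous_intros) auto
qed

lemma laplacian:
  assumes "x \<in> S"
  shows "laplacian f x = w2 (norm x) + (real DIM('a) - 1) / norm x * w1 (norm x)"
proof -
  define r where "r = norm x"
  have r: "r > 0" using norm_pos[OF assms] by (simp add: r_def)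
  have "laplacian f x = (\<Sum>b\<in>Basis. (w2 r / r\<^sup>2 - w1 r / r ^ 3) * ((x \<bullet> b) * (x \<bullet> b)) + w1 r / r)"
    unfolding laplacian_def pd2[OF assms] r_def by (simp add: mult.assoc)
  also have "\<dots> = (w2 r / r\<^sup>2 - w1 r / r ^ 3) * (\<Sum>b\<in>Basis. (x \<bullet> b) * (x \<bullet> b)) + real DIM('a) * (w1 r / r)"
    by (simp add: sum.distrib sum_distrib_left)
  also have "(\<Sum>b\<in>Basis. (x \<bullet> b) * (x \<bullet> b)) = r\<^sup>2"
    unfolding r_def power2_norm_eq_inner by (rule euclidean_inner[symmetric])
  also have "(w2 r / r\<^sup>2 - w1 r / r ^ 3) * r\<^sup>2 = w2 r - w1 r / r"
    using r by (simp add: field_simps power2_eq_square power3_eq_cube)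
  also have "w2 r - w1 r / r + real DIM('a) * (w1 r / r) = w2 r + (real DIM('a) - 1) / r * w1 r"
    using r by (simp add: field_simps)
  finally show ?thesis unfolding r_def .
qed

end

text \<open>The Hessian of a radial function has radial part \<open>w2\<close> and tangential part
  \<open>w1 / r\<close>. This explains the weight \<open>norm x\<close> on the error of
  \<open>w1\<close>, and the constant: \<open>2 * e\<close> for the difference of the two parts plus
  \<open>e\<close> for the tangential one.\<close>

lemma radial_profile_close:
  fixes f g :: "'a::euclidean_space \<Rightarrow> real"
  assumes "radial_profile S f w w1 w2" "radial_profile S g v v1 v2" and x: "x \<in> S"
    and d: "\<bar>w (norm x) - v (norm x)\<bar> \<le> e" "\<bar>w1 (norm x) - v1 (norm x)\<bar> \<le> e * norm x"
      "\<bar>w2 (norm x) - v2 (norm x)\<bar> \<le> e"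
    and bc: "b \<in> Basis" "c \<in> Basis"
  shows "\<bar>f x - g x\<bar> \<le> e" "\<bar>pd b f x - pd b g x\<bar> \<le> e * norm x" "\<bar>pd c (pd b f) x - pd c (pd b g) x\<bar> \<le> 3 * e"
proof -
  interpret f: radial_profile S f w w1 w2 by fact
  interpret g: radial_profile S g v v1 v2 by fact
  define r where "r = norm x"
  have r: "r > 0" using f.norm_pos[OF x] by (simp add: r_def)
  show "\<bar>f x - g x\<bar> \<le> e" using f.f[OF x] g.f[OF x] d by simp
  have e: "e \<ge> 0" using d by linarith
  have xb: "\<bar>x \<bullet> b\<bar> \<le> r" "\<bar>x \<bullet> c\<bar> \<le> r" using bc by (auto simp: r_def Basis_le_norm)
  define D where "D = (w1 r - v1 r) / r"
  define D2 where "D2 = w2 r - v2 r"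
  have D: "\<bar>D\<bar> \<le> e" "\<bar>D2\<bar> \<le> e" using d r by (auto simp: D_def D2_def r_def[symmetric] divide_le_eq)
  have "pd b f x - pd b g x = D * (x \<bullet> b)"
    unfolding f.pd[OF x] g.pd[OF x] r_def[symmetric] D_def by (simp add: algebra_simps diff_divide_distrib)
  also have "\<bar>\<dots>\<bar> \<le> e * r"
    unfolding abs_mult using D xb e by (intro mult_mono) auto
  finally show "\<bar>pd b f x - pd b g x\<bar> \<le> e * norm x" by (simp add: r_def)
  have "pd c (pd b f) x - pd c (pd b g) x = (D2 - D) * ((x \<bullet> b) / r * ((x \<bullet> c) / r)) + D * (b \<bullet> c)"
    unfolding f.pd2[OF x] g.pd2[OF x] r_def[symmetric] D_def D2_def using r
    by (simp add: field_simps power2_eq_square power3_eq_cube)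
  also have "\<bar>\<dots>\<bar> \<le> \<bar>(D2 - D) * ((x \<bullet> b) / r * ((x \<bullet> c) / r))\<bar> + \<bar>D * (b \<bullet> c)\<bar>"
    by (rule abs_triangle_ineq)
  also have "\<bar>(D2 - D) * ((x \<bullet> b) / r * ((x \<bullet> c) / r))\<bar> \<le> (2 * e) * (1 * 1)"
    unfolding abs_mult using D xb r e by (intro mult_mono) (auto simp: divide_le_eq)
  also have "\<bar>D * (b \<bullet> c)\<bar> \<le> e * 1"
    unfolding abs_mult using D e bc by (intro mult_mono) (auto simp: inner_Basis)
  finally show "\<bar>pd c (pd b f) x - pd c (pd b g) x\<bar> \<le> 3 * e" by simp
qed

text \<open>Besides the rescaling itself, the case \<open>k = 1\<close>, \<open>c = -1\<close> gives
  the rules for negation.\<close>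

lemma C2_on_scale:
  fixes u :: "'a::euclidean_space \<Rightarrow> real"
  assumes u: "C2_on (ball 0 1) u" and k: "k > 0"
  shows "C2_on (ball 0 k) (\<lambda>y. c * u (y /\<^sub>R k))"
    and "\<And>y b d. y \<in> ball 0 k \<Longrightarrow> b \<in> Basis \<Longrightarrow>
      pd d (pd b (\<lambda>y. c * u (y /\<^sub>R k))) y = c / k / k * pd d (pd b u) (y /\<^sub>R k)"
proof -
  from u have u3: "continuous_on (ball 0 1) (pd d (pd b u))" if "b \<in> Basis" "d \<in> Basis" for b d
    using that unfolding C2_on_def by auto
  have mem: "y /\<^sub>R k \<in> ball 0 1" if "y \<in> ball 0 k" for y :: 'a
    using that k by (auto simp: field_simps)
  have gen: "(\<lambda>y. c * f (y /\<^sub>R k)) differentiable (at y) \<and> pd b (\<lambda>y. c * f (y /\<^sub>R k)) y = c / k * pd b f (y /\<^sub>R k)"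
    if "f differentiable (at (y /\<^sub>R k))" for f :: "'a \<Rightarrow> real" and y b c
  proof -
    define F where "F = frechet_derivative f (at (y /\<^sub>R k))"
    have F: "(f has_derivative F) (at (y /\<^sub>R k))"
      using that by (simp add: F_def frechet_derivative_works)
    then have lin: "linear F" by (rule has_derivative_linear)
    have "((\<lambda>y. f (y /\<^sub>R k)) has_derivative (\<lambda>h. F (h /\<^sub>R k))) (at y)"
      by (rule has_derivative_compose[of "\<lambda>y. y /\<^sub>R k" "\<lambda>h. h /\<^sub>R k" y UNIV f F])
        (use F in \<open>auto intro!: derivative_eq_intros\<close>)
    then have d: "((\<lambda>y. c * f (y /\<^sub>R k)) has_derivative (\<lambda>h. c * F (h /\<^sub>R k))) (at y)"
      by (auto intro!: derivative_eq_intros)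
    then show ?thesis
      using pd_eqI[OF d, of b] lin by (auto simp: differentiable_def linear_scale pd_def F_def[symmetric] divide_inverse)
  qed
  let ?f = "\<lambda>y. c * u (y /\<^sub>R k)"
  have p1: "?f differentiable (at y)" "pd b ?f y = c / k * pd b u (y /\<^sub>R k)" if "y \<in> ball 0 k" for y b
    using gen[of u y c b] u mem[OF that] unfolding C2_on_def by blast+
  have p2: "pd b ?f differentiable (at y)" "pd d (pd b ?f) y = c / k / k * pd d (pd b u) (y /\<^sub>R k)"
    if "y \<in> ball 0 k" "b \<in> Basis" for y b d
  proof -
    have "pd b u differentiable (at (y /\<^sub>R k))" using u mem[OF that(1)] that(2) unfolding C2_on_def by blast
    from gen[OF this, of "c / k" d] show "pd b ?f differentiable (at y)" "pd d (pd b ?f) y = c / k / k * pd d (pd b u) (y /\<^sub>R k)"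
      using differentiable_cong_open[OF open_ball that(1), of "pd b ?f" "\<lambda>y. c / k * pd b u (y /\<^sub>R k)"]
        pd_cong[OF open_ball that(1), of "pd b ?f" "\<lambda>y. c / k * pd b u (y /\<^sub>R k)"] p1(2) by auto
  qed
  have "continuous_on (ball 0 k) (pd d (pd b ?f))" if "b \<in> Basis" "d \<in> Basis" for b d
  proof -
    have "continuous_on (ball 0 k) (\<lambda>y. c / k / k * pd d (pd b u) (y /\<^sub>R k))"
      using mem by (intro continuous_intros continuous_on_compose2[OF u3[OF that]]) auto
    then show ?thesis by (subst continuous_on_cong[OF refl p2(2)[OF _ that(1)]])
  qed
  then show "C2_on (ball 0 k) ?f"
    unfolding C2_on_def by (intro conjI ballI) (rule p1(1) p2(1), assumption+)+
  show "\<And>y b d. y \<in> ball 0 k \<Longrightarrow> b \<in> Basis \<Longrightarrow> pd d (pd b ?f) y = c / k / k * pd d (pd b u) (y /\<^sub>R k)"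
    by (rule p2(2))
qed

section \<open>The first Dirichlet eigenvalue\<close>

lemma DERIV_line:
  assumes "f differentiable (at (z + t *\<^sub>R b))"
  shows "((\<lambda>t. f (z + t *\<^sub>R b)) has_real_derivative pd b f (z + t *\<^sub>R b)) (at t)"
proof -
  define F where "F = frechet_derivative f (at (z + t *\<^sub>R b))"
  have F: "(f has_derivative F) (at (z + t *\<^sub>R b))"
    using assms by (simp add: F_def frechet_derivative_works)
  have "((\<lambda>t. f (z + t *\<^sub>R b)) has_derivative (\<lambda>h. F (h *\<^sub>R b))) (at t)"
    by (rule has_derivative_compose[of "\<lambda>t. z + t *\<^sub>R b" "\<lambda>h. h *\<^sub>R b" t UNIV f F])
      (use F in \<open>auto intro!: derivative_eq_intros\<close>)
  moreover have "(\<lambda>h. F (h *\<^sub>R b)) = (*) (pd b f (z + t *\<^sub>R b))"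
    using has_derivative_linear[OF F] by (simp add: linear_scale pd_def F_def[symmetric] mult.commute fun_eq_iff)
  ultimately show ?thesis by (simp add: has_field_derivative_def)
qed

lemma second_deriv_nonpos_at_max:
  fixes g g1 :: "real \<Rightarrow> real"
  assumes d: "d > 0" and g1: "\<And>t. \<bar>t\<bar> < d \<Longrightarrow> (g has_real_derivative g1 t) (at t)"
    and g2: "(g1 has_real_derivative D) (at 0)" and max: "\<And>t. \<bar>t\<bar> < d \<Longrightarrow> g t \<le> g 0"
  shows "D \<le> 0"
proof (rule ccontr)
  assume "\<not> D \<le> 0"
  then obtain h where h: "h > 0" "\<And>t. 0 < t \<Longrightarrow> t < h \<Longrightarrow> g1 0 < g1 t"
    using DERIV_pos_inc_right[OF g2] by auto
  have "g1 0 = 0"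
    by (rule DERIV_local_max[OF g1 d]) (use d max in auto)
  define t where "t = min h d / 2"
  have t: "0 < t" "t < h" "t < d" using h d by (auto simp: t_def)
  have "g 0 < g t"
  proof (rule DERIV_pos_imp_increasing_open[OF t(1)])
    fix x assume "0 < x" "x < t"
    then show "\<exists>y. (g has_real_derivative y) (at x) \<and> 0 < y"
      using g1[of x] h(2)[of x] t \<open>g1 0 = 0\<close> by auto
  next
    show "continuous_on {0..t} g"
      using t by (intro continuous_at_imp_continuous_on ballI DERIV_isCont[OF g1]) auto
  qed
  then show False using max[of t] t by auto
qed

text \<open>Compare \<open>\<psi>\<close> with the supersolution \<open>2 - |x|\<^sup>2\<close> at a maximum of their quotient.\<close>

lemma DIM_le_potential:
  fixes \<psi> :: "'a::euclidean_space \<Rightarrow> real"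
  assumes C2: "C2_on (ball 0 1) \<psi>" and cont: "continuous_on (cball 0 1) \<psi>"
    and bd: "\<And>x. x \<in> sphere 0 1 \<Longrightarrow> \<psi> x = 0" and x0: "x0 \<in> ball 0 1" "\<psi> x0 > 0"
    and lap: "\<And>x. x \<in> ball 0 1 \<Longrightarrow> \<psi> x > 0 \<Longrightarrow> - laplacian \<psi> x \<le> V * \<psi> x"
  shows "real DIM('a) \<le> V"
proof -
  have nn: "x \<bullet> x \<le> 1" if "x \<in> cball 0 1" for x :: 'a
    using that by (simp add: dot_square_norm abs_square_le_1)
  \<comment> \<open>On the closed ball the denominator lies between \<open>1\<close> and
    \<open>2\<close>, so the quotient is continuous up to the boundary and attains its
    maximum.\<close>
  define q where "q x = \<psi> x / (2 - x \<bullet> x)" for x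
  have "continuous_on (cball 0 1) q"
    unfolding q_def using nn by (intro continuous_intros cont) force
  then obtain z where z: "z \<in> cball 0 1" "\<And>x. x \<in> cball 0 1 \<Longrightarrow> q x \<le> q z"
    using continuous_attains_sup[of "cball (0::'a) 1" q] by auto
  define c where "c = q z"
  have "0 < q x0" using x0 nn[of x0] by (simp add: q_def)
  then have c: "c > 0" using z(2)[of x0] x0 by (simp add: c_def)
  have zb: "z \<in> ball 0 1"
    using c z(1) bd[of z] by (auto simp: c_def q_def less_le)
  have psiz: "\<psi> z = c * (2 - z \<bullet> z)" using nn[OF z(1)] by (simp add: c_def q_def)
  have le: "\<psi> x - c * (2 - x \<bullet> x) \<le> 0" if "x \<in> ball 0 1" for x
    using z(2)[of x] that nn[of x] by (simp add: c_def[symmetric] q_def[of x] divide_le_eq mult.commute)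
  obtain d where d: "d > 0" "ball z d \<subseteq> ball 0 1"
    using zb open_ball openE by metis
  \<comment> \<open>The function \<open>\<psi> - c (2 - |x|^2)\<close> is nonpositive and vanishes
    at \<open>z\<close>; the comparison function contributes \<open>2 * c\<close> in each
    direction.\<close>
  have "pd b (pd b \<psi>) z + 2 * c \<le> 0" if b: "b \<in> Basis" for b
  proof -
    have inb: "z + t *\<^sub>R b \<in> ball 0 1" if "\<bar>t\<bar> < d" for t
    proof -
      have "z + t *\<^sub>R b \<in> ball z d" using that b by (simp add: dist_norm)
      then show ?thesis using d(2) by blast
    qed
    define g where "g t = \<psi> (z + t *\<^sub>R b) - c * (2 - (z + t *\<^sub>R b) \<bullet> (z + t *\<^sub>R b))" for t
    define g1 where "g1 t = pd b \<psi> (z + t *\<^sub>R b) + 2 * c * (z \<bullet> b + t)" for t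
    have sq: "(z + t *\<^sub>R b) \<bullet> (z + t *\<^sub>R b) = z \<bullet> z + 2 * t * (z \<bullet> b) + t * t" for t
      using b by (simp add: inner_add_left inner_add_right inner_Basis inner_commute)
    show ?thesis
    proof (rule second_deriv_nonpos_at_max[OF d(1), of g g1])
      fix t assume t: "\<bar>t\<bar> < d"
      then have "\<psi> differentiable (at (z + t *\<^sub>R b))"
        using C2 inb by (simp add: C2_on_def)
      from DERIV_line[OF this] show "(g has_real_derivative g1 t) (at t)"
        unfolding g_def[abs_def] g1_def sq by (auto intro!: derivative_eq_intros simp: algebra_simps)
      show "g t \<le> g 0" using le[OF inb[OF t]] psiz by (simp add: g_def)
    next
      have "pd b \<psi> differentiable (at (z + 0 *\<^sub>R b))"
        using C2 zb b by (simp add: C2_on_def)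
      from DERIV_line[OF this] show "(g1 has_real_derivative pd b (pd b \<psi>) z + 2 * c) (at 0)"
        unfolding g1_def[abs_def] by (auto intro!: derivative_eq_intros)
    qed
  qed
  then have "(\<Sum>b\<in>Basis. pd b (pd b \<psi>) z + 2 * c) \<le> 0" by (rule sum_nonpos)
  then have "real DIM('a) * (2 * c) \<le> - laplacian \<psi> z"
    by (simp add: laplacian_def sum.distrib)
  also have "\<dots> \<le> V * (c * (2 - z \<bullet> z))"
    using lap[OF zb] psiz c nn[OF z(1)] by simp
  finally have V: "real DIM('a) * 2 \<le> V * (2 - z \<bullet> z)"
    using c by (simp add: mult.assoc mult.left_commute[of _ c])
  \<comment> \<open>The sign of \<open>V\<close> is needed before \<open>2 - z \<bullet> z\<close>
    can be replaced by its upper bound \<open>2\<close>.\<close>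
  have "0 < V * (2 - z \<bullet> z)" using V by (rule less_le_trans[rotated]) simp
  then have "V > 0" using nn[OF z(1)] by (simp add: zero_less_mult_iff)
  then have "V * (2 - z \<bullet> z) \<le> V * 2" by (intro mult_left_mono) auto
  with V show ?thesis by simp
qed

text \<open>The maximum principle asks for a point of positivity; where the eigenfunction offers a
  negative value, its negative is used.\<close>

lemma dirichlet_eigenvalue_ge_DIM:
  assumes "dirichlet_eigenvalue TYPE('a::euclidean_space) \<Lambda>"
  shows "real DIM('a) \<le> \<Lambda>"
proof -
  obtain \<phi> :: "'a \<Rightarrow> real" and x where \<phi>: "C2_on (ball 0 1) \<phi>" "continuous_on (cball 0 1) \<phi>"
    and x: "x \<in> ball 0 1" "\<phi> x \<noteq> 0" and eq: "\<And>x. x \<in> ball 0 1 \<Longrightarrow> - laplacian \<phi> x = \<Lambda> * \<phi> x"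
    and bd: "\<And>x. x \<in> sphere 0 1 \<Longrightarrow> \<phi> x = 0"
    using assms unfolding dirichlet_eigenvalue_def by blast
  show ?thesis
  proof (cases "\<phi> x > 0")
    case True
    then show ?thesis using \<phi> x eq bd by (intro DIM_le_potential[of \<phi> x]) auto
  next
    case False
    have lap: "laplacian (\<lambda>y. - \<phi> y) y = - laplacian \<phi> y" if "y \<in> ball 0 1" for y
      using C2_on_scale(2)[OF \<phi>(1), of 1 y _ _ "-1"] that by (simp add: laplacian_def sum_negf)
    show ?thesis
    proof (rule DIM_le_potential[of "\<lambda>y. - \<phi> y" x])
      show "C2_on (ball 0 1) (\<lambda>y. - \<phi> y)" using C2_on_scale(1)[OF \<phi>(1), of 1 "-1"] by simp
    qed (use \<phi> x False bd eq lap in \<open>auto intro!: continuous_intros\<close>)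
  qed
qed

section \<open>A Bessel series with a positive zero\<close>

context
  fixes n :: nat
  assumes n: "n \<ge> 7"
begin

text \<open>Coefficients of the hypergeometric series 0F1 with parameter \<open>n / 2\<close> at
  \<open>- t / 4\<close>. Up to a power of \<open>t\<close> and a constant this is the Bessel
  function of order \<open>n / 2 - 1\<close> at \<open>sqrt t\<close>, whose value at
  \<open>t = |x|^2\<close> is the radial solution of \<open>- \<Delta> f = f\<close>.\<close>

definition bessel_series_coeff :: "nat \<Rightarrow> real" where
  "bessel_series_coeff k = (- 1) ^ k / (4 ^ k * fact k * pochhammer (real n / 2) k)"

definition bessel_series :: "real \<Rightarrow> real" where "bessel_series t = (\<Sum>k. bessel_series_coeff k * t ^ k)"
definition bessel_series1 :: "real \<Rightarrow> real" where "bessel_series1 t = (\<Sum>k. diffs bessel_series_coeff k * t ^ k)"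
definition bessel_series2 :: "real \<Rightarrow> real" where "bessel_series2 t = (\<Sum>k. diffs (diffs bessel_series_coeff) k * t ^ k)"

text \<open>Allows the coefficients to be dominated by \<open>1 / k!\<close>, hence convergence
  everywhere.\<close>

lemma pochhammer_ge_1: "1 \<le> pochhammer (real n / 2) k"
proof (induction k)
  case (Suc k)
  have "1 * 1 \<le> pochhammer (real n / 2) k * (real n / 2 + real k)"
    using Suc n by (intro mult_mono) auto
  then show ?case by (simp add: pochhammer_rec' mult.commute)
qed simp

lemma bessel_series_coeff_rec: "4 * real (Suc k) * (real n / 2 + real k) * bessel_series_coeff (Suc k) = - bessel_series_coeff k"
proof -
  define a c p where "a = real (Suc k)" and "c = real n / 2 + real k" and "p = pochhammer (real n / 2) k"
  have nz: "a \<noteq> 0" "c \<noteq> 0" "p \<noteq> 0"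
    using n pochhammer_ge_1[of k] unfolding a_def c_def p_def by (auto simp: add_nonneg_eq_0_iff)
  have e1: "bessel_series_coeff (Suc k) = - 1 * (- 1) ^ k / (4 * 4 ^ k * (a * fact k) * (c * p))"
    unfolding a_def c_def p_def by (simp only: bessel_series_coeff_def pochhammer_rec' fact_Suc power_Suc)
  have e2: "bessel_series_coeff k = (- 1) ^ k / (4 ^ k * fact k * p)"
    by (simp only: bessel_series_coeff_def p_def)
  show ?thesis
    unfolding e1 e2 a_def[symmetric] c_def[symmetric] using nz by (simp add: field_simps)
qed

lemma summable_bessel_series: "summable (\<lambda>k. bessel_series_coeff k * t ^ k)"
proof (rule summable_comparison_test')
  show "summable (\<lambda>k. inverse (fact k) * \<bar>t\<bar> ^ k)" by (rule summable_exp)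
  fix k
  have "1 * fact k * 1 \<le> 4 ^ k * fact k * pochhammer (real n / 2) k"
    using pochhammer_ge_1[of k] by (intro mult_mono) auto
  then have le: "fact k \<le> 4 ^ k * fact k * pochhammer (real n / 2) k" by simp
  have "\<bar>bessel_series_coeff k\<bar> = 1 / (4 ^ k * fact k * pochhammer (real n / 2) k)"
    using pochhammer_ge_1[of k] by (simp add: bessel_series_coeff_def abs_mult power_abs)
  also have "\<dots> \<le> 1 / fact k"
    using le pochhammer_ge_1[of k] by (intro divide_left_mono) (auto intro!: mult_pos_pos)
  finally have "\<bar>bessel_series_coeff k\<bar> \<le> inverse (fact k)" by (simp add: divide_inverse)
  then show "norm (bessel_series_coeff k * t ^ k) \<le> inverse (fact k) * \<bar>t\<bar> ^ k"
    by (simp add: abs_mult power_abs mult_right_mono)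
qed

lemma summable_bessel_series1: "summable (\<lambda>k. diffs bessel_series_coeff k * t ^ k)"
  and summable_bessel_series2: "summable (\<lambda>k. diffs (diffs bessel_series_coeff) k * t ^ k)"
  by (intro termdiff_converges_all summable_bessel_series)+

lemma DERIV_bessel_series: "(bessel_series has_real_derivative bessel_series1 t) (at t)"
  unfolding bessel_series_def[abs_def] bessel_series1_def
  by (rule termdiffs_strong_converges_everywhere) (rule summable_bessel_series)

lemma DERIV_bessel_series1: "(bessel_series1 has_real_derivative bessel_series2 t) (at t)"
  unfolding bessel_series1_def[abs_def] bessel_series2_def
  by (rule termdiffs_strong_converges_everywhere) (rule summable_bessel_series1)

lemma bessel_series_0: "bessel_series 0 = 1" "bessel_series1 0 = - 1 / (2 * real n)"
  unfolding bessel_series_def bessel_series1_def powser_zero using n by (simp_all add: bessel_series_coeff_def diffs_def)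

text \<open>For \<open>f x = B (x \<bullet> x)\<close> the Laplacian is
  \<open>4 t B'' + 2 n B'\<close> at \<open>t = x \<bullet> x\<close>, so this is
  \<open>\<Delta> f = - f\<close> in the squared radius.\<close>

lemma bessel_series_ode: "4 * t * bessel_series2 t + 2 * real n * bessel_series1 t + bessel_series t = 0"
proof -
  have "(\<lambda>k. t * (diffs (diffs bessel_series_coeff) k * t ^ k)) sums (t * bessel_series2 t)"
    unfolding bessel_series2_def by (intro sums_mult summable_sums summable_bessel_series2)
  then have "(\<lambda>k. (\<lambda>k. real k * diffs bessel_series_coeff k * t ^ k) (Suc k)) sums (t * bessel_series2 t)"
    by (simp add: diffs_def algebra_simps)
  \<comment> \<open>The index shift is free because the term at \<open>k = 0\<close> carries the
    factor \<open>real k\<close>.\<close>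
  then have "(\<lambda>k. real k * diffs bessel_series_coeff k * t ^ k) sums (t * bessel_series2 t)"
    by (subst (asm) sums_Suc_iff) simp
  from sums_add[OF sums_add[OF sums_mult[OF this, of 4]
      sums_mult[OF summable_sums[OF summable_bessel_series1[of t]], of "2 * real n"]] summable_sums[OF summable_bessel_series[of t]]]
  have "(\<lambda>k. 4 * (real k * diffs bessel_series_coeff k * t ^ k) + 2 * real n * (diffs bessel_series_coeff k * t ^ k) + bessel_series_coeff k * t ^ k)
      sums (4 * (t * bessel_series2 t) + 2 * real n * bessel_series1 t + bessel_series t)"
    by (simp add: bessel_series_def bessel_series1_def)
  moreover have "4 * (real k * diffs bessel_series_coeff k * t ^ k) + 2 * real n * (diffs bessel_series_coeff k * t ^ k) + bessel_series_coeff k * t ^ k = 0" for k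
  proof -
    have "4 * (real k * diffs bessel_series_coeff k * t ^ k) + 2 * real n * (diffs bessel_series_coeff k * t ^ k) + bessel_series_coeff k * t ^ k
       = (4 * real (Suc k) * (real n / 2 + real k) * bessel_series_coeff (Suc k) + bessel_series_coeff k) * t ^ k"
      by (simp add: diffs_def algebra_simps)
    then show ?thesis unfolding bessel_series_coeff_rec by simp
  qed
  ultimately have "(\<lambda>k. 0) sums (4 * (t * bessel_series2 t) + 2 * real n * bessel_series1 t + bessel_series t)" by simp
  from sums_unique2[OF this sums_zero] show ?thesis by (simp add: mult.assoc)
qed

text \<open>Were \<open>bessel_series\<close> positive, \<open>Q = - bessel_series1 / bessel_series\<close> would solve \<open>4 t Q' = 4 t Q\<^sup>2 - 2 n Q + 1\<close>,
  stay above \<open>1 / (2 n)\<close> and blow up in finite time.\<close>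

lemma bessel_series_zero: "\<exists>t>0. bessel_series t = 0"
proof (rule ccontr)
  assume no: "\<not> (\<exists>t>0. bessel_series t = 0)"
  have contb: "continuous_on S bessel_series" "continuous_on S bessel_series1" for S
    using DERIV_isCont[OF DERIV_bessel_series] DERIV_isCont[OF DERIV_bessel_series1] by (auto intro: continuous_at_imp_continuous_on)
  have pos: "bessel_series t > 0" if "t \<ge> 0" for t
  proof (rule ccontr)
    assume "\<not> bessel_series t > 0"
    then have "\<exists>x\<ge>0. x \<le> t \<and> bessel_series x = 0"
      using that contb bessel_series_0 by (intro IVT2') auto
    then obtain x where "0 \<le> x" "bessel_series x = 0" by blast
    then show False using no bessel_series_0 by (cases "x = 0") auto
  qed
  define Q where "Q t = - bessel_series1 t / bessel_series t" for t
  define Q1 where "Q1 t = (Q t)\<^sup>2 - real n * Q t / (2 * t) + 1 / (4 * t)" for t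
  have dQ: "(Q has_real_derivative Q1 t) (at t)" if "t > 0" for t
  proof -
    have b: "bessel_series t > 0" using pos that by simp
    have e: "bessel_series2 t = (- 2 * real n * bessel_series1 t - bessel_series t) / (4 * t)"
      using bessel_series_ode[of t] that by (simp add: field_simps)
    have "(Q has_real_derivative (- bessel_series2 t * bessel_series t - - bessel_series1 t * bessel_series1 t) / (bessel_series t * bessel_series t)) (at t)"
      unfolding Q_def[abs_def] using b by (intro DERIV_divide DERIV_minus DERIV_bessel_series DERIV_bessel_series1) auto
    moreover have "(- bessel_series2 t * bessel_series t - - bessel_series1 t * bessel_series1 t) / (bessel_series t * bessel_series t) = Q1 t"
      unfolding Q1_def Q_def e using b that by (simp add: field_simps power2_eq_square)
    ultimately show ?thesis by simp
  qed
  have contQ: "continuous_on {x..y} Q" if "0 \<le> x" for x y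
  proof -
    have "bessel_series t \<noteq> 0" if "t \<in> {x..y}" for t using pos[of t] that \<open>0 \<le> x\<close> by simp
    then show ?thesis unfolding Q_def[abs_def] by (intro continuous_intros contb ballI)
  qed
  \<comment> \<open>\<open>y\<close> is both \<open>Q 0\<close> and the zero of the linear part
    \<open>1 - 2 n Q\<close>. With the integrating factor \<open>t powr (n / 2)\<close> only the
    nonnegative square survives.\<close>
  define y where "y = 1 / (2 * real n)"
  have Qy: "Q t \<ge> y" if t: "t > 0" for t
  proof -
    have "0 powr (real n / 2) * (Q 0 - y) \<le> t powr (real n / 2) * (Q t - y)"
    proof (rule DERIV_nonneg_imp_increasing_open[of 0 t "\<lambda>t. t powr (real n / 2) * (Q t - y)"])
      fix x assume "0 < x" "x < t"
      then have x: "x > 0" by simp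
      have dp: "((\<lambda>t. t powr (real n / 2)) has_real_derivative real n / 2 * x powr (real n / 2 - 1)) (at x)"
        using x by (rule has_real_derivative_powr)
      have dq: "((\<lambda>t. Q t - y) has_real_derivative Q1 x) (at x)"
        using DERIV_diff[OF dQ[OF x] DERIV_const[of y]] by simp
      have xx: "x powr (real n / 2) = x * x powr (real n / 2 - 1)"
        using powr_mult_base[of x "real n / 2 - 1"] x by simp
      have "((\<lambda>t. t powr (real n / 2) * (Q t - y)) has_real_derivative x powr (real n / 2) * (Q x)\<^sup>2) (at x)"
        by (rule DERIV_cong[OF DERIV_mult[OF dp dq]])
          (use x n in \<open>simp add: xx Q1_def y_def field_simps\<close>)
      then show "\<exists>d. ((\<lambda>t. t powr (real n / 2) * (Q t - y)) has_real_derivative d) (at x) \<and> 0 \<le> d"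
        by (intro exI[of _ "x powr (real n / 2) * (Q x)\<^sup>2"]) simp
    next
      show "continuous_on {0..t} (\<lambda>t. t powr (real n / 2) * (Q t - y))"
        using n by (intro continuous_intros contQ continuous_on_powr') auto
    qed (use t in simp)
    then show ?thesis using t n by (simp add: zero_le_mult_iff)
  qed
  have y: "y > 0" using n by (simp add: y_def)
  \<comment> \<open>Beyond \<open>T\<close> the linear term is at most half of the quadratic one:
    \<open>n / (2 x) \<le> y / 2 \<le> Q x / 2\<close>, hence
    \<open>Q' \<ge> Q^2 / 2\<close>.\<close>
  define T where "T = 2 * (real n)\<^sup>2"
  have T: "T > 0" using n by (simp add: T_def)
  \<comment> \<open>The Riccati inequality for \<open>1 / Q\<close>: it falls at rate at least
    \<open>1 / 2\<close> from a value at most \<open>2 n\<close>, so a further length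
    \<open>4 n\<close> would exhaust it.\<close>
  have dec: "1 / Q (T + 4 * real n) + (T + 4 * real n) / 2 \<le> 1 / Q T + T / 2"
  proof (rule DERIV_nonpos_imp_decreasing_open[of T "T + 4 * real n" "\<lambda>t. 1 / Q t + t / 2"])
    fix x assume "T < x" "x < T + 4 * real n"
    then have x: "x > 0" "T < x" using T by auto
    have Q: "Q x \<ge> y" "Q x > 0" using Qy[OF x(1)] y by auto
    have "real n / (2 * x) \<le> real n / (2 * T)" using x T by (intro divide_left_mono) auto
    also have "\<dots> = y / 2" using n by (simp add: T_def y_def power2_eq_square)
    finally have "real n / (2 * x) \<le> Q x / 2" using Q by simp
    then have "real n / (2 * x) * Q x \<le> Q x / 2 * Q x" using Q by (intro mult_right_mono) auto
    moreover have "0 \<le> 1 / (4 * x)" using x by simp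
    ultimately have Q1: "(Q x)\<^sup>2 / 2 \<le> Q1 x"
      unfolding Q1_def power2_eq_square times_divide_eq_left by linarith
    have "((\<lambda>t. 1 / Q t + t / 2) has_real_derivative - Q1 x / (Q x)\<^sup>2 + 1 / 2) (at x)"
      by (rule DERIV_cong[OF DERIV_add[OF DERIV_divide[OF DERIV_const dQ[OF x(1)]] DERIV_cdivide[OF DERIV_ident]]])
        (use Q in \<open>simp_all add: power2_eq_square\<close>)
    moreover have "- Q1 x / (Q x)\<^sup>2 + 1 / 2 \<le> 0" using Q Q1 by (simp add: divide_simps)
    ultimately show "\<exists>d. ((\<lambda>t. 1 / Q t + t / 2) has_real_derivative d) (at x) \<and> d \<le> 0" by blast
  next
    have "Q x \<noteq> 0" if "x \<in> {T..T + 4 * real n}" for x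
      using Qy[of x] that T y by auto
    then show "continuous_on {T..T + 4 * real n} (\<lambda>t. 1 / Q t + t / 2)"
      using T by (intro continuous_intros contQ) auto
  qed (use n in simp)
  have QT: "1 / Q T \<le> 2 * real n"
  proof -
    have "1 / Q T \<le> 1 / y" using Qy[OF T] y by (intro divide_left_mono mult_pos_pos) auto
    then show ?thesis by (simp add: y_def)
  qed
  have "0 < 1 / Q (T + 4 * real n)"
  proof -
    have "0 < T + 4 * real n" using T n by simp
    from Qy[OF this] y show ?thesis by simp
  qed
  then have "(T + 4 * real n) / 2 < 1 / Q T + T / 2"
    using dec by (rule less_le_trans[OF less_add_same_cancel2[THEN iffD2]])
  also have "\<dots> \<le> 2 * real n + T / 2" using QT by (rule add_right_mono)
  finally show False by (simp add: add_divide_distrib)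
qed

end

text \<open>A positive zero \<open>L\<close> of the series is itself an eigenvalue: scaling the
  radial solution by \<open>sqrt L\<close> places that zero on the unit sphere.\<close>

lemma ex_dirichlet_eigenvalue:
  assumes n: "DIM('a::euclidean_space) \<ge> 7"
  shows "\<exists>\<Lambda>. dirichlet_eigenvalue TYPE('a) \<Lambda>"
proof -
  let ?n = "DIM('a)"
  obtain L where L: "L > 0" "bessel_series ?n L = 0" using bessel_series_zero[OF n] by blast
  define \<phi> :: "'a \<Rightarrow> real" where "\<phi> x = bessel_series ?n (L * (x \<bullet> x))" for x
  have G1: "((\<lambda>t. bessel_series ?n (L * t)) has_real_derivative L * bessel_series1 ?n (L * t)) (at t)" for t
    by (rule DERIV_cong[OF DERIV_chain2[OF DERIV_bessel_series[OF n] DERIV_cmult_Id]]) simp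
  have G2: "((\<lambda>t. L * bessel_series1 ?n (L * t)) has_real_derivative L * (L * bessel_series2 ?n (L * t))) (at t)" for t
    by (rule DERIV_cong[OF DERIV_cmult[OF DERIV_chain2[OF DERIV_bessel_series1[OF n] DERIV_cmult_Id]]]) simp
  have pd2: "pd c (pd b \<phi>) x = 4 * (L * (L * bessel_series2 ?n (L * (x \<bullet> x)))) * (x \<bullet> b) * (x \<bullet> c)
      + 2 * (L * bessel_series1 ?n (L * (x \<bullet> x))) * (b \<bullet> c)" for b c x
    by (rule pd2_radial_sq(2)[OF open_UNIV UNIV_I \<phi>_def G1 G2])
  have "isCont (bessel_series2 ?n) t" for t
    unfolding bessel_series2_def[OF n, abs_def]
    by (rule DERIV_isCont[OF termdiffs_strong_converges_everywhere]) (rule summable_bessel_series2[OF n])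
  then have cb2: "continuous_on UNIV (bessel_series2 ?n)" by (simp add: continuous_at_imp_continuous_on)
  have "continuous_on UNIV (\<lambda>x::'a. bessel_series2 ?n (L * (x \<bullet> x)))"
    by (intro continuous_on_compose2[OF cb2] continuous_intros) auto
  then have "C2_on UNIV \<phi>"
    by (intro C2_on_radial_sq[OF open_UNIV \<phi>_def G1 G2] continuous_intros)
  then have C2: "C2_on (ball 0 1) \<phi>" by (rule C2_on_subset) simp
  have lap: "- laplacian \<phi> x = L * \<phi> x" for x
  proof -
    have "laplacian \<phi> x = (\<Sum>b\<in>Basis. 4 * (L * (L * bessel_series2 ?n (L * (x \<bullet> x)))) * ((x \<bullet> b) * (x \<bullet> b))
      + 2 * (L * bessel_series1 ?n (L * (x \<bullet> x))))"
      unfolding laplacian_def pd2 by (simp add: mult.assoc)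
    also have "\<dots> = 4 * (L * (L * bessel_series2 ?n (L * (x \<bullet> x)))) * (\<Sum>b\<in>Basis. (x \<bullet> b) * (x \<bullet> b))
       + real ?n * (2 * (L * bessel_series1 ?n (L * (x \<bullet> x))))"
      by (simp add: sum.distrib sum_distrib_left)
    also have "(\<Sum>b\<in>Basis. (x \<bullet> b) * (x \<bullet> b)) = x \<bullet> x"
      by (rule euclidean_inner[symmetric])
    also have "4 * (L * (L * bessel_series2 ?n (L * (x \<bullet> x)))) * (x \<bullet> x) + real ?n * (2 * (L * bessel_series1 ?n (L * (x \<bullet> x))))
      = L * (4 * (L * (x \<bullet> x)) * bessel_series2 ?n (L * (x \<bullet> x)) + 2 * real ?n * bessel_series1 ?n (L * (x \<bullet> x)) + bessel_series ?n (L * (x \<bullet> x)))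
        - L * \<phi> x"
      by (simp add: \<phi>_def algebra_simps)
    finally show ?thesis unfolding bessel_series_ode[OF n] by simp
  qed
  have cb: "continuous_on UNIV (bessel_series ?n)"
    by (rule DERIV_continuous_on[OF has_field_derivative_at_within[OF DERIV_bessel_series[OF n]]])
  have "continuous_on (cball 0 1) \<phi>"
    unfolding \<phi>_def[abs_def]
    by (intro continuous_on_compose2[OF cb] continuous_intros) auto
  moreover have "\<phi> 0 \<noteq> 0" by (simp add: \<phi>_def bessel_series_0[OF n])
  moreover have "\<phi> x = 0" if "x \<in> sphere 0 1" for x
    using that L by (simp add: \<phi>_def dot_square_norm)
  ultimately show ?thesis
    unfolding dirichlet_eigenvalue_def using C2 lap
    by (intro exI[of _ L] exI[of _ \<phi>] conjI ballI bexI[of _ 0]) simp_all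
qed

text \<open>Both halves matter: an infimum over the empty set would carry no information, and
  without positivity no parameter near \<open>0\<close> would be covered.\<close>

lemma first_dirichlet_eigenvalue_pos:
  assumes "DIM('a::euclidean_space) \<ge> 7"
  shows "0 < first_dirichlet_eigenvalue TYPE('a)"
proof -
  have "real DIM('a) \<le> first_dirichlet_eigenvalue TYPE('a)"
    unfolding first_dirichlet_eigenvalue_def
  proof (rule cInf_greatest)
    show "{\<Lambda>. dirichlet_eigenvalue TYPE('a) \<Lambda>} \<noteq> {}"
      using ex_dirichlet_eigenvalue[OF assms] by simp
  qed (simp add: dirichlet_eigenvalue_ge_DIM)
  then show ?thesis using assms by linarith
qed

section \<open>Radial sign-changing solutions\<close>

text \<open>The basis vector \<open>e\<close> fixes the ray on which \<open>u\<close> is read as a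
  function of one variable.\<close>

locale radial_nodal_solution =
  fixes u :: "'a::euclidean_space \<Rightarrow> real" and lam :: real and e :: 'a and n :: nat and b :: real
  assumes n_eq_DIM: "n = DIM('a)" and b_eq_beta: "b = beta_exp TYPE('a)" and dim: "n \<ge> 7"
    and sol: "radial_sign_changing_solution lam u"
    and u0: "u 0 > 0" and lam: "lam > 0" and e: "e \<in> Basis"
begin

definition "\<phi> r = u (r *\<^sub>R e)"
definition "\<phi>1 r = pd e u (r *\<^sub>R e)"
definition "\<phi>2 r = pd e (pd e u) (r *\<^sub>R e)"

lemma bn: "BN_solution lam u" and rad: "radial u" and sc: "sign_changing u"
  using sol by (auto simp: radial_sign_changing_solution_def)

lemma C2: "C2_on (ball 0 1) u" and cont_u: "continuous_on (cball 0 1) u"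
  and bd: "\<And>x. x \<in> sphere 0 1 \<Longrightarrow> u x = 0"
  using bn unfolding BN_solution_def by blast+

lemma b_eq: "b = 2 / (real n - 2)" by (simp add: b_eq_beta n_eq_DIM beta_exp_def)

lemma b_gt_0: "b > 0" using dim by (simp add: b_eq)

lemma pde: "x \<in> ball 0 1 \<Longrightarrow> - laplacian u x = lam * u x + \<bar>u x\<bar> powr (2 * b) * u x"
proof -
  have crit: "crit_exp TYPE('a) - 2 = 2 * b"
    using dim by (simp add: crit_exp_def b_eq n_eq_DIM field_simps)
  show "x \<in> ball 0 1 \<Longrightarrow> - laplacian u x = lam * u x + \<bar>u x\<bar> powr (2 * b) * u x"
    using bn unfolding BN_solution_def crit by blast
qed

lemma norm_e: "norm (r *\<^sub>R e) = \<bar>r\<bar>" using e by simp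

lemma u_eq: "norm x \<le> 1 \<Longrightarrow> u x = \<phi> (norm x)"
proof -
  assume "norm x \<le> 1"
  then have "x \<in> cball 0 1" "norm x *\<^sub>R e \<in> cball 0 1" "norm x = norm (norm x *\<^sub>R e)"
    using e by simp_all
  then show ?thesis using rad unfolding radial_def \<phi>_def by blast
qed

lemma DERIV_\<phi>: assumes "\<bar>r\<bar> < 1" shows "(\<phi> has_real_derivative \<phi>1 r) (at r)"
proof -
  have "r *\<^sub>R e \<in> ball 0 1" using assms e by simp
  then have "u differentiable (at (0 + r *\<^sub>R e))" using C2 by (simp add: C2_on_def)
  from DERIV_line[OF this] show ?thesis by (simp add: \<phi>_def[abs_def] \<phi>1_def)
qed

lemma DERIV_\<phi>1: assumes "\<bar>r\<bar> < 1" shows "(\<phi>1 has_real_derivative \<phi>2 r) (at r)"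
proof -
  have "r *\<^sub>R e \<in> ball 0 1" using assms e by simp
  then have "pd e u differentiable (at (0 + r *\<^sub>R e))" using C2 e by (simp add: C2_on_def)
  from DERIV_line[OF this] show ?thesis by (simp add: \<phi>1_def[abs_def] \<phi>2_def)
qed

text \<open>The ray is extended to a line through the origin; radial symmetry makes
  \<open>\<phi>\<close> even there.\<close>

lemma \<phi>1_0: "\<phi>1 0 = 0"
proof -
  have "\<phi> (- r) = \<phi> r" if "r \<in> ball 0 1" for r
    using u_eq[of "(- r) *\<^sub>R e"] u_eq[of "r *\<^sub>R e"] that unfolding norm_e by (simp add: \<phi>_def)
  moreover have "((\<lambda>r. \<phi> (- r)) has_real_derivative - \<phi>1 0) (at 0)"
    using DERIV_\<phi>[of 0] by (simp add: DERIV_mirror[symmetric])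
  ultimately have "(\<phi> has_real_derivative - \<phi>1 0) (at 0)"
    by (elim has_field_derivative_transform_within_open[of _ _ _ "ball 0 1"]) auto
  from DERIV_unique[OF this DERIV_\<phi>[of 0]] show ?thesis by simp
qed

lemma profile_u: "radial_profile (ball 0 1 - {0}) u \<phi> \<phi>1 \<phi>2"
  by unfold_locales (auto simp: u_eq DERIV_\<phi> DERIV_\<phi>1)

sublocale o: radial_ode n b lam 1 \<phi> \<phi>1 \<phi>2
proof
  show "continuous_on {0..1} \<phi>"
    unfolding \<phi>_def[abs_def] using e
    by (intro continuous_on_compose2[OF cont_u] continuous_intros) (auto simp: norm_e)
  show "continuous_on {0..<1} \<phi>1"
    by (intro continuous_at_imp_continuous_on ballI DERIV_isCont[OF DERIV_\<phi>1]) auto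
  fix r :: real assume r: "0 < r" "r < 1"
  then show "(\<phi> has_real_derivative \<phi>1 r) (at r)" "(\<phi>1 has_real_derivative \<phi>2 r) (at r)"
    by (auto intro: DERIV_\<phi> DERIV_\<phi>1)
  have x: "r *\<^sub>R e \<in> ball 0 1 - {0}" "norm (r *\<^sub>R e) = r" using r e by (auto simp: nonzero_Basis)
  from radial_profile.laplacian[OF profile_u x(1)] pde[of "r *\<^sub>R e"] x
  have "\<phi>2 r + (real n - 1) / r * \<phi>1 r = - (lam * \<phi> r + \<bar>\<phi> r\<bar> powr (2 * b) * \<phi> r)"
    by (simp add: \<phi>_def n_eq_DIM)
  then show "\<phi>2 r = - (real n - 1) / r * \<phi>1 r - (lam * \<phi> r + \<bar>\<phi> r\<bar> powr (2 * b) * \<phi> r)"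
    unfolding minus_divide_left[symmetric] mult_minus_left by linarith
next
  show "n \<ge> 7" "b = 2 / (real n - 2)" "0 \<le> lam" "(0::real) < 1" "\<phi>1 0 = 0"
    using dim lam \<phi>1_0 b_eq by simp_all
qed

lemma \<phi>_0: "\<phi> 0 = u 0" "\<phi> 0 > 0" using u0 by (simp_all add: \<phi>_def)

lemma \<phi>_1: "\<phi> 1 = 0" using bd[of e] e by (simp add: \<phi>_def)

text \<open>The zero set beyond \<open>x\<close> is compact and contains \<open>1\<close> by the
  boundary condition, so it has a least element; the intermediate value theorem fixes the sign
  before it.\<close>

lemma first_zero_ex:
  assumes x: "0 \<le> x" "x < 1" "\<phi> x \<noteq> 0"
  shows "\<exists>z>x. z \<le> 1 \<and> \<phi> z = 0 \<and> (\<forall>t. x \<le> t \<longrightarrow> t < z \<longrightarrow> sgn (\<phi> t) = sgn (\<phi> x))"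
proof -
  have cont: "continuous_on {x..y} \<phi>" if "y \<le> 1" for y
    using o.cont_sub[of x y] x that by simp
  define Z where "Z = {t \<in> {x..1}. \<phi> t = 0}"
  have "closed Z"
    unfolding Z_def using continuous_closed_preimage_constant[OF cont, of 1 0] by simp
  then have "compact Z" unfolding Z_def
    by (intro compact_eq_bounded_closed[THEN iffD2] conjI bounded_subset[OF bounded_closed_interval[of x 1]]) auto
  moreover have "1 \<in> Z" using x \<phi>_1 by (simp add: Z_def)
  ultimately obtain z where z: "z \<in> Z" "\<And>t. t \<in> Z \<Longrightarrow> z \<le> t"
    using compact_attains_inf[of Z] by auto
  have nz: "\<phi> t \<noteq> 0" if "x \<le> t" "t < z" for t
    using z(2)[of t] z(1) that by (auto simp: Z_def)
  show ?thesis
  proof (intro exI[of _ z] conjI allI impI)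
    show "x < z" "z \<le> 1" "\<phi> z = 0" using z x by (auto simp: Z_def less_le)
    fix t assume t: "x \<le> t" "t < z"
    then have t1: "t \<le> 1" using z by (simp add: Z_def)
    show "sgn (\<phi> t) = sgn (\<phi> x)"
    proof (rule ccontr)
      assume "sgn (\<phi> t) \<noteq> sgn (\<phi> x)"
      then have "\<phi> x \<le> 0 \<and> 0 \<le> \<phi> t \<or> \<phi> t \<le> 0 \<and> 0 \<le> \<phi> x"
        by (auto simp: sgn_if split: if_splits)
      then have "\<exists>y\<ge>x. y \<le> t \<and> \<phi> y = 0"
        using IVT'[of \<phi> x 0 t] IVT2'[of \<phi> t 0 x] cont[OF t1] t by blast
      then show False using nz t by force
    qed
  qed
qed

text \<open>The minimum \<open>s\<close> is taken over the first interval of negativity only. Since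
  it is a critical point, \<open>abs_le_critical\<close> makes it the minimum over all of
  \<open>{0..1}\<close>, whatever happens after that interval.\<close>

lemma nodal_structure:
  obtains r1 s where "0 < r1" "r1 < s" "s < 1" "\<And>t. 0 \<le> t \<Longrightarrow> t < r1 \<Longrightarrow> 0 < \<phi> t" "\<phi> r1 = 0"
    "\<phi> s < 0" "\<phi>1 s = 0" "\<And>t. r1 \<le> t \<Longrightarrow> t \<le> s \<Longrightarrow> \<bar>\<phi> t\<bar> \<le> \<bar>\<phi> s\<bar>"
    "\<And>t. 0 \<le> t \<Longrightarrow> t \<le> 1 \<Longrightarrow> \<phi> s \<le> \<phi> t"
proof -
  obtain r1 where r1: "0 < r1" "r1 \<le> 1" "\<phi> r1 = 0" and sg: "\<And>t. 0 \<le> t \<Longrightarrow> t < r1 \<Longrightarrow> sgn (\<phi> t) = sgn (\<phi> 0)"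
    using first_zero_ex[of 0] \<phi>_0 by auto
  have pos: "0 < \<phi> t" if "0 \<le> t" "t < r1" for t
    using sg[OF that] \<phi>_0 by (simp add: sgn_if split: if_splits)
  obtain x where x: "x \<in> ball 0 1" "u x < 0" using sc by (auto simp: sign_changing_def)
  have r1_1: "r1 < 1"
  proof (rule ccontr)
    assume "\<not> r1 < 1"
    then have "0 < \<phi> (norm x)" using x by (intro pos) auto
    then show False using x u_eq[of x] by simp
  qed
  \<comment> \<open>Transversality at the node gives negative values immediately to its
    right.\<close>
  have "\<phi>1 r1 < 0" using r1 r1_1 pos by (intro o.v1_neg[of r1 r1]) auto
  then obtain d where d: "d > 0" "\<And>h. 0 < h \<Longrightarrow> h < d \<Longrightarrow> \<phi> (r1 + h) < \<phi> r1"
    using DERIV_neg_dec_right[OF DERIV_\<phi>[of r1]] r1 r1_1 by auto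
  define x1 where "x1 = r1 + min d (1 - r1) / 2"
  have x1: "r1 < x1" "x1 < 1" "x1 < r1 + d" using d r1_1 by (auto simp: x1_def min_def field_simps)
  have neg1: "\<phi> t < 0" if "r1 < t" "t \<le> x1" for t
    using d(2)[of "t - r1"] that x1 r1 by simp
  obtain z where z: "x1 < z" "z \<le> 1" "\<phi> z = 0" "\<And>t. x1 \<le> t \<Longrightarrow> t < z \<Longrightarrow> sgn (\<phi> t) = sgn (\<phi> x1)"
    using first_zero_ex[of x1] x1 r1 neg1[of x1] by auto
  have neg: "\<phi> t < 0" if "r1 < t" "t < z" for t
  proof (cases "t \<le> x1")
    case False
    then have "sgn (\<phi> t) = sgn (\<phi> x1)" using z(4)[of t] that by simp
    then show ?thesis using neg1[of x1] x1 by (simp add: sgn_if split: if_splits)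
  qed (use neg1 that in simp)
  have "continuous_on {r1..z} \<phi>" using o.cont_sub[of r1 z] r1 z(2) by simp
  then obtain s where s: "s \<in> {r1..z}" "\<And>t. t \<in> {r1..z} \<Longrightarrow> \<phi> s \<le> \<phi> t"
    using continuous_attains_inf[of "{r1..z}" \<phi>] x1 z(1) by auto
  have sneg: "\<phi> s < 0" using s(2)[of x1] neg1[of x1] x1 z(1) by simp
  have s1: "r1 < s" "s < z" using s(1) sneg r1(3) z(3) by (auto simp: less_le)
  have crit: "\<phi>1 s = 0"
  proof (rule DERIV_local_min[OF DERIV_\<phi>[of s]])
    show "0 < min (s - r1) (z - s)" using s1 by simp
    show "\<forall>y. \<bar>s - y\<bar> < min (s - r1) (z - s) \<longrightarrow> \<phi> s \<le> \<phi> y"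
      by (intro allI impI s(2)) (auto simp: abs_less_iff)
  qed (use s1 r1(1) z(2) in simp)
  have bump: "\<bar>\<phi> t\<bar> \<le> \<bar>\<phi> s\<bar>" if "r1 \<le> t" "t \<le> s" for t
    using s(2)[of t] neg[of t] r1(3) that s1 sneg by (cases "t = r1") auto
  show thesis
  proof (rule that[of r1 s])
    show "s < 1" using s1 z(2) by simp
    show "0 < r1" "r1 < s" "\<phi> r1 = 0" "\<phi> s < 0" "\<phi>1 s = 0" by fact+
    show "\<And>t. 0 \<le> t \<Longrightarrow> t < r1 \<Longrightarrow> 0 < \<phi> t" by (rule pos)
    show "\<And>t. r1 \<le> t \<Longrightarrow> t \<le> s \<Longrightarrow> \<bar>\<phi> t\<bar> \<le> \<bar>\<phi> s\<bar>" by (rule bump)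
    fix t :: real assume t: "0 \<le> t" "t \<le> 1"
    consider "t < r1" | "r1 \<le> t" "t \<le> s" | "s \<le> t" "t < 1" | "t = 1" using t by linarith
    then show "\<phi> s \<le> \<phi> t"
    proof cases
      case 1 then show ?thesis using pos[of t] t sneg by simp
    next
      case 2 then show ?thesis using bump[of t] sneg by linarith
    next
      case 3
      then have "\<bar>\<phi> t\<bar> \<le> \<bar>\<phi> s\<bar>" using o.abs_le_critical[of s t] crit r1 s1 by auto
      then show ?thesis using sneg by linarith
    next
      case 4 then show ?thesis using \<phi>_1 sneg by simp
    qed
  qed
qed

lemma abs_le_center: "0 \<le> t \<Longrightarrow> t \<le> 1 \<Longrightarrow> \<bar>\<phi> t\<bar> \<le> \<phi> 0"
proof (cases "t = 1")
  case True
  then show ?thesis using \<phi>_1 \<phi>_0(2) by simp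
next
  case False
  assume "0 \<le> t" "t \<le> 1"
  with False have "\<bar>\<phi> t\<bar> \<le> \<bar>\<phi> 0\<bar>" by (intro o.abs_le_critical \<phi>1_0) simp_all
  then show ?thesis using \<phi>_0(2) by simp
qed

lemma sup_norm_pos_fun: "sup_norm (pos_fun u) = \<phi> 0"
  unfolding sup_norm_def
proof (rule cSup_eq_maximum)
  show "\<phi> 0 \<in> (\<lambda>x. \<bar>pos_fun u x\<bar>) ` ball 0 1"
    using \<phi>_0 by (intro image_eqI[of _ _ 0]) (auto simp: pos_fun_def)
  fix y assume "y \<in> (\<lambda>x. \<bar>pos_fun u x\<bar>) ` ball 0 1"
  then obtain x where "norm x < 1" "y = \<bar>pos_fun u x\<bar>" by auto
  then show "y \<le> \<phi> 0"
    using abs_le_center[of "norm x"] u_eq[of x] \<phi>_0 by (auto simp: pos_fun_def)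
qed

lemma sup_norm_neg_fun:
  assumes s: "0 \<le> s" "s < 1" "\<phi> s < 0" and le: "\<And>t. 0 \<le> t \<Longrightarrow> t \<le> 1 \<Longrightarrow> \<phi> s \<le> \<phi> t"
  shows "sup_norm (neg_fun u) = - \<phi> s"
  unfolding sup_norm_def
proof (rule cSup_eq_maximum)
  show "- \<phi> s \<in> (\<lambda>x. \<bar>neg_fun u x\<bar>) ` ball 0 1"
  proof (rule image_eqI[of _ _ "s *\<^sub>R e"])
    show "- \<phi> s = \<bar>neg_fun u (s *\<^sub>R e)\<bar>" using s(3) by (simp add: neg_fun_def \<phi>_def)
    show "s *\<^sub>R e \<in> ball 0 1" using s(1,2) e by simp
  qed
  fix y assume "y \<in> (\<lambda>x. \<bar>neg_fun u x\<bar>) ` ball 0 1"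
  then obtain x where "norm x < 1" "y = \<bar>neg_fun u x\<bar>" by auto
  then show "y \<le> - \<phi> s"
    using le[of "norm x"] u_eq[of x] s(3) by (simp add: neg_fun_def)
qed

lemma node_eq:
  assumes r1: "0 < r1" "r1 < 1" "\<phi> r1 = 0" and pos: "\<And>t. 0 \<le> t \<Longrightarrow> t < r1 \<Longrightarrow> 0 < \<phi> t"
  shows "node u = r1"
  unfolding node_def
proof (rule cInf_eq_minimum)
  show "r1 \<in> {r. 0 < r \<and> r \<le> 1 \<and> (\<exists>x. norm x = r \<and> u x = 0)}"
  proof -
    have "norm (r1 *\<^sub>R e) = r1" "u (r1 *\<^sub>R e) = 0" using r1 norm_e[of r1] by (auto simp: \<phi>_def)
    then show ?thesis
      unfolding mem_Collect_eq using r1(1) less_imp_le[OF r1(2)] by blast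
  qed
  fix r assume "r \<in> {r. 0 < r \<and> r \<le> 1 \<and> (\<exists>x. norm x = r \<and> u x = 0)}"
  then have r: "0 < r" "\<phi> r = 0" using u_eq by auto
  then show "r1 \<le> r" using pos[of r] by force
qed

text \<open>On the set where \<open>- u\<close> is positive it is a subsolution with potential
  \<open>lam + M^(2 b)\<close>, where \<open>M = - \<phi> s\<close>. The maximum principle makes
  this at least \<open>n\<close>, and \<open>lam \<le> 1\<close> leaves ample room for the bound
  \<open>1\<close>.\<close>

lemma min_powr_ge_1:
  assumes lam1: "lam \<le> 1" and s: "0 \<le> s" "s < 1" "\<phi> s < 0" and le: "\<And>t. 0 \<le> t \<Longrightarrow> t \<le> 1 \<Longrightarrow> \<phi> s \<le> \<phi> t"
  shows "1 \<le> (- \<phi> s) powr (2 * b)"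
proof -
  have lap: "laplacian (\<lambda>y. - u y) y = - laplacian u y" if "y \<in> ball 0 1" for y
    using C2_on_scale(2)[OF C2, of 1 y _ _ "-1"] that by (simp add: laplacian_def sum_negf)
  have "real n \<le> lam + (- \<phi> s) powr (2 * b)"
    unfolding n_eq_DIM
  proof (rule DIM_le_potential[of "\<lambda>y. - u y" "s *\<^sub>R e"])
    show "C2_on (ball 0 1) (\<lambda>y. - u y)" using C2_on_scale(1)[OF C2, of 1 "-1"] by simp
    show "continuous_on (cball 0 1) (\<lambda>y. - u y)" by (intro continuous_intros cont_u)
    show "- u x = 0" if "x \<in> sphere 0 1" for x using bd[OF that] by simp
    show "s *\<^sub>R e \<in> ball 0 1" "- u (s *\<^sub>R e) > 0" using s norm_e[of s] by (auto simp: \<phi>_def)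
    fix x :: 'a assume x: "x \<in> ball 0 1" "- u x > 0"
    have "\<bar>u x\<bar> powr (2 * b) \<le> (- \<phi> s) powr (2 * b)"
      using x le[of "norm x"] u_eq[of x] b_gt_0 by (intro powr_mono2) auto
    then have "(lam + \<bar>u x\<bar> powr (2 * b)) * - u x \<le> (lam + (- \<phi> s) powr (2 * b)) * - u x"
      using x by (intro mult_right_mono) auto
    then show "- laplacian (\<lambda>y. - u y) x \<le> (lam + (- \<phi> s) powr (2 * b)) * - u x"
      unfolding lap[OF x(1)] using pde[OF x(1)] by (simp add: algebra_simps)
  qed
  then show ?thesis using lam1 dim by linarith
qed

text \<open>\<open>c\<close> is a signed amplitude: \<open>\<phi> 0\<close> for the positive part,
  the minimum value for the negative part. Both profiles thus have height \<open>1\<close>.\<close>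

definition "W1 c r = \<phi>1 (r / \<bar>c\<bar> powr b) / (\<bar>c\<bar> powr b * c)"
definition "W2 c r = \<phi>2 (r / \<bar>c\<bar> powr b) / ((\<bar>c\<bar> powr b)\<^sup>2 * c)"
definition "W c r = \<phi> (r / \<bar>c\<bar> powr b) / c"

lemma W_ode: "c \<noteq> 0 \<Longrightarrow>
    radial_ode n b (lam * \<bar>c\<bar> powr (- 2 * b)) (\<bar>c\<bar> powr b) (W c) (W1 c) (W2 c)"
  using radial_ode_scale[OF o.radial_ode_axioms _ refl, of c]
  unfolding W_def[abs_def] W1_def[abs_def] W2_def[abs_def] by simp

lemma W_profile:
  assumes c: "c \<noteq> 0" and S: "open S" "0 \<notin> S" "S \<subseteq> ball 0 (\<bar>c\<bar> powr b)"
    and f: "\<And>y. y \<in> S \<Longrightarrow> f y = 1 / c * u (y /\<^sub>R (\<bar>c\<bar> powr b))"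
  shows "radial_profile S f (W c) (W1 c) (W2 c)"
proof -
  interpret w: radial_ode n b "lam * \<bar>c\<bar> powr (- 2 * b)" "\<bar>c\<bar> powr b" "W c" "W1 c" "W2 c"
    by (rule W_ode[OF c])
  show ?thesis
  proof
    fix y assume y: "y \<in> S"
    then have y1: "0 < norm y" "norm y < \<bar>c\<bar> powr b" using S by (auto simp: subset_iff)
    then show "(W c has_real_derivative W1 c (norm y)) (at (norm y))"
      "(W1 c has_real_derivative W2 c (norm y)) (at (norm y))" by (auto intro: w.der w.der1)
    have "norm (y /\<^sub>R (\<bar>c\<bar> powr b)) = norm y / \<bar>c\<bar> powr b" by (simp add: divide_inverse mult.commute)
    then show "f y = W c (norm y)"
      using f[OF y] u_eq[of "y /\<^sub>R (\<bar>c\<bar> powr b)"] y1 by (simp add: W_def divide_le_eq)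
  qed (use S in auto)
qed

end

section \<open>Convergence to the bubble\<close>

text \<open>Kept pointwise so that an estimate on a punctured neighbourhood can be extended to the
  missing point.\<close>

definition C2_close_at :: "('a::euclidean_space \<Rightarrow> real) \<Rightarrow> ('a \<Rightarrow> real) \<Rightarrow> real \<Rightarrow> 'a \<Rightarrow> bool" where
  "C2_close_at f g \<epsilon> x \<longleftrightarrow> \<bar>f x - g x\<bar> \<le> \<epsilon> \<and> (\<forall>b\<in>Basis. \<bar>pd b f x - pd b g x\<bar> \<le> \<epsilon>) \<and>
     (\<forall>b\<in>Basis. \<forall>c\<in>Basis. \<bar>pd c (pd b f) x - pd c (pd b g) x\<bar> \<le> \<epsilon>)"

lemma C2_loc_tendstoI:
  fixes f :: "'l \<Rightarrow> 'a::euclidean_space \<Rightarrow> real"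
  assumes g: "C2_on S g"
    and ev: "\<And>K \<epsilon>. compact K \<Longrightarrow> K \<subseteq> S \<Longrightarrow> \<epsilon> > 0 \<Longrightarrow>
      \<forall>\<^sub>F l in F. (\<exists>U. open U \<and> K \<subseteq> U \<and> U \<subseteq> D l \<and> C2_on U (f l)) \<and> (\<forall>x\<in>K. C2_close_at (f l) g \<epsilon> x)"
  shows "C2_loc_tendsto D f g S F"
  unfolding C2_loc_tendsto_def
proof (intro conjI allI impI g ballI)
  fix K assume "compact K \<and> K \<subseteq> S"
  then have K: "compact K" "K \<subseteq> S" by auto
  show "\<forall>\<^sub>F l in F. \<exists>U. open U \<and> K \<subseteq> U \<and> U \<subseteq> D l \<and> C2_on U (f l)"
    using ev[OF K zero_less_one] by (rule eventually_mono) blast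
  have cl: "\<forall>\<^sub>F l in F. \<forall>x\<in>K. C2_close_at (f l) g (\<epsilon> / 2) x" if "\<epsilon> > 0" for \<epsilon>
    using ev[OF K, of "\<epsilon> / 2"] that by (auto elim: eventually_mono)
  show "uniform_limit K f g F"
  proof (rule uniform_limitI)
    fix \<epsilon> :: real assume "\<epsilon> > 0"
    show "\<forall>\<^sub>F l in F. \<forall>x\<in>K. dist (f l x) (g x) < \<epsilon>"
    proof (rule eventually_mono[OF cl[OF \<open>\<epsilon> > 0\<close>]], intro ballI)
      fix l x assume "\<forall>x\<in>K. C2_close_at (f l) g (\<epsilon> / 2) x" "x \<in> K"
      then have "\<bar>f l x - g x\<bar> \<le> \<epsilon> / 2" by (simp add: C2_close_at_def)
      then show "dist (f l x) (g x) < \<epsilon>" using \<open>\<epsilon> > 0\<close> by (simp add: dist_real_def)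
    qed
  qed
  fix b :: 'a assume b: "b \<in> Basis"
  show "uniform_limit K (\<lambda>l. pd b (f l)) (pd b g) F"
  proof (rule uniform_limitI)
    fix \<epsilon> :: real assume "\<epsilon> > 0"
    show "\<forall>\<^sub>F l in F. \<forall>x\<in>K. dist (pd b (f l) x) (pd b g x) < \<epsilon>"
    proof (rule eventually_mono[OF cl[OF \<open>\<epsilon> > 0\<close>]], intro ballI)
      fix l x assume "\<forall>x\<in>K. C2_close_at (f l) g (\<epsilon> / 2) x" "x \<in> K"
      then have "\<bar>pd b (f l) x - pd b g x\<bar> \<le> \<epsilon> / 2" using b by (simp add: C2_close_at_def)
      then show "dist (pd b (f l) x) (pd b g x) < \<epsilon>" using \<open>\<epsilon> > 0\<close> by (simp add: dist_real_def)
    qed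
  qed
  fix c :: 'a assume c: "c \<in> Basis"
  show "uniform_limit K (\<lambda>l. pd c (pd b (f l))) (pd c (pd b g)) F"
  proof (rule uniform_limitI)
    fix \<epsilon> :: real assume "\<epsilon> > 0"
    show "\<forall>\<^sub>F l in F. \<forall>x\<in>K. dist (pd c (pd b (f l)) x) (pd c (pd b g) x) < \<epsilon>"
    proof (rule eventually_mono[OF cl[OF \<open>\<epsilon> > 0\<close>]], intro ballI)
      fix l x assume "\<forall>x\<in>K. C2_close_at (f l) g (\<epsilon> / 2) x" "x \<in> K"
      then have "\<bar>pd c (pd b (f l)) x - pd c (pd b g) x\<bar> \<le> \<epsilon> / 2" using b c by (simp add: C2_close_at_def)
      then show "dist (pd c (pd b (f l)) x) (pd c (pd b g) x) < \<epsilon>" using \<open>\<epsilon> > 0\<close> by (simp add: dist_real_def)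
    qed
  qed
qed

lemma abs_diff_le_extend:
  fixes p q :: "'a::euclidean_space \<Rightarrow> real"
  assumes "open S" "x \<in> S" "continuous_on S p" "continuous_on S q"
    and le: "\<And>y. y \<in> S - {x} \<Longrightarrow> \<bar>p y - q y\<bar> \<le> \<epsilon>"
  shows "\<bar>p x - q x\<bar> \<le> \<epsilon>"
proof -
  have "((\<lambda>y. \<bar>p y - q y\<bar>) \<longlongrightarrow> \<bar>p x - q x\<bar>) (at x)"
    using assms(1-4) by (intro tendsto_intros) (auto simp: continuous_on_eq_continuous_at isCont_def)
  moreover have "\<forall>\<^sub>F y in at x. \<bar>p y - q y\<bar> \<le> \<epsilon>"
    using eventually_at_in_open[OF assms(1,2)] by eventually_elim (rule le)
  ultimately show ?thesis by (intro tendsto_upperbound) auto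
qed

text \<open>Fills in the origin, which \<open>radial_profile\<close> has to exclude: all derivatives
  up to order two are continuous and the bound is not strict.\<close>

lemma C2_close_at_extend:
  fixes f g :: "'a::euclidean_space \<Rightarrow> real"
  assumes "open S" "x \<in> S" "C2_on S f" "C2_on S g" "\<And>y. y \<in> S - {x} \<Longrightarrow> C2_close_at f g \<epsilon> y"
  shows "C2_close_at f g \<epsilon> x"
proof -
  have cont: "continuous_on S h" if "C2_on S h" for h
    using that unfolding C2_on_def
    by (auto intro!: continuous_at_imp_continuous_on differentiable_imp_continuous_within)
  have cont1: "continuous_on S (pd b h)" if "C2_on S h" "b \<in> Basis" for b h
    using that unfolding C2_on_def
    by (auto intro!: continuous_at_imp_continuous_on differentiable_imp_continuous_within)
  have cont2: "continuous_on S (pd c (pd b h))" if "C2_on S h" "b \<in> Basis" "c \<in> Basis" for b c h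
    using that unfolding C2_on_def by auto
  note fg = assms(3,4) and ext = abs_diff_le_extend[OF assms(1,2)]
  show ?thesis
    unfolding C2_close_at_def
  proof (intro conjI ballI)
    show "\<bar>f x - g x\<bar> \<le> \<epsilon>"
      by (rule ext[OF cont[OF fg(1)] cont[OF fg(2)]]) (use assms(5) in \<open>simp add: C2_close_at_def\<close>)
    fix b :: 'a assume b: "b \<in> Basis"
    show "\<bar>pd b f x - pd b g x\<bar> \<le> \<epsilon>"
      by (rule ext[OF cont1[OF fg(1) b] cont1[OF fg(2) b]]) (use assms(5) b in \<open>simp add: C2_close_at_def\<close>)
    fix c :: 'a assume c: "c \<in> Basis"
    show "\<bar>pd c (pd b f) x - pd c (pd b g) x\<bar> \<le> \<epsilon>"
      by (rule ext[OF cont2[OF fg(1) b c] cont2[OF fg(2) b c]]) (use assms(5) b c in \<open>simp add: C2_close_at_def\<close>)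
  qed
qed

text \<open>In \<open>3 + R\<close> the \<open>3\<close> pays for the Hessian and the
  \<open>R\<close> for the factor \<open>norm x\<close> in the gradient bound.\<close>

lemma radial_profile_C2_close_at:
  fixes f g :: "'a::euclidean_space \<Rightarrow> real"
  assumes fg: "radial_profile S f w w1 w2" "radial_profile S g v v1 v2" and x: "x \<in> S"
    and R: "norm x \<le> R" and \<epsilon>: "\<epsilon> > 0"
    and d: "\<bar>w (norm x) - v (norm x)\<bar> \<le> \<epsilon> / (3 + R)" "\<bar>w1 (norm x) - v1 (norm x)\<bar> \<le> \<epsilon> / (3 + R) * norm x"
      "\<bar>w2 (norm x) - v2 (norm x)\<bar> \<le> \<epsilon> / (3 + R)"
  shows "C2_close_at f g \<epsilon> x"
proof -
  have R0: "0 \<le> R" using R norm_ge_zero order_trans by blast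
  have 1: "\<epsilon> / (3 + R) \<le> \<epsilon>" "3 * (\<epsilon> / (3 + R)) \<le> \<epsilon>" using R0 \<epsilon> by (auto simp: field_simps)
  have "\<epsilon> / (3 + R) * norm x \<le> \<epsilon> / (3 + R) * R" using R R0 \<epsilon> by (intro mult_left_mono) auto
  also have "\<dots> \<le> \<epsilon>" using R0 \<epsilon> by (simp add: field_simps)
  finally have 2: "\<epsilon> / (3 + R) * norm x \<le> \<epsilon>" .
  obtain b0 :: 'a where "b0 \<in> Basis" using nonempty_Basis by blast
  note close = radial_profile_close[OF fg x d]
  show ?thesis
    unfolding C2_close_at_def
    using close(1)[OF \<open>b0 \<in> Basis\<close> \<open>b0 \<in> Basis\<close>] close(2) close(3) 1 2 by (meson order_trans)
qed

text \<open>This \<open>\<mu>\<close> normalises the height to \<open>1\<close>: with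
  \<open>q = \<mu>^2 = n (n - 2)\<close>, numerator and denominator share the factor
  \<open>q powr p\<close>. The first form is smooth at the origin, the second is the radial
  profile.\<close>

lemma bubble_eq_profile:
  fixes x :: "'a::euclidean_space"
  assumes n: "DIM('a) \<ge> 7" and \<mu>: "\<mu> = sqrt (real DIM('a) * (real DIM('a) - 2))"
  shows "bubble 0 \<mu> x = (1 + x \<bullet> x / (real DIM('a) * (real DIM('a) - 2))) powr (- (real DIM('a) - 2) / 2)"
    and "bubble 0 \<mu> x = bubble_profile DIM('a) (norm x)"
proof -
  define q p where "q = real DIM('a) * (real DIM('a) - 2)" and "p = (real DIM('a) - 2) / 2"
  have q: "q > 0" using n by (simp add: q_def)
  have m: "\<mu>\<^sup>2 = q" using q by (simp add: \<mu> q_def[symmetric])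
  have "(q * q) powr ((real DIM('a) - 2) / 4) = q powr p"
    using q by (simp add: powr_mult p_def powr_add[symmetric])
  moreover have "q + (norm x)\<^sup>2 = q * (1 + x \<bullet> x / q)"
    using q by (simp add: field_simps power2_norm_eq_inner)
  moreover have "(q * (1 + x \<bullet> x / q)) powr p = q powr p * (1 + x \<bullet> x / q) powr p"
    by (rule powr_mult)
  ultimately have "bubble 0 \<mu> x = q powr p / (q powr p * (1 + x \<bullet> x / q) powr p)"
    unfolding bubble_def m by (simp add: q_def[symmetric] p_def[symmetric])
  also have "\<dots> = (1 + x \<bullet> x / q) powr (- p)"
    using q by (simp add: powr_minus_divide)
  also have "- p = - (real DIM('a) - 2) / 2" by (simp only: p_def minus_divide_left)
  finally show 1: "bubble 0 \<mu> x = (1 + x \<bullet> x / (real DIM('a) * (real DIM('a) - 2))) powr (- (real DIM('a) - 2) / 2)"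
    by (simp only: q_def)
  show "bubble 0 \<mu> x = bubble_profile DIM('a) (norm x)"
    unfolding 1 by (simp add: bubble_profile_def bubble_base_def power2_norm_eq_inner)
qed

lemma C2_on_bubble:
  assumes n: "DIM('a::euclidean_space) \<ge> 7" and \<mu>: "\<mu> = sqrt (real DIM('a) * (real DIM('a) - 2))"
  shows "C2_on S (bubble (0::'a) \<mu>)"
proof -
  define q p where "q = real DIM('a) * (real DIM('a) - 2)" and "p = - (real DIM('a) - 2) / 2"
  have q: "q > 0" using n by (simp add: q_def)
  \<comment> \<open>Stated for arbitrary \<open>c\<close> and \<open>a\<close> because the
    derivative has the same shape; it is applied twice.\<close>
  have D: "((\<lambda>t. c * (1 + t / q) powr a) has_real_derivative c * a / q * (1 + (y \<bullet> y) / q) powr (a - 1)) (at (y \<bullet> y))"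
    for a c and y :: 'a
  proof -
    have "0 < 1 + (y \<bullet> y) / q" using q by (simp add: add_pos_nonneg)
    moreover have "((\<lambda>t. 1 + t / q) has_real_derivative 1 / q) (at (y \<bullet> y))"
      using q by (auto intro!: derivative_eq_intros)
    ultimately show ?thesis
      using DERIV_cmult[OF DERIV_fun_powr[of "\<lambda>t. 1 + t / q" "1 / q" "y \<bullet> y" a], of c] by (simp add: mult_ac)
  qed
  have "C2_on UNIV (bubble (0::'a) \<mu>)"
  proof (rule C2_on_radial_sq[OF open_UNIV _ D D])
    show "bubble 0 \<mu> y = 1 * (1 + (y \<bullet> y) / q) powr p" for y :: 'a
      unfolding q_def p_def using bubble_eq_profile(1)[OF n \<mu>, of y] by simp
    show "continuous_on UNIV (\<lambda>y::'a. 1 * p / q * (p - 1) / q * (1 + (y \<bullet> y) / q) powr (p - 1 - 1))"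
      using q by (intro continuous_intros continuous_on_powr) (auto simp: add_nonneg_eq_0_iff)
  qed
  then show ?thesis by (rule C2_on_subset) simp
qed

lemma radial_profile_bubble:
  assumes n: "DIM('a::euclidean_space) \<ge> 7" and \<mu>: "\<mu> = sqrt (real DIM('a) * (real DIM('a) - 2))"
    and S: "open S" "0 \<notin> S"
  shows "radial_profile S (bubble (0::'a) \<mu>) (bubble_profile DIM('a)) (bubble_profile1 DIM('a)) (bubble_profile2 DIM('a))"
  using S by unfold_locales (auto simp: bubble_eq_profile(2)[OF n \<mu>] DERIV_bubble_profile[OF n] DERIV_bubble_profile1[OF n])

text \<open>The threshold depends on \<open>R\<close> and \<open>\<epsilon>\<close> but not on the
  solution, so the family enters only when the limit is taken.\<close>

lemma positive_part_close:
  fixes R \<epsilon> \<mu> :: real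
  assumes n: "DIM('a::euclidean_space) \<ge> 7" and \<mu>: "\<mu> = sqrt (real DIM('a) * (real DIM('a) - 2))"
    and R: "R > 0" and \<epsilon>: "\<epsilon> > 0"
  obtains t where "t > 0" "\<And>lam u. 0 < lam \<Longrightarrow> lam \<le> t \<Longrightarrow>
    radial_sign_changing_solution lam (u :: 'a \<Rightarrow> real) \<Longrightarrow> u 0 > 0 \<Longrightarrow>
    ball 0 R \<subseteq> ball_rescaled u \<and> C2_on (ball 0 R) (rescale (pos_fun u)) \<and>
    (\<forall>x\<in>ball 0 R. C2_close_at (rescale (pos_fun u)) (bubble 0 \<mu>) \<epsilon> x)"
proof -
  obtain e :: 'a where e: "e \<in> Basis" using nonempty_Basis by blast
  have \<epsilon>': "\<epsilon> / (3 + R) > 0" using \<epsilon> R by simp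
  obtain \<theta> where th: "\<theta> > 0" "\<And>b eps L v v1 v2 s. radial_ode DIM('a) b eps L v v1 v2 \<Longrightarrow> eps \<le> \<theta> \<Longrightarrow>
    0 \<le> s \<Longrightarrow> s \<le> \<theta> \<Longrightarrow> s = 0 \<or> 0 < (0::real) \<Longrightarrow> s < L \<Longrightarrow> v s = 1 \<Longrightarrow> v1 s = 0 \<Longrightarrow> v L = 0 \<Longrightarrow>
    R < L \<and> (\<forall>r. s \<le> r \<and> r \<le> R \<longrightarrow> 0 < v r) \<and> (\<forall>r. 0 < r \<and> 0 \<le> r \<and> r \<le> R \<longrightarrow> s \<le> r \<and>
      \<bar>v r - bubble_profile DIM('a) r\<bar> \<le> \<epsilon> / (3 + R) \<and> \<bar>v1 r - bubble_profile1 DIM('a) r\<bar> \<le> \<epsilon> / (3 + R) * r \<and>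
      \<bar>v2 r - bubble_profile2 DIM('a) r\<bar> \<le> \<epsilon> / (3 + R))"
    using bubble_close_C2[OF n R \<epsilon>' order_refl] by blast
  show thesis
  proof (rule that[of "min \<theta> 1"])
    show "min \<theta> 1 > 0" using th(1) by simp
    fix lam :: real and u :: "'a \<Rightarrow> real"
    assume lam_pos: "0 < lam" and lam_le: "lam \<le> min \<theta> 1" and sol: "radial_sign_changing_solution lam u" and u0: "u 0 > 0"
    define b where "b = beta_exp TYPE('a)"
    interpret radial_nodal_solution u lam e "DIM('a)" b by unfold_locales (use n sol u0 lam_pos lam_le e in \<open>auto simp: b_def\<close>)
    obtain r1 s where rs: "0 < r1" "r1 < s" "s < 1" "\<And>t. 0 \<le> t \<Longrightarrow> t < r1 \<Longrightarrow> 0 < \<phi> t" "\<phi> r1 = 0"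
      "\<phi> s < 0" "\<phi>1 s = 0" "\<And>t. r1 \<le> t \<Longrightarrow> t \<le> s \<Longrightarrow> \<bar>\<phi> t\<bar> \<le> \<bar>\<phi> s\<bar>"
      "\<And>t. 0 \<le> t \<Longrightarrow> t \<le> 1 \<Longrightarrow> \<phi> s \<le> \<phi> t"
      using nodal_structure by blast
    define a where "a = \<phi> 0"
    have a: "a > 0" using \<phi>_0 by (simp add: a_def)
    define k where "k = \<bar>a\<bar> powr b"
    have k: "k > 0" using a by (simp add: k_def)
    \<comment> \<open>The lower bound for the amplitude is known for the minimum; it passes to the
      centre because \<open>\<phi> 0\<close> dominates all values.\<close>
    have "(- \<phi> s) powr (2 * b) \<le> a powr (2 * b)"
      using abs_le_center[of s] rs b_gt_0 by (intro powr_mono2) (auto simp: a_def)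
    moreover have "1 \<le> (- \<phi> s) powr (2 * b)"
      using rs lam_pos lam_le by (intro min_powr_ge_1) auto
    ultimately have a1: "1 \<le> a powr (2 * b)" by linarith
    have "lam * \<bar>a\<bar> powr (- 2 * b) \<le> lam * 1"
      using a1 a lam_pos lam_le powr_minus_divide[of a "2 * b"] by (intro mult_left_mono) (auto simp: divide_le_eq)
    then have eps: "lam * \<bar>a\<bar> powr (- 2 * b) \<le> \<theta>" using lam_le by linarith
    have "W a k = 0" using k \<phi>_1 by (simp add: W_def k_def)
    moreover have "W a 0 = 1" "W1 a 0 = 0" using a \<phi>1_0 by (auto simp: W_def W1_def a_def)
    ultimately have cl: "R < k" "\<And>r. 0 \<le> r \<Longrightarrow> r \<le> R \<Longrightarrow> 0 < W a r"
      "\<And>r. 0 < r \<Longrightarrow> r \<le> R \<Longrightarrow> \<bar>W a r - bubble_profile DIM('a) r\<bar> \<le> \<epsilon> / (3 + R) \<and>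
        \<bar>W1 a r - bubble_profile1 DIM('a) r\<bar> \<le> \<epsilon> / (3 + R) * r \<and> \<bar>W2 a r - bubble_profile2 DIM('a) r\<bar> \<le> \<epsilon> / (3 + R)"
      using th(2)[OF W_ode eps order_refl, of] a th(1) k unfolding k_def by auto
    \<comment> \<open>Positivity of the profile up to \<open>R\<close> pushes the rescaled node
      beyond \<open>R\<close>, so the ball lies in the rescaled domain.\<close>
    have "W a (k * r1) = 0" using rs k by (simp add: W_def k_def)
    then have Rr: "R < k * r1" using cl(2)[of "k * r1"] rs k by force
    have node: "node u = r1" using rs(2,3) by (intro node_eq[OF rs(1) _ rs(5,4)]) auto
    have sub: "ball 0 R \<subseteq> ball_rescaled u"
      using Rr a unfolding ball_rescaled_def sup_norm_pos_fun node
      by (auto simp: k_def a_def b_def)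
    have f_eq: "rescale (pos_fun u) y = 1 / a * u (y /\<^sub>R k)" if y: "y \<in> ball 0 R" for y
    proof -
      have nk: "norm (y /\<^sub>R k) = norm y / k" using k by (simp add: divide_inverse mult.commute)
      have "u (y /\<^sub>R k) = \<phi> (norm y / k)"
        using u_eq[of "y /\<^sub>R k"] y cl(1) k unfolding nk by (simp add: divide_le_eq)
      moreover have "0 < \<phi> (norm y / k)"
        using cl(2)[of "norm y"] y a by (simp add: W_def k_def zero_less_divide_iff)
      ultimately show ?thesis
        using a unfolding rescale_def sup_norm_pos_fun by (simp add: pos_fun_def a_def k_def b_def)
    qed
    have "ball 0 R \<subseteq> ball (0::'a) k" using cl(1) by (intro subset_ball) simp
    from C2_on_subset[OF C2_on_scale(1)[OF C2 k, of "1 / a"] this]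
    have C2f: "C2_on (ball 0 R) (rescale (pos_fun u))"
      by (subst C2_on_cong[OF open_ball, of 0 R "rescale (pos_fun u)" "\<lambda>y. 1 / a * u (y /\<^sub>R k)"])
        (use f_eq in auto)
    have close: "C2_close_at (rescale (pos_fun u)) (bubble 0 \<mu>) \<epsilon> x" if x: "x \<in> ball 0 R - {0}" for x
    proof (rule radial_profile_C2_close_at[where R = R])
      show "radial_profile (ball 0 R - {0}) (rescale (pos_fun u)) (W a) (W1 a) (W2 a)"
        using a cl(1) f_eq by (intro W_profile) (auto simp: k_def)
      show "radial_profile (ball (0::'a) R - {0}) (bubble 0 \<mu>) (bubble_profile DIM('a)) (bubble_profile1 DIM('a)) (bubble_profile2 DIM('a))"
        by (rule radial_profile_bubble[OF n \<mu>]) auto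
    qed (use x cl(3)[of "norm x"] \<epsilon> in auto)
    have "C2_close_at (rescale (pos_fun u)) (bubble 0 \<mu>) \<epsilon> x" if x: "x \<in> ball 0 R" for x
    proof (cases "x = 0")
      case True
      show ?thesis
        unfolding True
        by (rule C2_close_at_extend[OF open_ball _ C2f C2_on_bubble[OF n \<mu>] close]) (use R in simp_all)
    qed (use close x in simp)
    with sub C2f show "ball 0 R \<subseteq> ball_rescaled u \<and> C2_on (ball 0 R) (rescale (pos_fun u)) \<and>
      (\<forall>x\<in>ball 0 R. C2_close_at (rescale (pos_fun u)) (bubble 0 \<mu>) \<epsilon> x)" by blast
  qed
qed

lemma negative_part_close:
  fixes R \<delta> \<epsilon> \<mu> :: real
  assumes n: "DIM('a::euclidean_space) \<ge> 7" and \<mu>: "\<mu> = sqrt (real DIM('a) * (real DIM('a) - 2))"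
    and R: "R > 0" and \<delta>: "\<delta> > 0" and \<epsilon>: "\<epsilon> > 0"
  obtains t where "t > 0" "\<And>lam u. 0 < lam \<Longrightarrow> lam \<le> t \<Longrightarrow>
    radial_sign_changing_solution lam (u :: 'a \<Rightarrow> real) \<Longrightarrow> u 0 > 0 \<Longrightarrow>
    ball 0 R - cball 0 \<delta> \<subseteq> annulus_rescaled u \<and> C2_on (ball 0 R - cball 0 \<delta>) (rescale (neg_fun u)) \<and>
    (\<forall>x\<in>ball 0 R - cball 0 \<delta>. C2_close_at (rescale (neg_fun u)) (bubble 0 \<mu>) \<epsilon> x)"
proof -
  obtain e :: 'a where e: "e \<in> Basis" using nonempty_Basis by blast
  have \<epsilon>': "\<epsilon> / (3 + R) > 0" using \<epsilon> R by simp
  obtain \<theta> where th: "\<theta> > 0" "\<And>b eps L v v1 v2 s. radial_ode DIM('a) b eps L v v1 v2 \<Longrightarrow> eps \<le> \<theta> \<Longrightarrow>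
    0 \<le> s \<Longrightarrow> s \<le> \<theta> \<Longrightarrow> s = 0 \<or> 0 < \<delta> \<Longrightarrow> s < L \<Longrightarrow> v s = 1 \<Longrightarrow> v1 s = 0 \<Longrightarrow> v L = 0 \<Longrightarrow>
    R < L \<and> (\<forall>r. s \<le> r \<and> r \<le> R \<longrightarrow> 0 < v r) \<and> (\<forall>r. 0 < r \<and> \<delta> \<le> r \<and> r \<le> R \<longrightarrow> s \<le> r \<and>
      \<bar>v r - bubble_profile DIM('a) r\<bar> \<le> \<epsilon> / (3 + R) \<and> \<bar>v1 r - bubble_profile1 DIM('a) r\<bar> \<le> \<epsilon> / (3 + R) * r \<and>
      \<bar>v2 r - bubble_profile2 DIM('a) r\<bar> \<le> \<epsilon> / (3 + R))"
    using bubble_close_C2[OF n R \<epsilon>' less_imp_le[OF \<delta>]] by blast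
  \<comment> \<open>The rescaled minimum must be below \<open>\<theta>\<close> for the comparison
    with the bubble and below \<open>\<delta>\<close> for the region to avoid it.\<close>
  have th\<delta>: "min \<theta> \<delta> > 0" using th(1) \<delta> by simp
  obtain e0 where e0: "e0 > 0" "\<And>b eps L v v1 v2 r1 s. radial_ode DIM('a) b eps L v v1 v2 \<Longrightarrow>
    eps * v 0 powr (- 2 * b) \<le> e0 \<Longrightarrow> 0 < r1 \<Longrightarrow> r1 \<le> s \<Longrightarrow> s < L \<Longrightarrow>
    (\<And>t. 0 \<le> t \<Longrightarrow> t < r1 \<Longrightarrow> 0 < v t) \<Longrightarrow> v r1 = 0 \<Longrightarrow> v1 s = 0 \<Longrightarrow> v L = 0 \<Longrightarrow>
    (\<And>t. r1 \<le> t \<Longrightarrow> t \<le> s \<Longrightarrow> \<bar>v t\<bar> \<le> \<bar>v s\<bar>) \<Longrightarrow> \<bar>v s\<bar> powr b * s \<le> min \<theta> \<delta>"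
    using second_bump_small[OF n th\<delta>] by blast
  show thesis
  proof (rule that[of "min (min \<theta> 1) e0"])
    show "min (min \<theta> 1) e0 > 0" using th(1) e0(1) by simp
    fix lam :: real and u :: "'a \<Rightarrow> real"
    assume lam_pos: "0 < lam" and lam_le: "lam \<le> min (min \<theta> 1) e0" and sol: "radial_sign_changing_solution lam u" and u0: "u 0 > 0"
    define b where "b = beta_exp TYPE('a)"
    interpret radial_nodal_solution u lam e "DIM('a)" b by unfold_locales (use n sol u0 lam_pos lam_le e in \<open>auto simp: b_def\<close>)
    obtain r1 s where rs: "0 < r1" "r1 < s" "s < 1" "\<And>t. 0 \<le> t \<Longrightarrow> t < r1 \<Longrightarrow> 0 < \<phi> t" "\<phi> r1 = 0"
      "\<phi> s < 0" "\<phi>1 s = 0" "\<And>t. r1 \<le> t \<Longrightarrow> t \<le> s \<Longrightarrow> \<bar>\<phi> t\<bar> \<le> \<bar>\<phi> s\<bar>"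
      "\<And>t. 0 \<le> t \<Longrightarrow> t \<le> 1 \<Longrightarrow> \<phi> s \<le> \<phi> t"
      using nodal_structure by blast
    define c where "c = \<phi> s"
    have c: "c < 0" using rs by (simp add: c_def)
    define k where "k = \<bar>c\<bar> powr b"
    have k: "k > 0" using c by (simp add: k_def)
    have m1: "1 \<le> (- \<phi> s) powr (2 * b)"
      using rs lam_pos lam_le by (intro min_powr_ge_1) auto
    moreover have "(- \<phi> s) powr (2 * b) \<le> \<phi> 0 powr (2 * b)"
      using abs_le_center[of s] rs b_gt_0 by (intro powr_mono2) auto
    ultimately have a1: "1 \<le> \<phi> 0 powr (2 * b)" by linarith
    \<comment> \<open>Used for two normalisations: by the minimum value for the comparison with the
      bubble, and by \<open>\<phi> 0\<close> for the Pohozaev estimate.\<close>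
    have small: "lam * m powr (- 2 * b) \<le> lam" if "1 \<le> m powr (2 * b)" for m
      using that lam_pos lam_le powr_minus_divide[of m "2 * b"] by (intro mult_right_le_one_le) (auto simp: divide_le_eq)
    have eps: "lam * \<bar>c\<bar> powr (- 2 * b) \<le> \<theta>" proof -
      have "\<bar>c\<bar> = - \<phi> s" "lam \<le> \<theta>" using c lam_le by (auto simp: c_def)
      then show ?thesis using small[OF m1] by (simp only:)
    qed
    have "\<bar>\<phi> s\<bar> powr b * s \<le> min \<theta> \<delta>"
    proof (rule e0(2)[OF o.radial_ode_axioms _ rs(1) less_imp_le[OF rs(2)] rs(3) rs(4,5,7) \<phi>_1 rs(8)])
      show "lam * \<phi> 0 powr (- 2 * b) \<le> e0" using small[OF a1] lam_le by linarith
    qed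
    then have ks: "k * s \<le> \<theta>" "k * s \<le> \<delta>" by (auto simp: k_def c_def)
    have "W c k = 0" using k \<phi>_1 by (simp add: W_def k_def)
    moreover have "W c (k * s) = 1" "W1 c (k * s) = 0" using c rs k by (auto simp: W_def W1_def c_def k_def)
    moreover have "0 \<le> k * s" "k * s < k" using rs k by auto
    ultimately have cl: "R < k" "\<And>r. k * s \<le> r \<Longrightarrow> r \<le> R \<Longrightarrow> 0 < W c r"
      "\<And>r. 0 < r \<Longrightarrow> \<delta> \<le> r \<Longrightarrow> r \<le> R \<Longrightarrow> \<bar>W c r - bubble_profile DIM('a) r\<bar> \<le> \<epsilon> / (3 + R) \<and>
        \<bar>W1 c r - bubble_profile1 DIM('a) r\<bar> \<le> \<epsilon> / (3 + R) * r \<and> \<bar>W2 c r - bubble_profile2 DIM('a) r\<bar> \<le> \<epsilon> / (3 + R)"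
      using th(2)[OF W_ode eps, of "k * s"] c ks \<delta> unfolding k_def by auto
    have sup: "sup_norm (neg_fun u) = \<bar>c\<bar>"
      using sup_norm_neg_fun[of s] rs c by (simp add: c_def)
    have node: "node u = r1" using rs(2,3) by (intro node_eq[OF rs(1) _ rs(5,4)]) auto
    \<comment> \<open>The inner radius of the rescaled annulus is \<open>k * r1\<close>, which lies
      below the rescaled minimum and hence below \<open>\<delta>\<close>.\<close>
    have "k * r1 < k * s" using k rs(2) by simp
    then have sub: "ball 0 R - cball 0 \<delta> \<subseteq> annulus_rescaled u"
      using ks(2) cl(1) unfolding annulus_rescaled_def sup node
      by (auto simp: k_def b_def)
    define S where "S = ball (0::'a) R - cball 0 \<delta>"
    have S: "open S" "0 \<notin> S" "S \<subseteq> ball 0 k" using \<delta> cl(1) by (auto simp: S_def open_Diff)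
    have f_eq: "rescale (neg_fun u) y = 1 / c * u (y /\<^sub>R k)" if y: "y \<in> S" for y
    proof -
      have y1: "\<delta> < norm y" "norm y < R" using y by (auto simp: S_def)
      have nk: "norm (y /\<^sub>R k) = norm y / k" using k by (simp add: divide_inverse mult.commute)
      have "u (y /\<^sub>R k) = \<phi> (norm y / k)"
        using u_eq[of "y /\<^sub>R k"] y1 cl(1) k unfolding nk by (simp add: divide_le_eq)
      moreover have "\<phi> (norm y / k) < 0"
        using cl(2)[of "norm y"] y1 ks c by (simp add: W_def k_def zero_less_divide_iff)
      ultimately show ?thesis
        using c unfolding rescale_def sup by (simp add: neg_fun_def k_def b_def)
    qed
    have C2f: "C2_on S (rescale (neg_fun u))"
      using C2_on_cong[OF S(1), of "rescale (neg_fun u)" "\<lambda>y. 1 / c * u (y /\<^sub>R k)"] f_eq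
        C2_on_subset[OF C2_on_scale(1)[OF C2 k, of "1 / c"] S(3)] by blast
    have close: "C2_close_at (rescale (neg_fun u)) (bubble 0 \<mu>) \<epsilon> x" if x: "x \<in> S" for x
    proof (rule radial_profile_C2_close_at[where R = R])
      show "radial_profile S (rescale (neg_fun u)) (W c) (W1 c) (W2 c)"
        using c S f_eq by (intro W_profile) (auto simp: k_def)
      show "radial_profile S (bubble 0 \<mu>) (bubble_profile DIM('a)) (bubble_profile1 DIM('a)) (bubble_profile2 DIM('a))"
        by (rule radial_profile_bubble[OF n \<mu> S(1,2)])
      have "x \<noteq> 0" "\<delta> \<le> norm x" "norm x \<le> R" using x S(2) by (auto simp: S_def)
      then show "norm x \<le> R" "\<bar>W c (norm x) - bubble_profile DIM('a) (norm x)\<bar> \<le> \<epsilon> / (3 + R)"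
        "\<bar>W1 c (norm x) - bubble_profile1 DIM('a) (norm x)\<bar> \<le> \<epsilon> / (3 + R) * norm x"
        "\<bar>W2 c (norm x) - bubble_profile2 DIM('a) (norm x)\<bar> \<le> \<epsilon> / (3 + R)"
        using cl(3)[of "norm x"] by auto
    qed (use x \<epsilon> in auto)
    show "ball 0 R - cball 0 \<delta> \<subseteq> annulus_rescaled u \<and> C2_on (ball 0 R - cball 0 \<delta>) (rescale (neg_fun u)) \<and>
      (\<forall>x\<in>ball 0 R - cball 0 \<delta>. C2_close_at (rescale (neg_fun u)) (bubble 0 \<mu>) \<epsilon> x)"
      using sub C2f close unfolding S_def by blast
  qed
qed

theorem theorem1:
  fixes u :: "real \<Rightarrow> real ^ 'n \<Rightarrow> real" and \<mu> :: real
  assumes "CARD('n) \<ge> 7"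
    and "\<And>lam. 0 < lam \<Longrightarrow> lam < first_dirichlet_eigenvalue TYPE(real ^ 'n) \<Longrightarrow>
           least_energy_radial_sign_changing_solution lam (u lam)"
    and "\<And>lam. 0 < lam \<Longrightarrow> lam < first_dirichlet_eigenvalue TYPE(real ^ 'n) \<Longrightarrow> u lam 0 > 0"
    and "\<mu> = sqrt (real CARD('n) * (real CARD('n) - 2))"
  shows "C2_loc_tendsto (\<lambda>lam. ball_rescaled (u lam)) (\<lambda>lam. rescale (pos_fun (u lam)))
           (bubble 0 \<mu>) UNIV (at_right 0) \<and>
         C2_loc_tendsto (\<lambda>lam. annulus_rescaled (u lam)) (\<lambda>lam. rescale (neg_fun (u lam)))
           (bubble 0 \<mu>) (UNIV - {0}) (at_right 0)"
proof -
  have n: "DIM(real ^ 'n) \<ge> 7" using assms(1) by simp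
  have \<mu>: "\<mu> = sqrt (real DIM(real ^ 'n) * (real DIM(real ^ 'n) - 2))" using assms(4) by simp
  define \<Lambda> where "\<Lambda> = first_dirichlet_eigenvalue TYPE(real ^ 'n)"
  \<comment> \<open>Makes parameters near \<open>0\<close> fall into the range where the family is
    given.\<close>
  have \<Lambda>: "\<Lambda> > 0" unfolding \<Lambda>_def by (rule first_dirichlet_eigenvalue_pos[OF n])
  have sol: "radial_sign_changing_solution lam (u lam)" "u lam 0 > 0" if "0 < lam" "lam < \<Lambda>" for lam
    using assms(2,3)[of lam] that unfolding \<Lambda>_def least_energy_radial_sign_changing_solution_def by auto
  have evI: "\<forall>\<^sub>F lam in at_right 0. Q lam"
    if "t > 0" "\<And>lam. 0 < lam \<Longrightarrow> lam \<le> t \<Longrightarrow> lam < \<Lambda> \<Longrightarrow> Q lam" for Q t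
    unfolding eventually_at_right_field using that \<Lambda> by (intro exI[of _ "min t \<Lambda>"]) auto
  show ?thesis
  proof (intro conjI C2_loc_tendstoI C2_on_bubble[OF n \<mu>])
    fix K :: "(real ^ 'n) set" and \<epsilon> :: real
    assume K: "compact K" and \<epsilon>: "\<epsilon> > 0"
    obtain R where R: "R > 0" "K \<subseteq> ball 0 R"
      using bounded_subset_ballD[OF compact_imp_bounded[OF K], of 0] by auto
    obtain t where t: "t > 0" "\<And>lam v. 0 < lam \<Longrightarrow> lam \<le> t \<Longrightarrow>
      radial_sign_changing_solution lam (v :: real ^ 'n \<Rightarrow> real) \<Longrightarrow> v 0 > 0 \<Longrightarrow>
      ball 0 R \<subseteq> ball_rescaled v \<and> C2_on (ball 0 R) (rescale (pos_fun v)) \<and>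
      (\<forall>x\<in>ball 0 R. C2_close_at (rescale (pos_fun v)) (bubble 0 \<mu>) \<epsilon> x)"
      using positive_part_close[OF n \<mu> R(1) \<epsilon>] by blast
    show "\<forall>\<^sub>F lam in at_right 0. (\<exists>U. open U \<and> K \<subseteq> U \<and> U \<subseteq> ball_rescaled (u lam) \<and> C2_on U (rescale (pos_fun (u lam)))) \<and>
      (\<forall>x\<in>K. C2_close_at (rescale (pos_fun (u lam))) (bubble 0 \<mu>) \<epsilon> x)"
    proof (rule evI[OF t(1)])
      fix lam :: real assume "0 < lam" "lam \<le> t" "lam < \<Lambda>"
      with t(2)[of lam "u lam"] sol[of lam] R(2) show "(\<exists>U. open U \<and> K \<subseteq> U \<and> U \<subseteq> ball_rescaled (u lam) \<and>
          C2_on U (rescale (pos_fun (u lam)))) \<and> (\<forall>x\<in>K. C2_close_at (rescale (pos_fun (u lam))) (bubble 0 \<mu>) \<epsilon> x)"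
        by (intro conjI exI[of _ "ball 0 R"]) auto
    qed
  next
    fix K :: "(real ^ 'n) set" and \<epsilon> :: real
    assume K: "compact K" "K \<subseteq> UNIV - {0}" and \<epsilon>: "\<epsilon> > 0"
    obtain R where R: "R > 0" "K \<subseteq> ball 0 R"
      using bounded_subset_ballD[OF compact_imp_bounded[OF K(1)], of 0] by auto
    \<comment> \<open>A compact set missing the origin stays at positive distance from it, which
      supplies the cut-off \<open>\<delta>\<close>.\<close>
    have "open (- K)" "0 \<in> - K" using K compact_imp_closed by (auto simp: open_Compl)
    then obtain \<delta> where \<delta>: "\<delta> > 0" "cball 0 \<delta> \<subseteq> - K" using open_contains_cball by metis
    obtain t where t: "t > 0" "\<And>lam v. 0 < lam \<Longrightarrow> lam \<le> t \<Longrightarrow>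
      radial_sign_changing_solution lam (v :: real ^ 'n \<Rightarrow> real) \<Longrightarrow> v 0 > 0 \<Longrightarrow>
      ball 0 R - cball 0 \<delta> \<subseteq> annulus_rescaled v \<and> C2_on (ball 0 R - cball 0 \<delta>) (rescale (neg_fun v)) \<and>
      (\<forall>x\<in>ball 0 R - cball 0 \<delta>. C2_close_at (rescale (neg_fun v)) (bubble 0 \<mu>) \<epsilon> x)"
      using negative_part_close[OF n \<mu> R(1) \<delta>(1) \<epsilon>] by blast
    have KU: "K \<subseteq> ball 0 R - cball 0 \<delta>" using R(2) \<delta>(2) by auto
    show "\<forall>\<^sub>F lam in at_right 0. (\<exists>U. open U \<and> K \<subseteq> U \<and> U \<subseteq> annulus_rescaled (u lam) \<and> C2_on U (rescale (neg_fun (u lam)))) \<and>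
      (\<forall>x\<in>K. C2_close_at (rescale (neg_fun (u lam))) (bubble 0 \<mu>) \<epsilon> x)"
    proof (rule evI[OF t(1)])
      fix lam :: real assume lam: "0 < lam" "lam \<le> t" "lam < \<Lambda>"
      have "open (ball (0::real ^ 'n) R - cball 0 \<delta>)" by (intro open_Diff) auto
      with t(2)[of lam "u lam"] sol[of lam] KU lam show "(\<exists>U. open U \<and> K \<subseteq> U \<and> U \<subseteq> annulus_rescaled (u lam) \<and>
          C2_on U (rescale (neg_fun (u lam)))) \<and> (\<forall>x\<in>K. C2_close_at (rescale (neg_fun (u lam))) (bubble 0 \<mu>) \<epsilon> x)"
        by (intro conjI exI[of _ "ball 0 R - cball 0 \<delta>"]) auto
    qed
  qed
qed

end
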